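(* Let $(D\to B;A\to M)$ be a $\mathcal{VB}$-algebroid with core $C$, let $h:\Gamma(A)\to\Gamma_\ell(B,D)$ be a horizontal lift for $D$ and let $h^\top:\Gamma(A)\to\Gamma_\ell(C^*,D_A^* )$ be the corresponding horizontal lift for the vertical dual $D_A^*$, endowed with its dual $\mathcal{VB}$-algebroid structure $(D_A^*\to C^*;A\to M)$. Let $(\partial,\nabla,K)$ be the structure operators of the representation up to homotopy of $A$ on $C_{[0]}\oplus B_{[1]}$ associated to $(D,h)$ and $(\partial^{\rm ver},\nabla^{\rm ver},K^{\rm ver})$ those of the representation up to homotopy of $A$ on $B^*_{[0]}\oplus C^*_{[1]}$ associated to $(D_A^*,h^\top)$. Then $(\partial^{\rm ver},\nabla^{\rm ver},K^{\rm ver})$ coincide with the structure operators of the dual representation $(C_{[0]}\oplus B_{[1]})^\top$, that is, $$\partial^{\rm ver}=\partial^*,\qquad \nabla^{\rm ver}=\nabla^*,\qquad K^{\rm ver}=-K^*.$$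
   Context: **Double vector bundles.** A double vector bundle $(D;A,B;M)$ is a commutative square of vector bundles $q^D_B:D\to B$, $q^D_A:D\to A$, $A\to M$, $q_B:B\to M$ such that $q^D_B$ is a vector bundle morphism over $A\to M$ and the addition of $D\to B$ is a vector bundle morphism over the addition of $A\to M$. Its core $C$ is the intersection of the kernels of $D\to A$ and $D\to B$. For $c\in\Gamma(C)$ the core section $\widehat c\in\Gamma(B,D)$ is $b_m\mapsto 0_{b_m}+_Ac(m)$ (addition in $D\to A$). A section of $D\to B$ is linear (in $\Gamma_\ell(B,D)$) if it is a vector bundle morphism from $B\to M$ to $D\to A$; it covers a section of $A$. For $T\in\Gamma(B^*\otimes C)$, $\widehat T\in\Gamma_\ell(B,D)$ is $b_m\mapsto0_{b_m}+_AT(b_m)$. A horizontal lift is a $C^\infty(M)$-linear map $h:\Gamma(A)\to\Gamma_\ell(B,D)$ with $h(a)$ covering $a$. Horizontal lifts correspond to decompositions, i.e. double vector bundle isomorphisms $\sigma:A\oplus B\oplus C\to D$ inducing identities on $A,B,C$, via $h(a)(b_m)=\sigma(a(m),b_m,0)$. **$\mathcal{VB}$-algebroids.** $(D\to B;A\to M)$ is a $\mathcal{VB}$-algebroid if $D\to B$ is a Lie algebroid whose anchor $\rho_D:D\to TB$ is a bundle morphism over a map $\rho_A:A\to TM$, brackets of linear sections are linear, the bracket of a linear and a core section is a core section, and core sections have zero bracket. Then $A$ inherits a Lie algebroid structure with anchor $\rho_A$ and bracket given by covering. Given $h$, the associated representation up to homotopy $(\partial,\nabla,K)$ of $A$ on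 $C_{[0]}\oplus B_{[1]}$ ($C$ in degree 0, $B$ in degree 1), consisting of $\partial:C\to B$, $A$-connections $\nabla^0$ on $C$ and $\nabla^1$ on $B$, and $K\in\Omega^2(A;\mathrm{Hom}(B,C))$, is defined by: $\rho_D(\widehat c)=\partial(c)^\uparrow$ (vertical lift); $\rho_D(h(a))$ is the linear vector field $X$ on $B$ with $X(\ell_\psi)=\ell_{(\nabla^1_a)^*\psi}$ for $\psi\in\Gamma(B^* )$ ($\ell_\psi$ the fibrewise linear function); $[h(a),\widehat c]_D=\widehat{\nabla^0_ac}$; $[h(a_1),h(a_2)]_D=h([a_1,a_2]_A)+\widehat{K(a_1,a_2)}$. **Dual representation.** For $(\partial,\nabla,K)$ on $V_0\oplus V_1$, the dual $V^\top$ has $V^\top_0=V_1^*$, $V^\top_1=V_0^*$ and structure operators $(\partial^*,\nabla^*,-K^* )$, where $\langle\nabla^*_a\xi,v\rangle+\langle\xi,\nabla_av\rangle=\mathcal L_{\rho_A(a)}\langle\xi,v\rangle$. **Duals of $D$.** Let $D_B^*\to B$ (projection $p_B$) and $D_A^*\to A$ (projection $p_A$) be the dual bundles of $D\to B$ and $D\to A$. Both are also vector bundles over $C^*$: $D_B^*$ (horizontal dual) is a double vector bundle with sides $B,C^*$ and core $A^*$, with projection $p^{\rm hor}_{C^*}$, $\langle p^{\rm hor}_{C^*}(\xi),c_m\rangle=\langle\xi,0_{b_m}+_Ac_m\rangle$ for $\xi$ over $b_m$; $D_A^*$ (vertical dual) is similarly a double vector bundle with sides $A,C^*$ and core $B^*$.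 The bundles $D_A^*\to C^*$ and $D_B^*\to C^*$ are in duality via the nondegenerate pairing $\Vert\Theta,\Psi\Vert=\langle\Psi,d\rangle_B-\langle\Theta,d\rangle_A$, for any $d\in D$ with $q^D_A(d)=p_A(\Theta)$, $q^D_B(d)=p_B(\Psi)$. For $\Theta\in\Gamma(C^*,D_A^* )$ let $\ell^{C^*}_\Theta\in C^\infty(D_B^* )$ be $\ell^{C^*}_\Theta(\Psi)=\Vert\Theta(p^{\rm hor}_{C^*}(\Psi)),\Psi\Vert$. **Dual $\mathcal{VB}$-algebroid.** The Lie algebroid $D\to B$ defines a linear Poisson structure on $D_B^*$ by $\{\ell_{\chi_1},\ell_{\chi_2}\}=\ell_{[\chi_1,\chi_2]_D}$, $\{\ell_\chi,f\circ p_B\}=(\mathcal L_{\rho_D(\chi)}f)\circ p_B$, $\{f\circ p_B,g\circ p_B\}=0$. It is also linear over $C^*$, and the Lie algebroid structure on $D_A^*\to C^*$ is determined by $\ell^{C^*}_{[\Theta_1,\Theta_2]}=\{\ell^{C^*}_{\Theta_1},\ell^{C^*}_{\Theta_2}\}$ and $(\mathcal L_{\rho_{D_A^*}(\Theta)}g)\circ p^{\rm hor}_{C^*}=\{\ell^{C^*}_\Theta,g\circ p^{\rm hor}_{C^*}\}$; this makes $(D_A^*\to C^*;A\to M)$ a $\mathcal{VB}$-algebroid. **The lift $h^\top$.** If $\sigma_h:A\oplus B\oplus C\to D$ is the decomposition of $h$, the inverse of its dual over $A$, $(\sigma_h)_A^{*\,-1}:A\oplus C^*\oplus B^*\to D_A^*$,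 is a decomposition of $D_A^*$, and $h^\top$ is its horizontal lift: $h^\top(a)(\gamma_m)=(\sigma_h)_A^{*\,-1}(a(m),\gamma_m,0)$. *)

theory Defs
  imports "HOL-Analysis.Analysis"
begin

section \<open>Smooth manifolds\<close>

text \<open>
  A manifold is a set of points together with its algebra of global smooth real functions. The
  topology is the initial topology of these functions. Everything is extensional: functions,
  sections, functionals and derivations are \<open>undefined\<close> outside their domain, so that
  HOL equality is mathematical equality.

  \<open>\<real>\<^sup>n\<close> is the set \<open>Rn n\<close> of sequences vanishing from index \<open>n\<close> on, so that dimensions
  and ranks are natural numbers, zero included.
\<close>

definition Rn :: "nat \<Rightarrow> (nat \<Rightarrow> real) set" where
  "Rn n = {x. \<forall>i\<ge>n. x i = 0}"

text \<open>\<open>C\<^sup>\<infinity>\<close> on an open \<open>V \<subseteq> \<real>\<^sup>n\<close>: partial derivatives of all orders exist and are continuous.\<close>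

coinductive smooth_Rn :: "nat \<Rightarrow> (nat \<Rightarrow> real) set \<Rightarrow> ((nat \<Rightarrow> real) \<Rightarrow> real) \<Rightarrow> bool" for n V where
  "\<lbrakk>continuous_on V f;
    \<And>i x. \<lbrakk>i < n; x \<in> V\<rbrakk> \<Longrightarrow> ((\<lambda>t. f (x(i := t))) has_real_derivative g i x) (at (x i));
    \<And>i. i < n \<Longrightarrow> smooth_Rn n V (g i)\<rbrakk>
   \<Longrightarrow> smooth_Rn n V f"

record 'a dspace =
  pts :: "'a set"
  smf :: "('a \<Rightarrow> real) set"

definition init_top :: "'a set \<Rightarrow> ('a \<Rightarrow> real) set \<Rightarrow> 'a topology" where
  "init_top X F =
     topology_generated_by (insert X {{x \<in> X. f x \<in> U} | f U. f \<in> F \<and> open U})"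

text \<open>The smooth structure generated by \<open>F\<close>: functions that are locally smooth functions of
  finitely many generators.\<close>

definition gen :: "'a set \<Rightarrow> ('a \<Rightarrow> real) set \<Rightarrow> 'a dspace" where
  "gen X F = \<lparr>pts = X,
     smf = {f \<in> extensional X. \<forall>p\<in>X. \<exists>k g G W.
       (\<forall>i<k. g i \<in> F) \<and> smooth_Rn k (Rn k) G \<and> openin (init_top X F) W \<and> p \<in> W \<and>
       (\<forall>q\<in>W. f q = G (\<lambda>i. if i < k then g i q else 0))}\<rparr>"

definition dtop :: "'a dspace \<Rightarrow> 'a topology" where
  "dtop X = init_top (pts X) (smf X)"

definition pull :: "'a dspace \<Rightarrow> ('a \<Rightarrow> 'b) \<Rightarrow> ('b \<Rightarrow> real) \<Rightarrow> 'a \<Rightarrow> real" where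
  "pull X \<phi> g = (\<lambda>x\<in>pts X. g (\<phi> x))"

definition smooth_map :: "'a dspace \<Rightarrow> 'b dspace \<Rightarrow> ('a \<Rightarrow> 'b) \<Rightarrow> bool" where
  "smooth_map X Y \<phi> \<longleftrightarrow> \<phi> \<in> pts X \<rightarrow> pts Y \<and> (\<forall>g\<in>smf Y. pull X \<phi> g \<in> smf X)"

definition diffeo :: "'a dspace \<Rightarrow> 'b dspace \<Rightarrow> ('a \<Rightarrow> 'b) \<Rightarrow> bool" where
  "diffeo X Y \<phi> \<longleftrightarrow> bij_betw \<phi> (pts X) (pts Y) \<and> smooth_map X Y \<phi> \<and>
     smooth_map Y X (inv_into (pts X) \<phi>)"

definition Rn_space :: "nat \<Rightarrow> (nat \<Rightarrow> real) set \<Rightarrow> (nat \<Rightarrow> real) dspace" where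
  "Rn_space n V = \<lparr>pts = V, smf = {f \<in> extensional V. smooth_Rn n V f}\<rparr>"

definition subsp :: "'a dspace \<Rightarrow> 'a set \<Rightarrow> 'a dspace" where
  "subsp X S = gen S ((\<lambda>f. restrict f S) ` smf X)"

definition prodsp :: "'a dspace \<Rightarrow> 'b dspace \<Rightarrow> ('a \<times> 'b) dspace" where
  "prodsp X Y = gen (pts X \<times> pts Y)
     ({(\<lambda>z\<in>pts X \<times> pts Y. f (fst z)) | f. f \<in> smf X} \<union>
      {(\<lambda>z\<in>pts X \<times> pts Y. g (snd z)) | g. g \<in> smf Y})"

definition manifold :: "'a dspace \<Rightarrow> bool" where
  "manifold X \<longleftrightarrow> gen (pts X) (smf X) = X \<and>
     Hausdorff_space (dtop X) \<and> second_countable (dtop X) \<and>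
     (\<exists>n. \<forall>p\<in>pts X. \<exists>U V \<phi>. openin (dtop X) U \<and> p \<in> U \<and>
        openin (top_of_set (Rn n)) V \<and> diffeo (subsp X U) (Rn_space n V) \<phi>)"


section \<open>Vector bundles\<close>

record ('e, 'm) vbun =
  tot :: "'e dspace"
  bas :: "'m dspace"
  prj :: "'e \<Rightarrow> 'm"
  vadd :: "'e \<Rightarrow> 'e \<Rightarrow> 'e"
  vscl :: "real \<Rightarrow> 'e \<Rightarrow> 'e"
  vzero :: "'m \<Rightarrow> 'e"

definition fib :: "('e, 'm) vbun \<Rightarrow> 'm \<Rightarrow> 'e set" where
  "fib E m = {e \<in> pts (tot E). prj E e = m}"

definition fibres_vector_spaces :: "('e, 'm) vbun \<Rightarrow> bool" where
  "fibres_vector_spaces E \<longleftrightarrow> (\<forall>m\<in>pts (bas E).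
     vzero E m \<in> fib E m \<and>
     (\<forall>u\<in>fib E m. \<forall>v\<in>fib E m. vadd E u v \<in> fib E m \<and> vadd E u v = vadd E v u) \<and>
     (\<forall>u\<in>fib E m. \<forall>v\<in>fib E m. \<forall>w\<in>fib E m.
        vadd E (vadd E u v) w = vadd E u (vadd E v w)) \<and>
     (\<forall>u\<in>fib E m. vadd E (vzero E m) u = u \<and> vadd E u (vscl E (-1) u) = vzero E m \<and>
        vscl E 1 u = u) \<and>
     (\<forall>r. \<forall>u\<in>fib E m. vscl E r u \<in> fib E m) \<and>
     (\<forall>r s. \<forall>u\<in>fib E m. vscl E r (vscl E s u) = vscl E (r * s) u \<and>
        vscl E (r + s) u = vadd E (vscl E r u) (vscl E s u)) \<and>
     (\<forall>r. \<forall>u\<in>fib E m. \<forall>v\<in>fib E m.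
        vscl E r (vadd E u v) = vadd E (vscl E r u) (vscl E r v)))"

definition local_trivialisation ::
  "('e, 'm) vbun \<Rightarrow> nat \<Rightarrow> 'm set \<Rightarrow> ('e \<Rightarrow> 'm \<times> (nat \<Rightarrow> real)) \<Rightarrow> bool" where
  "local_trivialisation E r U \<Phi> \<longleftrightarrow>
     diffeo (subsp (tot E) {e \<in> pts (tot E). prj E e \<in> U})
            (prodsp (subsp (bas E) U) (Rn_space r (Rn r))) \<Phi> \<and>
     (\<forall>m\<in>U. \<forall>u\<in>fib E m. fst (\<Phi> u) = m \<and>
        (\<forall>c. snd (\<Phi> (vscl E c u)) = (\<lambda>i. c * snd (\<Phi> u) i)) \<and>
        (\<forall>v\<in>fib E m. snd (\<Phi> (vadd E u v)) = (\<lambda>i. snd (\<Phi> u) i + snd (\<Phi> v) i)))"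

definition vector_bundle :: "('e, 'm) vbun \<Rightarrow> bool" where
  "vector_bundle E \<longleftrightarrow> manifold (tot E) \<and> manifold (bas E) \<and>
     smooth_map (tot E) (bas E) (prj E) \<and> fibres_vector_spaces E \<and>
     (\<exists>r. \<forall>m\<in>pts (bas E). \<exists>U \<Phi>. openin (dtop (bas E)) U \<and> m \<in> U \<and>
        local_trivialisation E r U \<Phi>)"

definition vb_morphism ::
  "('e, 'm) vbun \<Rightarrow> ('f, 'n) vbun \<Rightarrow> ('e \<Rightarrow> 'f) \<Rightarrow> ('m \<Rightarrow> 'n) \<Rightarrow> bool" where
  "vb_morphism E F \<Phi> \<phi> \<longleftrightarrow>
     smooth_map (tot E) (tot F) \<Phi> \<and> smooth_map (bas E) (bas F) \<phi> \<and>
     (\<forall>u\<in>pts (tot E). prj F (\<Phi> u) = \<phi> (prj E u) \<and>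
        (\<forall>r. \<Phi> (vscl E r u) = vscl F r (\<Phi> u)) \<and>
        (\<forall>v\<in>pts (tot E). prj E u = prj E v \<longrightarrow>
           \<Phi> (vadd E u v) = vadd F (\<Phi> u) (\<Phi> v)))"

definition Sect :: "('e, 'm) vbun \<Rightarrow> ('m \<Rightarrow> 'e) set" where
  "Sect E = {s \<in> extensional (pts (bas E)).
     smooth_map (bas E) (tot E) s \<and> (\<forall>m\<in>pts (bas E). prj E (s m) = m)}"

definition sadd :: "('e, 'm) vbun \<Rightarrow> ('m \<Rightarrow> 'e) \<Rightarrow> ('m \<Rightarrow> 'e) \<Rightarrow> 'm \<Rightarrow> 'e" where
  "sadd E s t = (\<lambda>m\<in>pts (bas E). vadd E (s m) (t m))"

definition smul :: "('e, 'm) vbun \<Rightarrow> ('m \<Rightarrow> real) \<Rightarrow> ('m \<Rightarrow> 'e) \<Rightarrow> 'm \<Rightarrow> 'e" where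
  "smul E f s = (\<lambda>m\<in>pts (bas E). vscl E (f m) (s m))"

definition szero :: "('e, 'm) vbun \<Rightarrow> 'm \<Rightarrow> 'e" where
  "szero E = (\<lambda>m\<in>pts (bas E). vzero E m)"

text \<open>Elements of the dual bundle are pairs of a base point and a functional on the fibre.\<close>

definition fib_dual :: "('e, 'm) vbun \<Rightarrow> 'm \<Rightarrow> ('e \<Rightarrow> real) set" where
  "fib_dual E m = {\<xi> \<in> extensional (fib E m).
     (\<forall>u\<in>fib E m. \<forall>v\<in>fib E m. \<xi> (vadd E u v) = \<xi> u + \<xi> v) \<and>
     (\<forall>r. \<forall>u\<in>fib E m. \<xi> (vscl E r u) = r * \<xi> u)}"

definition dual_pts :: "('e, 'm) vbun \<Rightarrow> ('m \<times> ('e \<Rightarrow> real)) set" where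
  "dual_pts E = Sigma (pts (bas E)) (fib_dual E)"

definition ell_sect :: "('e, 'm) vbun \<Rightarrow> ('m \<Rightarrow> 'e) \<Rightarrow> 'm \<times> ('e \<Rightarrow> real) \<Rightarrow> real" where
  "ell_sect E s = (\<lambda>\<xi>\<in>dual_pts E. snd \<xi> (s (fst \<xi>)))"

definition dual :: "('e, 'm) vbun \<Rightarrow> ('m \<times> ('e \<Rightarrow> real), 'm) vbun" where
  "dual E = \<lparr>
     tot = gen (dual_pts E)
       ({(\<lambda>\<xi>\<in>dual_pts E. f (fst \<xi>)) | f. f \<in> smf (bas E)} \<union> ell_sect E ` Sect E),
     bas = bas E,
     prj = fst,
     vadd = (\<lambda>\<xi> \<eta>. (fst \<xi>, \<lambda>u\<in>fib E (fst \<xi>). snd \<xi> u + snd \<eta> u)),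
     vscl = (\<lambda>r \<xi>. (fst \<xi>, \<lambda>u\<in>fib E (fst \<xi>). r * snd \<xi> u)),
     vzero = (\<lambda>m. (m, \<lambda>u\<in>fib E m. 0))\<rparr>"

definition ell :: "('e, 'm) vbun \<Rightarrow> ('m \<Rightarrow> 'm \<times> ('e \<Rightarrow> real)) \<Rightarrow> 'e \<Rightarrow> real" where
  "ell E \<psi> = (\<lambda>u\<in>pts (tot E). snd (\<psi> (prj E u)) u)"

definition dual_map :: "('e, 'm) vbun \<Rightarrow> ('f, 'm) vbun \<Rightarrow> ('e \<Rightarrow> 'f) \<Rightarrow>
    'm \<times> ('f \<Rightarrow> real) \<Rightarrow> 'm \<times> ('e \<Rightarrow> real)" where
  "dual_map E F \<Phi> \<eta> = (fst \<eta>, \<lambda>u\<in>fib E (fst \<eta>). snd \<eta> (\<Phi> u))"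

text \<open>The inverse of the dual \<open>\<Phi>\<^sup>* : F\<^sup>* \<rightarrow> E\<^sup>*\<close> of an isomorphism \<open>\<Phi> : E \<rightarrow> F\<close> over the identity.\<close>

definition dual_map_inv :: "('e, 'm) vbun \<Rightarrow> ('f, 'm) vbun \<Rightarrow> ('e \<Rightarrow> 'f) \<Rightarrow>
    'm \<times> ('e \<Rightarrow> real) \<Rightarrow> 'm \<times> ('f \<Rightarrow> real)" where
  "dual_map_inv E F \<Phi> \<xi> =
     (fst \<xi>, \<lambda>v\<in>fib F (fst \<xi>). snd \<xi> (inv_into (pts (tot E)) \<Phi> v))"


section \<open>Tangent bundles and vector fields\<close>

text \<open>Tangent vectors are pairs of a base point and a derivation of the smooth functions at it.\<close>

definition derivations :: "'a dspace \<Rightarrow> 'a \<Rightarrow> (('a \<Rightarrow> real) \<Rightarrow> real) set" where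
  "derivations X p = {v \<in> extensional (smf X).
     (\<forall>f\<in>smf X. \<forall>g\<in>smf X.
        v (\<lambda>x\<in>pts X. f x + g x) = v f + v g \<and>
        v (\<lambda>x\<in>pts X. f x * g x) = f p * v g + g p * v f) \<and>
     (\<forall>c. \<forall>f\<in>smf X. v (\<lambda>x\<in>pts X. c * f x) = c * v f)}"

definition tangent_pts :: "'a dspace \<Rightarrow> ('a \<times> (('a \<Rightarrow> real) \<Rightarrow> real)) set" where
  "tangent_pts X = Sigma (pts X) (derivations X)"

definition tangent :: "'a dspace \<Rightarrow> ('a \<times> (('a \<Rightarrow> real) \<Rightarrow> real), 'a) vbun" where
  "tangent X = \<lparr>
     tot = gen (tangent_pts X)
       ({(\<lambda>v\<in>tangent_pts X. f (fst v)) | f. f \<in> smf X} \<union>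
        {(\<lambda>v\<in>tangent_pts X. snd v f) | f. f \<in> smf X}),
     bas = X,
     prj = fst,
     vadd = (\<lambda>v w. (fst v, \<lambda>f\<in>smf X. snd v f + snd w f)),
     vscl = (\<lambda>r v. (fst v, \<lambda>f\<in>smf X. r * snd v f)),
     vzero = (\<lambda>p. (p, \<lambda>f\<in>smf X. 0))\<rparr>"

definition tangent_map :: "'a dspace \<Rightarrow> 'b dspace \<Rightarrow> ('a \<Rightarrow> 'b) \<Rightarrow>
    'a \<times> (('a \<Rightarrow> real) \<Rightarrow> real) \<Rightarrow> 'b \<times> (('b \<Rightarrow> real) \<Rightarrow> real)" where
  "tangent_map X Y \<phi> v = (\<phi> (fst v), \<lambda>g\<in>smf Y. snd v (pull X \<phi> g))"

definition lie :: "'a dspace \<Rightarrow> ('a \<Rightarrow> 'a \<times> (('a \<Rightarrow> real) \<Rightarrow> real)) \<Rightarrow> ('a \<Rightarrow> real) \<Rightarrow> 'a \<Rightarrow> real" where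
  "lie X \<X> f = (\<lambda>p\<in>pts X. snd (\<X> p) f)"

definition vertical_lift :: "('e, 'm) vbun \<Rightarrow> ('m \<Rightarrow> 'e) \<Rightarrow> 'e \<Rightarrow> 'e \<times> (('e \<Rightarrow> real) \<Rightarrow> real)" where
  "vertical_lift E s = (\<lambda>u\<in>pts (tot E).
     (u, \<lambda>f\<in>smf (tot E). deriv (\<lambda>t. f (vadd E u (vscl E t (s (prj E u))))) 0))"

definition fprod :: "'a dspace \<Rightarrow> ('a \<Rightarrow> 'm) \<Rightarrow> ('a \<times> 'a) dspace" where
  "fprod X q = subsp (prodsp X X) {z \<in> pts X \<times> pts X. q (fst z) = q (snd z)}"

text \<open>The bundle \<open>TE \<rightarrow> TM\<close>, whose structure maps are the tangent maps of those of \<open>E \<rightarrow> M\<close>;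
  \<open>T(E \<times>\<^sub>M E)\<close> is identified with \<open>TE \<times>\<^bsub>TM\<^esub> TE\<close> through the tangent maps of the projections.\<close>

definition tangent_prolongation :: "('e, 'm) vbun \<Rightarrow>
    ('e \<times> (('e \<Rightarrow> real) \<Rightarrow> real), 'm \<times> (('m \<Rightarrow> real) \<Rightarrow> real)) vbun" where
  "tangent_prolongation E = \<lparr>
     tot = tot (tangent (tot E)),
     bas = tot (tangent (bas E)),
     prj = tangent_map (tot E) (bas E) (prj E),
     vadd = (\<lambda>v w. let EE = fprod (tot E) (prj E) in
       tangent_map EE (tot E) (\<lambda>z. vadd E (fst z) (snd z))
         (THE x. x \<in> tangent_pts EE \<and> tangent_map EE (tot E) fst x = v \<and>
                 tangent_map EE (tot E) snd x = w)),
     vscl = (\<lambda>r. tangent_map (tot E) (tot E) (vscl E r)),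
     vzero = tangent_map (bas E) (tot E) (vzero E)\<rparr>"

definition linear_vector_field ::
  "('e, 'm) vbun \<Rightarrow> ('e \<Rightarrow> 'e \<times> (('e \<Rightarrow> real) \<Rightarrow> real)) \<Rightarrow> bool" where
  "linear_vector_field E \<X> \<longleftrightarrow> \<X> \<in> Sect (tangent (tot E)) \<and>
     (\<exists>Y\<in>Sect (tangent (bas E)). vb_morphism E (tangent_prolongation E) \<X> Y)"


section \<open>Lie algebroids, connections, Poisson brackets\<close>

definition lie_algebroid :: "('e, 'm) vbun \<Rightarrow>
    (('m \<Rightarrow> 'e) \<Rightarrow> ('m \<Rightarrow> 'e) \<Rightarrow> 'm \<Rightarrow> 'e) \<Rightarrow> ('e \<Rightarrow> 'm \<times> (('m \<Rightarrow> real) \<Rightarrow> real)) \<Rightarrow> bool" where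
  "lie_algebroid E br \<rho> \<longleftrightarrow> vector_bundle E \<and>
     vb_morphism E (tangent (bas E)) \<rho> (\<lambda>m. m) \<and>
     (\<forall>s\<in>Sect E. \<forall>t\<in>Sect E.
        br s t \<in> Sect E \<and>
        br s t = smul E (\<lambda>_. -1) (br t s) \<and>
        (\<forall>r. br s (smul E (\<lambda>_. r) t) = smul E (\<lambda>_. r) (br s t)) \<and>
        (\<forall>f\<in>smf (bas E). br s (smul E f t) =
           sadd E (smul E f (br s t)) (smul E (lie (bas E) (\<rho> \<circ> s) f) t)) \<and>
        (\<forall>u\<in>Sect E.
           br s (sadd E t u) = sadd E (br s t) (br s u) \<and>
           sadd E (br s (br t u)) (sadd E (br t (br u s)) (br u (br s t))) = szero E))"

definition connection :: "('a, 'm) vbun \<Rightarrow> ('a \<Rightarrow> 'm \<times> (('m \<Rightarrow> real) \<Rightarrow> real)) \<Rightarrow>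
    ('e, 'm) vbun \<Rightarrow> (('m \<Rightarrow> 'a) \<Rightarrow> ('m \<Rightarrow> 'e) \<Rightarrow> 'm \<Rightarrow> 'e) \<Rightarrow> bool" where
  "connection A \<rho> E nab \<longleftrightarrow> (\<forall>a\<in>Sect A. \<forall>s\<in>Sect E.
     nab a s \<in> Sect E \<and>
     (\<forall>a'\<in>Sect A. nab (sadd A a a') s = sadd E (nab a s) (nab a' s)) \<and>
     (\<forall>s'\<in>Sect E. nab a (sadd E s s') = sadd E (nab a s) (nab a s')) \<and>
     (\<forall>f\<in>smf (bas A).
        nab (smul A f a) s = smul E f (nab a s) \<and>
        nab a (smul E f s) =
          sadd E (smul E f (nab a s)) (smul E (lie (bas A) (\<rho> \<circ> a) f) s)))"

definition pairing :: "('e, 'm) vbun \<Rightarrow> ('m \<Rightarrow> 'm \<times> ('e \<Rightarrow> real)) \<Rightarrow> ('m \<Rightarrow> 'e) \<Rightarrow> 'm \<Rightarrow> real" where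
  "pairing E \<xi> s = (\<lambda>m\<in>pts (bas E). snd (\<xi> m) (s m))"

definition dual_connection :: "('a, 'm) vbun \<Rightarrow> ('a \<Rightarrow> 'm \<times> (('m \<Rightarrow> real) \<Rightarrow> real)) \<Rightarrow>
    ('e, 'm) vbun \<Rightarrow> (('m \<Rightarrow> 'a) \<Rightarrow> ('m \<Rightarrow> 'e) \<Rightarrow> 'm \<Rightarrow> 'e) \<Rightarrow>
    (('m \<Rightarrow> 'a) \<Rightarrow> ('m \<Rightarrow> 'm \<times> ('e \<Rightarrow> real)) \<Rightarrow> 'm \<Rightarrow> 'm \<times> ('e \<Rightarrow> real)) \<Rightarrow> bool" where
  "dual_connection A \<rho> E nab nab' \<longleftrightarrow> connection A \<rho> (dual E) nab' \<and>
     (\<forall>a\<in>Sect A. \<forall>\<xi>\<in>Sect (dual E). \<forall>s\<in>Sect E. \<forall>m\<in>pts (bas E).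
        pairing E (nab' a \<xi>) s m + pairing E \<xi> (nab a s) m =
        lie (bas E) (\<rho> \<circ> a) (pairing E \<xi> s) m)"

definition hom_two_form :: "('a, 'm) vbun \<Rightarrow> ('e, 'm) vbun \<Rightarrow> ('f, 'm) vbun \<Rightarrow>
    (('m \<Rightarrow> 'a) \<Rightarrow> ('m \<Rightarrow> 'a) \<Rightarrow> 'e \<Rightarrow> 'f) \<Rightarrow> bool" where
  "hom_two_form A E F K \<longleftrightarrow> (\<forall>a1\<in>Sect A. \<forall>a2\<in>Sect A.
     vb_morphism E F (K a1 a2) (\<lambda>m. m) \<and>
     (\<forall>u\<in>pts (tot E).
        K a1 a2 u = vscl F (-1) (K a2 a1 u) \<and>
        (\<forall>a3\<in>Sect A. K (sadd A a1 a3) a2 u = vadd F (K a1 a2 u) (K a3 a2 u)) \<and>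
        (\<forall>f\<in>smf (bas A). K (smul A f a1) a2 u = vscl F (f (prj E u)) (K a1 a2 u))))"

definition poisson :: "'a dspace \<Rightarrow> (('a \<Rightarrow> real) \<Rightarrow> ('a \<Rightarrow> real) \<Rightarrow> 'a \<Rightarrow> real) \<Rightarrow> bool" where
  "poisson X pb \<longleftrightarrow> (\<forall>f\<in>smf X. \<forall>g\<in>smf X.
     pb f g \<in> smf X \<and>
     pb f g = (\<lambda>x\<in>pts X. - pb g f x) \<and>
     (\<forall>r. pb f (\<lambda>x\<in>pts X. r * g x) = (\<lambda>x\<in>pts X. r * pb f g x)) \<and>
     (\<forall>k\<in>smf X.
        pb f (\<lambda>x\<in>pts X. g x + k x) = (\<lambda>x\<in>pts X. pb f g x + pb f k x) \<and>
        pb f (\<lambda>x\<in>pts X. g x * k x) = (\<lambda>x\<in>pts X. pb f g x * k x + g x * pb f k x) \<and>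
        (\<forall>x\<in>pts X. pb f (pb g k) x + pb g (pb k f) x + pb k (pb f g) x = 0)))"


section \<open>Double vector bundles\<close>

text \<open>\<open>overA\<close> is \<open>D \<rightarrow> A\<close> and \<open>overB\<close> is \<open>D \<rightarrow> B\<close>; the sides are \<open>A \<rightarrow> M\<close> and \<open>B \<rightarrow> M\<close>.\<close>

record ('d, 'a, 'b, 'm) dvbun =
  overA :: "('d, 'a) vbun"
  overB :: "('d, 'b) vbun"
  sideA :: "('a, 'm) vbun"
  sideB :: "('b, 'm) vbun"

text \<open>\<open>D \<times>\<^sub>B D \<rightarrow> A \<times>\<^sub>M A\<close> with the componentwise structure of \<open>D \<rightarrow> A\<close>.\<close>

definition fibre_square :: "('d, 'a, 'b, 'm) dvbun \<Rightarrow> ('d \<times> 'd, 'a \<times> 'a) vbun" where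
  "fibre_square D = \<lparr>
     tot = fprod (tot (overB D)) (prj (overB D)),
     bas = fprod (tot (sideA D)) (prj (sideA D)),
     prj = map_prod (prj (overA D)) (prj (overA D)),
     vadd = (\<lambda>z w. (vadd (overA D) (fst z) (fst w), vadd (overA D) (snd z) (snd w))),
     vscl = (\<lambda>r. map_prod (vscl (overA D) r) (vscl (overA D) r)),
     vzero = map_prod (vzero (overA D)) (vzero (overA D))\<rparr>"

definition double_vector_bundle :: "('d, 'a, 'b, 'm) dvbun \<Rightarrow> bool" where
  "double_vector_bundle D \<longleftrightarrow>
     vector_bundle (overA D) \<and> vector_bundle (overB D) \<and>
     vector_bundle (sideA D) \<and> vector_bundle (sideB D) \<and>
     tot (overA D) = tot (overB D) \<and> bas (overA D) = tot (sideA D) \<and>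
     bas (overB D) = tot (sideB D) \<and> bas (sideA D) = bas (sideB D) \<and>
     (\<forall>d\<in>pts (tot (overA D)).
        prj (sideA D) (prj (overA D) d) = prj (sideB D) (prj (overB D) d)) \<and>
     vb_morphism (overA D) (sideB D) (prj (overB D)) (prj (sideA D)) \<and>
     vb_morphism (fibre_square D) (overA D)
       (\<lambda>z. vadd (overB D) (fst z) (snd z)) (\<lambda>z. vadd (sideA D) (fst z) (snd z))"

text \<open>On the core the structures inherited from \<open>D \<rightarrow> A\<close> and \<open>D \<rightarrow> B\<close> agree; the former is used.\<close>

definition core :: "('d, 'a, 'b, 'm) dvbun \<Rightarrow> ('d, 'm) vbun" where
  "core D = \<lparr>
     tot = subsp (tot (overA D)) {d \<in> pts (tot (overA D)). \<exists>m\<in>pts (bas (sideA D)).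
       prj (overA D) d = vzero (sideA D) m \<and> prj (overB D) d = vzero (sideB D) m},
     bas = bas (sideA D),
     prj = (\<lambda>d. prj (sideA D) (prj (overA D) d)),
     vadd = vadd (overA D),
     vscl = vscl (overA D),
     vzero = (\<lambda>m. vzero (overA D) (vzero (sideA D) m))\<rparr>"

text \<open>
  The core of a double vector bundle is often only canonically isomorphic to a given bundle
  \<open>C\<close> (the core of \<open>D\<^sub>A\<^sup>*\<close> is \<open>B\<^sup>*\<close>). Below, \<open>\<iota> : C \<rightarrow> D\<close> denotes the identification of \<open>C\<close> with the
  core.
\<close>

definition hom_hat :: "('d, 'a, 'b, 'm) dvbun \<Rightarrow> ('c \<Rightarrow> 'd) \<Rightarrow> ('b \<Rightarrow> 'c) \<Rightarrow> 'b \<Rightarrow> 'd" where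
  "hom_hat D \<iota> T = (\<lambda>b\<in>pts (tot (sideB D)). vadd (overA D) (vzero (overB D) b) (\<iota> (T b)))"

definition core_section :: "('d, 'a, 'b, 'm) dvbun \<Rightarrow> ('c \<Rightarrow> 'd) \<Rightarrow> ('m \<Rightarrow> 'c) \<Rightarrow> 'b \<Rightarrow> 'd" where
  "core_section D \<iota> c = (\<lambda>b\<in>pts (tot (sideB D)).
     vadd (overA D) (vzero (overB D) b) (\<iota> (c (prj (sideB D) b))))"

definition linear_section :: "('d, 'a, 'b, 'm) dvbun \<Rightarrow> ('b \<Rightarrow> 'd) \<Rightarrow> ('m \<Rightarrow> 'a) \<Rightarrow> bool" where
  "linear_section D \<tau> a \<longleftrightarrow> \<tau> \<in> Sect (overB D) \<and> a \<in> Sect (sideA D) \<and>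
     vb_morphism (sideB D) (overA D) \<tau> a"

definition horizontal_lift ::
  "('d, 'a, 'b, 'm) dvbun \<Rightarrow> (('m \<Rightarrow> 'a) \<Rightarrow> 'b \<Rightarrow> 'd) \<Rightarrow> bool" where
  "horizontal_lift D h \<longleftrightarrow> (\<forall>a\<in>Sect (sideA D).
     linear_section D (h a) a \<and>
     (\<forall>a'\<in>Sect (sideA D). h (sadd (sideA D) a a') = sadd (overB D) (h a) (h a')) \<and>
     (\<forall>f\<in>smf (bas (sideA D)). h (smul (sideA D) f a) =
        smul (overB D) (pull (tot (sideB D)) (prj (sideB D)) f) (h a)))"

text \<open>The decomposed double vector bundle \<open>A \<oplus> B \<oplus> C\<close>.\<close>

definition decomposed :: "('a, 'm) vbun \<Rightarrow> ('b, 'm) vbun \<Rightarrow> ('c, 'm) vbun \<Rightarrow>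
    ('a \<times> 'b \<times> 'c, 'a, 'b, 'm) dvbun" where
  "decomposed A B C =
     (let T = subsp (prodsp (tot A) (prodsp (tot B) (tot C)))
           {(a, b, c). a \<in> pts (tot A) \<and> b \<in> pts (tot B) \<and> c \<in> pts (tot C) \<and>
              prj A a = prj B b \<and> prj B b = prj C c}
      in \<lparr>
        overA = \<lparr>tot = T, bas = tot A, prj = fst,
          vadd = (\<lambda>(a, b, c) (a', b', c'). (a, vadd B b b', vadd C c c')),
          vscl = (\<lambda>r (a, b, c). (a, vscl B r b, vscl C r c)),
          vzero = (\<lambda>a. (a, vzero B (prj A a), vzero C (prj A a)))\<rparr>,
        overB = \<lparr>tot = T, bas = tot B, prj = fst \<circ> snd,
          vadd = (\<lambda>(a, b, c) (a', b', c'). (vadd A a a', b, vadd C c c')),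
          vscl = (\<lambda>r (a, b, c). (vscl A r a, b, vscl C r c)),
          vzero = (\<lambda>b. (vzero A (prj B b), b, vzero C (prj B b)))\<rparr>,
        sideA = A,
        sideB = B\<rparr>)"

definition decomposition :: "('d, 'a, 'b, 'm) dvbun \<Rightarrow> ('a \<times> 'b \<times> 'd \<Rightarrow> 'd) \<Rightarrow> bool" where
  "decomposition D \<sigma> \<longleftrightarrow>
     (let A = sideA D; B = sideB D; S = decomposed A B (core D) in
       diffeo (tot (overA S)) (tot (overA D)) \<sigma> \<and>
       vb_morphism (overA S) (overA D) \<sigma> (\<lambda>a. a) \<and>
       vb_morphism (overB S) (overB D) \<sigma> (\<lambda>b. b) \<and>
       (\<forall>c\<in>pts (tot (core D)). let m = prj (core D) c in \<sigma> (vzero A m, vzero B m, c) = c))"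

definition decomposition_of_lift ::
  "('d, 'a, 'b, 'm) dvbun \<Rightarrow> (('m \<Rightarrow> 'a) \<Rightarrow> 'b \<Rightarrow> 'd) \<Rightarrow> ('a \<times> 'b \<times> 'd \<Rightarrow> 'd) \<Rightarrow> bool" where
  "decomposition_of_lift D h \<sigma> \<longleftrightarrow> decomposition D \<sigma> \<and>
     (\<forall>a\<in>Sect (sideA D). \<forall>b\<in>pts (tot (sideB D)). let m = prj (sideB D) b in
        h a b = \<sigma> (a m, b, vzero (core D) m))"


section \<open>Duals of a double vector bundle\<close>

definition p_hor :: "('d, 'a, 'b, 'm) dvbun \<Rightarrow> 'b \<times> ('d \<Rightarrow> real) \<Rightarrow> 'm \<times> ('d \<Rightarrow> real)" where
  "p_hor D \<Psi> = (let m = prj (sideB D) (fst \<Psi>) in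
     (m, \<lambda>c\<in>fib (core D) m. snd \<Psi> (vadd (overA D) (vzero (overB D) (fst \<Psi>)) c)))"

definition p_ver :: "('d, 'a, 'b, 'm) dvbun \<Rightarrow> 'a \<times> ('d \<Rightarrow> real) \<Rightarrow> 'm \<times> ('d \<Rightarrow> real)" where
  "p_ver D \<Theta> = (let m = prj (sideA D) (fst \<Theta>) in
     (m, \<lambda>c\<in>fib (core D) m. snd \<Theta> (vadd (overB D) (vzero (overA D) (fst \<Theta>)) c)))"

text \<open>
  The zero of \<open>D\<^sub>A\<^sup>* \<rightarrow> C\<^sup>*\<close> over \<open>\<gamma>\<close> lies over the zero of \<open>A\<close> and is given by \<open>0\<^sub>b +\<^sub>A c \<mapsto> \<gamma>(c)\<close>. The
  addition is characterised by \<open>\<langle>\<Theta>\<^sub>1 + \<Theta>\<^sub>2, d\<^sub>1 +\<^sub>B d\<^sub>2\<rangle> = \<langle>\<Theta>\<^sub>1, d\<^sub>1\<rangle> + \<langle>\<Theta>\<^sub>2, d\<^sub>2\<rangle>\<close> and the scalar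
  multiplication, for \<open>r \<noteq> 0\<close>, by \<open>\<langle>r \<cdot> \<Theta>, r \<cdot>\<^sub>B d\<rangle> = r \<langle>\<Theta>, d\<rangle>\<close>.
\<close>

definition ver_zero :: "('d, 'a, 'b, 'm) dvbun \<Rightarrow> 'm \<times> ('d \<Rightarrow> real) \<Rightarrow> 'a \<times> ('d \<Rightarrow> real)" where
  "ver_zero D \<gamma> = (let a0 = vzero (sideA D) (fst \<gamma>) in
     (a0, \<lambda>d\<in>fib (overA D) a0.
        snd \<gamma> (vadd (overA D) d (vscl (overA D) (-1) (vzero (overB D) (prj (overB D) d))))))"

definition ver_add :: "('d, 'a, 'b, 'm) dvbun \<Rightarrow>
    'a \<times> ('d \<Rightarrow> real) \<Rightarrow> 'a \<times> ('d \<Rightarrow> real) \<Rightarrow> 'a \<times> ('d \<Rightarrow> real)" where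
  "ver_add D \<Theta>1 \<Theta>2 = (let a = vadd (sideA D) (fst \<Theta>1) (fst \<Theta>2) in
     (a, \<lambda>d\<in>fib (overA D) a.
        let (d1, d2) = (SOME (d1, d2).
              d1 \<in> fib (overA D) (fst \<Theta>1) \<and> d2 \<in> fib (overA D) (fst \<Theta>2) \<and>
              prj (overB D) d1 = prj (overB D) d2 \<and> vadd (overB D) d1 d2 = d)
        in snd \<Theta>1 d1 + snd \<Theta>2 d2))"

definition ver_scl :: "('d, 'a, 'b, 'm) dvbun \<Rightarrow> real \<Rightarrow>
    'a \<times> ('d \<Rightarrow> real) \<Rightarrow> 'a \<times> ('d \<Rightarrow> real)" where
  "ver_scl D r \<Theta> =
     (if r = 0 then ver_zero D (p_ver D \<Theta>)
      else let a = vscl (sideA D) r (fst \<Theta>) in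
        (a, \<lambda>d\<in>fib (overA D) a. r * snd \<Theta> (vscl (overB D) (inverse r) d)))"

definition vertical_dual :: "('d, 'a, 'b, 'm) dvbun \<Rightarrow>
    ('a \<times> ('d \<Rightarrow> real), 'a, 'm \<times> ('d \<Rightarrow> real), 'm) dvbun" where
  "vertical_dual D = \<lparr>
     overA = dual (overA D),
     overB = \<lparr>tot = tot (dual (overA D)), bas = tot (dual (core D)), prj = p_ver D,
       vadd = ver_add D, vscl = ver_scl D, vzero = ver_zero D\<rparr>,
     sideA = sideA D,
     sideB = dual (core D)\<rparr>"

text \<open>The identification of \<open>B\<^sup>*\<close> with the core of \<open>D\<^sub>A\<^sup>*\<close>.\<close>

definition ver_core :: "('d, 'a, 'b, 'm) dvbun \<Rightarrow> 'm \<times> ('b \<Rightarrow> real) \<Rightarrow> 'a \<times> ('d \<Rightarrow> real)" where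
  "ver_core D \<beta> = (let a0 = vzero (sideA D) (fst \<beta>) in
     (a0, \<lambda>d\<in>fib (overA D) a0. snd \<beta> (prj (overB D) d)))"

text \<open>The pairing \<open>\<parallel>\<Theta>, \<Psi>\<parallel>\<close>; it does not depend on the choice of \<open>d\<close> if \<open>\<Theta>\<close> and \<open>\<Psi>\<close> lie over the
  same point of \<open>C\<^sup>*\<close>.\<close>

definition dual_pairing :: "('d, 'a, 'b, 'm) dvbun \<Rightarrow>
    'a \<times> ('d \<Rightarrow> real) \<Rightarrow> 'b \<times> ('d \<Rightarrow> real) \<Rightarrow> real" where
  "dual_pairing D \<Theta> \<Psi> =
     (let d = (SOME d. d \<in> fib (overA D) (fst \<Theta>) \<and> d \<in> fib (overB D) (fst \<Psi>))
      in snd \<Psi> d - snd \<Theta> d)"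

definition ell_core_dual :: "('d, 'a, 'b, 'm) dvbun \<Rightarrow>
    ('m \<times> ('d \<Rightarrow> real) \<Rightarrow> 'a \<times> ('d \<Rightarrow> real)) \<Rightarrow> 'b \<times> ('d \<Rightarrow> real) \<Rightarrow> real" where
  "ell_core_dual D \<Theta> = (\<lambda>\<Psi>\<in>dual_pts (overB D). dual_pairing D (\<Theta> (p_hor D \<Psi>)) \<Psi>)"

text \<open>The isomorphism \<open>\<sigma>\<^sub>A\<^sup>*\<^sup>-\<^sup>1 : A \<oplus> C\<^sup>* \<oplus> B\<^sup>* \<rightarrow> D\<^sub>A\<^sup>*\<close>, where \<open>A \<oplus> C\<^sup>* \<oplus> B\<^sup>*\<close> is identified with the dual of
  \<open>A \<oplus> B \<oplus> C\<close> over \<open>A\<close>.\<close>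

definition dual_decomposition :: "('d, 'a, 'b, 'm) dvbun \<Rightarrow> ('a \<times> 'b \<times> 'd \<Rightarrow> 'd) \<Rightarrow>
    'a \<times> ('m \<times> ('d \<Rightarrow> real)) \<times> ('m \<times> ('b \<Rightarrow> real)) \<Rightarrow> 'a \<times> ('d \<Rightarrow> real)" where
  "dual_decomposition D \<sigma> = (\<lambda>(a, \<gamma>, \<beta>).
     let S = decomposed (sideA D) (sideB D) (core D) in
     dual_map_inv (overA S) (overA D) \<sigma>
       (a, \<lambda>(x, b, c)\<in>fib (overA S) a. snd \<gamma> c + snd \<beta> b))"

definition dual_lift :: "('d, 'a, 'b, 'm) dvbun \<Rightarrow> ('a \<times> 'b \<times> 'd \<Rightarrow> 'd) \<Rightarrow>
    ('m \<Rightarrow> 'a) \<Rightarrow> 'm \<times> ('d \<Rightarrow> real) \<Rightarrow> 'a \<times> ('d \<Rightarrow> real)" where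
  "dual_lift D \<sigma> a = (\<lambda>\<gamma>\<in>pts (tot (dual (core D))).
     dual_decomposition D \<sigma> (a (fst \<gamma>), \<gamma>, vzero (dual (sideB D)) (fst \<gamma>)))"


section \<open>VB-algebroids and their duals\<close>

text \<open>\<open>brk\<close> and \<open>anch\<close> are the Lie algebroid structure of \<open>D \<rightarrow> B\<close>; \<open>brkA\<close> and \<open>anchA\<close> are the bracket
  and anchor of \<open>A \<rightarrow> M\<close>, which they cover.\<close>

record ('d, 'a, 'b, 'm) vbalg =
  dvb :: "('d, 'a, 'b, 'm) dvbun"
  brk :: "('b \<Rightarrow> 'd) \<Rightarrow> ('b \<Rightarrow> 'd) \<Rightarrow> 'b \<Rightarrow> 'd"
  anch :: "'d \<Rightarrow> 'b \<times> (('b \<Rightarrow> real) \<Rightarrow> real)"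
  brkA :: "('m \<Rightarrow> 'a) \<Rightarrow> ('m \<Rightarrow> 'a) \<Rightarrow> 'm \<Rightarrow> 'a"
  anchA :: "'a \<Rightarrow> 'm \<times> (('m \<Rightarrow> real) \<Rightarrow> real)"

definition vb_algebroid :: "('d, 'a, 'b, 'm) vbalg \<Rightarrow> bool" where
  "vb_algebroid V \<longleftrightarrow>
     (let D = dvb V; hat = core_section D (\<lambda>c. c); \<Gamma>C = Sect (core D) in
       double_vector_bundle D \<and>
       lie_algebroid (overB D) (brk V) (anch V) \<and>
       vb_morphism (overA D) (tangent_prolongation (sideB D)) (anch V) (anchA V) \<and>
       (\<forall>\<tau>1 \<tau>2 a1 a2. linear_section D \<tau>1 a1 \<longrightarrow> linear_section D \<tau>2 a2 \<longrightarrow>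
          linear_section D (brk V \<tau>1 \<tau>2) (brkA V a1 a2)) \<and>
       (\<forall>\<tau> a. linear_section D \<tau> a \<longrightarrow> (\<forall>c\<in>\<Gamma>C. \<exists>c'\<in>\<Gamma>C. brk V \<tau> (hat c) = hat c')) \<and>
       (\<forall>c\<in>\<Gamma>C. \<forall>c'\<in>\<Gamma>C. brk V (hat c) (hat c') = szero (overB D)))"

text \<open>The linear Poisson bracket on \<open>D\<^sub>B\<^sup>*\<close> defined by \<open>D \<rightarrow> B\<close>.\<close>

definition dual_poisson :: "('d, 'a, 'b, 'm) vbalg \<Rightarrow>
    (('b \<times> ('d \<Rightarrow> real) \<Rightarrow> real) \<Rightarrow> ('b \<times> ('d \<Rightarrow> real) \<Rightarrow> real) \<Rightarrow> 'b \<times> ('d \<Rightarrow> real) \<Rightarrow> real) \<Rightarrow> bool" where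
  "dual_poisson V pb \<longleftrightarrow>
     (let E = overB (dvb V); P = tot (dual E); B = bas E; p = prj (dual E) in
       poisson P pb \<and>
       (\<forall>\<tau>1\<in>Sect E. \<forall>\<tau>2\<in>Sect E.
          pb (ell_sect E \<tau>1) (ell_sect E \<tau>2) = ell_sect E (brk V \<tau>1 \<tau>2)) \<and>
       (\<forall>\<tau>\<in>Sect E. \<forall>f\<in>smf B.
          pb (ell_sect E \<tau>) (pull P p f) = pull P p (lie B (anch V \<circ> \<tau>) f)) \<and>
       (\<forall>f\<in>smf B. \<forall>g\<in>smf B. pb (pull P p f) (pull P p g) = (\<lambda>x\<in>pts P. 0)))"

definition dual_vb_algebroid :: "('d, 'a, 'b, 'm) vbalg \<Rightarrow>
    ('a \<times> ('d \<Rightarrow> real), 'a, 'm \<times> ('d \<Rightarrow> real), 'm) vbalg \<Rightarrow> bool" where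
  "dual_vb_algebroid V V' \<longleftrightarrow>
     (let D = dvb V; P = tot (dual (overB D)); Cs = tot (dual (core D));
          \<Gamma> = Sect (overB (vertical_dual D)) in
       vb_algebroid V' \<and> dvb V' = vertical_dual D \<and>
       (\<exists>pb. dual_poisson V pb \<and>
          (\<forall>\<Theta>1\<in>\<Gamma>. \<forall>\<Theta>2\<in>\<Gamma>. ell_core_dual D (brk V' \<Theta>1 \<Theta>2) =
             pb (ell_core_dual D \<Theta>1) (ell_core_dual D \<Theta>2)) \<and>
          (\<forall>\<Theta>\<in>\<Gamma>. \<forall>g\<in>smf Cs. pull P (p_hor D) (lie Cs (anch V' \<circ> \<Theta>) g) =
             pb (ell_core_dual D \<Theta>) (pull P (p_hor D) g))))"

text \<open>
  The structure operators \<open>(\<partial>, \<nabla>\<^sup>0, \<nabla>\<^sup>1, K)\<close> of the representation up to homotopy on \<open>C \<oplus> B\<close>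
  associated to a horizontal lift \<open>h\<close>, where \<open>C\<close> is identified with the core by \<open>\<iota>\<close>.
\<close>

definition structure_operators :: "('d, 'a, 'b, 'm) vbalg \<Rightarrow> ('c, 'm) vbun \<Rightarrow> ('c \<Rightarrow> 'd) \<Rightarrow>
    (('m \<Rightarrow> 'a) \<Rightarrow> 'b \<Rightarrow> 'd) \<Rightarrow> ('c \<Rightarrow> 'b) \<Rightarrow>
    (('m \<Rightarrow> 'a) \<Rightarrow> ('m \<Rightarrow> 'c) \<Rightarrow> 'm \<Rightarrow> 'c) \<Rightarrow> (('m \<Rightarrow> 'a) \<Rightarrow> ('m \<Rightarrow> 'b) \<Rightarrow> 'm \<Rightarrow> 'b) \<Rightarrow>
    (('m \<Rightarrow> 'a) \<Rightarrow> ('m \<Rightarrow> 'a) \<Rightarrow> 'b \<Rightarrow> 'c) \<Rightarrow> bool" where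
  "structure_operators V C \<iota> h del nab0 nab1 K \<longleftrightarrow>
     (let D = dvb V; A = sideA D; B = sideB D; hat = core_section D \<iota> in
       vb_morphism C B del (\<lambda>m. m) \<and>
       connection A (anchA V) C nab0 \<and>
       connection A (anchA V) B nab1 \<and>
       hom_two_form A B C K \<and>
       (\<forall>c\<in>Sect C. \<forall>b\<in>pts (tot B). anch V (hat c b) = vertical_lift B (del \<circ> c) b) \<and>
       (\<exists>nab1'. dual_connection A (anchA V) B nab1 nab1' \<and>
          (\<forall>a\<in>Sect A. let \<X> = (\<lambda>b\<in>pts (tot B). anch V (h a b)) in
             linear_vector_field B \<X> \<and>
             (\<forall>\<psi>\<in>Sect (dual B). lie (tot B) \<X> (ell B \<psi>) = ell B (nab1' a \<psi>)))) \<and>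
       (\<forall>a\<in>Sect A. \<forall>c\<in>Sect C. brk V (h a) (hat c) = hat (nab0 a c)) \<and>
       (\<forall>a1\<in>Sect A. \<forall>a2\<in>Sect A. brk V (h a1) (h a2) =
          sadd (overB D) (h (brkA V a1 a2)) (hom_hat D \<iota> (K a1 a2))))"

end

theory Submission
  imports Defs
begin

text \<open>
  Under the decomposition \<open>D \<cong> A \<oplus> B \<oplus> C\<close> given by \<open>h\<close>, the functions on \<open>D\<^sub>B\<^sup>*\<close> that define the dual algebroid
  are the ones that define its linear Poisson bracket:
  \<open>\<ell>\<close> of \<open>h\<^sup>\<top>(a)\<close> over \<open>C\<^sup>*\<close> is \<open>\<ell>\<close> of \<open>h(a)\<close> over \<open>B\<close>; \<open>\<ell>\<close> of the core section of \<open>\<beta> \<in> \<Gamma>(B\<^sup>*)\<close> is the pull-back of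
  \<open>- \<ell>\<^sub>\<beta>\<close> from \<open>B\<close>; and the pull-back of \<open>\<ell>\<^sub>c\<close> from \<open>C\<^sup>*\<close> is \<open>\<ell>\<close> of the core section of \<open>c \<in> \<Gamma>(C)\<close>.
  Hence each Poisson bracket of two such functions computes a structure operator of \<open>D\<close> and one of
  \<open>D\<^sub>A\<^sup>*\<close>, and comparing the two gives the claim. Evaluating \<open>\<partial>\<close> at a point moreover needs sections of \<open>C\<close> and \<open>B\<^sup>*\<close>
  through that point, hence bump functions.
\<close>

section \<open>Smooth functions and bump functions\<close>

text \<open>All signs have one source: the pairing of the two duals subtracts its vertical argument,
  so \<open>\<beta>\<close> enters the Poisson algebra as minus its linear function. For the
  differential this sign cancels against the antisymmetry of the bracket, for the connection on the
  dual of B it occurs on both sides, and for the curvature nothing compensates it, whence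
  \<open>-K^*\<close>. The connection on the dual of C is given only indirectly, through the anchor
  of the lift acting on linear functions; this yields its dual on the bidual of C, in which elements
  of C have to be read as evaluations. Every identity of functions is tested at points of
  \<open>D_B^*\<close> whose component in the dual of A is zero, so that all horizontal terms
  vanish. Two obstacles shape the rest. \<open>V\<close> and \<open>V'\<close> each carry an anchor
  of A, and these must be identified before connections can be compared. And the core is given only
  as a subset of D with inherited operations: its linear structure, its zero section and its
  sections have to be obtained from \<open>D \<rightarrow> A\<close> and the decomposition.\<close>

definition flat :: "real poly \<Rightarrow> real \<Rightarrow> real" where
  "flat P x = (if x > 0 then poly P (1 / x) * exp (- (1 / x)) else 0)"

lemma poly_times_exp_tendsto_0: "((\<lambda>y::real. poly P y * exp (- y)) \<longlongrightarrow> 0) at_top"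
proof -
  have "((\<lambda>y::real. \<Sum>i\<le>degree P. coeff P i * (y ^ i / exp y)) \<longlongrightarrow> (\<Sum>i\<le>degree P. coeff P i * 0)) at_top"
    by (intro tendsto_sum tendsto_mult tendsto_const tendsto_power_div_exp_0)
  moreover have "(\<lambda>y::real. \<Sum>i\<le>degree P. coeff P i * (y ^ i / exp y)) = (\<lambda>y. poly P y * exp (- y))"
    by (simp add: poly_altdef sum_distrib_right exp_minus divide_inverse mult.assoc)
  ultimately show ?thesis by simp
qed

text \<open>The derivative of \<open>P (1/x) * exp (- 1/x)\<close> is
  \<open>(1/x)^2 * (P - P') (1/x) * exp (- 1/x)\<close>, again of the same shape; the two
  \<open>pCons 0\<close> multiply by the square of the variable. Admitting all polynomials makes the
  family closed under differentiation.\<close>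

lemma DERIV_flat: "DERIV (flat P) x :> flat (pCons 0 (pCons 0 (P - pderiv P))) x"
proof -
  consider "x > 0" | "x < 0" | "x = 0" by linarith
  then show ?thesis
  proof cases
    case 1
    have ev: "eventually (\<lambda>y. poly P (1 / y) * exp (- (1 / y)) = flat P y) (nhds x)"
      by (rule eventually_mono[OF eventually_nhds_in_open[of "{0<..}" x]]) (use 1 in \<open>simp_all add: flat_def\<close>)
    have i: "DERIV (\<lambda>y. 1 / y) x :> - (1 / x * (1 / x))"
      using 1 by (auto intro!: derivative_eq_intros)
    have "DERIV (\<lambda>y. poly P (1 / y) * exp (- (1 / y))) x :>
        poly (pderiv P) (1 / x) * - (1 / x * (1 / x)) * exp (- (1 / x)) +
        exp (- (1 / x)) * - (- (1 / x * (1 / x))) * poly P (1 / x)"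
      by (intro DERIV_mult DERIV_chain2[OF poly_DERIV] DERIV_chain2[OF DERIV_exp] DERIV_minus i)
    also have "poly (pderiv P) (1 / x) * - (1 / x * (1 / x)) * exp (- (1 / x)) +
        exp (- (1 / x)) * - (- (1 / x * (1 / x))) * poly P (1 / x) = flat (pCons 0 (pCons 0 (P - pderiv P))) x"
      using 1 by (simp add: flat_def algebra_simps)
    finally have "DERIV (\<lambda>y. poly P (1 / y) * exp (- (1 / y))) x :> flat (pCons 0 (pCons 0 (P - pderiv P))) x" .
    then show ?thesis using DERIV_cong_ev[OF refl ev refl] by simp
  next
    case 2
    have ev: "eventually (\<lambda>y. 0 = flat P y) (nhds x)"
      by (rule eventually_mono[OF eventually_nhds_in_open[of "{..<0}" x]]) (use 2 in \<open>simp_all add: flat_def\<close>)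
    have "DERIV (\<lambda>y. 0) x :> flat (pCons 0 (pCons 0 (P - pderiv P))) x"
      using 2 by (simp add: flat_def)
    then show ?thesis using DERIV_cong_ev[OF refl ev refl] by simp
  next
    case 3
    have l: "((\<lambda>h. flat P h / h) \<longlongrightarrow> 0) (at_left 0)"
    proof (rule tendsto_eventually)
      show "\<forall>\<^sub>F h in at_left 0. flat P h / h = 0"
        unfolding eventually_at_filter by (simp add: flat_def)
    qed
    \<comment> \<open>The right difference quotient at 0 is
      \<open>(1/h) * P (1/h) * exp (- 1/h)\<close>: the extra factor \<open>1/h\<close> turns P into
      \<open>[:0,1:] * P\<close>, evaluated at \<open>inverse h\<close>, which tends to
      infinity.\<close>
    have "((\<lambda>h. poly ([:0,1:] * P) (inverse h) * exp (- inverse h)) \<longlongrightarrow> 0) (at_right (0::real))"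
      by (rule filterlim_compose[OF poly_times_exp_tendsto_0 filterlim_inverse_at_top_right])
    moreover have "\<forall>\<^sub>F h in at_right 0. poly ([:0,1:] * P) (inverse h) * exp (- inverse h) = flat P h / h"
      unfolding eventually_at_filter by (simp add: flat_def inverse_eq_divide)
    ultimately have r: "((\<lambda>h. flat P h / h) \<longlongrightarrow> 0) (at_right 0)"
      by (rule Lim_transform_eventually)
    from l r have "((\<lambda>h. flat P h / h) \<longlongrightarrow> 0) (at 0)"
      by (simp add: filterlim_split_at)
    then show ?thesis using 3 by (simp add: DERIV_def flat_def)
  qed
qed

text \<open>The coinduction invariant is the whole family over all P, so a single derivative
  computation covers all orders.\<close>

lemma smooth_Rn_flat: "smooth_Rn 1 V (\<lambda>x. flat P (x 0))"
proof (coinduction arbitrary: P)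
  case smooth_Rn
  have "isCont (flat P) y" for y using DERIV_flat DERIV_isCont by blast
  then have c: "continuous_on UNIV (flat P)" by (simp add: continuous_on_eq_continuous_at)
  have "continuous_on V (\<lambda>x. flat P (x 0))"
    by (rule continuous_on_compose2[OF c continuous_on_subset[OF continuous_on_product_coordinates]]) auto
  then show ?case
    by (intro exI[of _ "\<lambda>x. flat P (x 0)"] exI[of _ "\<lambda>_ x. flat (pCons 0 (pCons 0 (P - pderiv P))) (x 0)"])
      (auto intro!: DERIV_flat)
qed

text \<open>Closed under partial derivatives, this class yields constants, sums and products at once.\<close>

lemma smooth_Rn_bilinear: "smooth_Rn n V (\<lambda>x. a + b * x 0 + c * x 1 + d * (x 0 * x 1))"
proof (coinduction arbitrary: a b c d)
  case smooth_Rn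
  have "continuous_on V (\<lambda>x. a + b * x 0 + c * x 1 + d * (x 0 * x (1::nat)))"
    by (intro continuous_intros continuous_on_subset[OF continuous_on_product_coordinates]) auto
  moreover have "((\<lambda>t. a + b * (x(i := t)) 0 + c * (x(i := t)) 1 + d * ((x(i := t)) 0 * (x(i := t)) 1))
     has_real_derivative (if i = 0 then b + d * x 1 else if i = 1 then c + d * x 0 else 0)) (at (x i))"
    for i and x :: "nat \<Rightarrow> real"
    by (auto intro!: derivative_eq_intros)
  moreover have "\<exists>a' b' c' d'. (\<lambda>x::nat\<Rightarrow>real. (if i = 0 then b + d * x 1 else if i = 1 then c + d * x 0 else 0)) =
      (\<lambda>x. a' + b' * x 0 + c' * x 1 + d' * (x 0 * x 1))" for i :: nat
  proof -
    consider "i = 0" | "i = 1" | "i \<noteq> 0" "i \<noteq> 1" by blast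
    then show ?thesis
    proof cases
      case 1 then show ?thesis by (intro exI[of _ b] exI[of _ 0] exI[of _ d]) auto
    next
      case 2 then show ?thesis by (intro exI[of _ c] exI[of _ d] exI[of _ 0]) auto
    next
      case 3 then show ?thesis by (intro exI[of _ 0]) auto
    qed
  qed
  ultimately show ?case
    by (intro exI[of _ "\<lambda>x. a + b * x 0 + c * x 1 + d * (x 0 * x 1)"]
        exI[of _ "\<lambda>i x. (if i = 0 then b + d * x 1 else if i = 1 then c + d * x 0 else 0)"]) blast
qed

section \<open>Initial topologies and generated smooth structures\<close>

lemma topspace_init_top [simp]: "topspace (init_top X F) = X"
  unfolding init_top_def by auto

lemma topspace_dtop [simp]: "topspace (dtop X) = pts X"
  unfolding dtop_def by simp

lemma openin_init_top_subset: "openin (init_top X F) W \<Longrightarrow> W \<subseteq> X"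
  using openin_subset by fastforce

lemma openin_init_topI: "f \<in> F \<Longrightarrow> open U \<Longrightarrow> openin (init_top X F) {x \<in> X. f x \<in> U}"
  unfolding init_top_def by (rule topology_generated_by_Basis) auto

lemma init_top_induct [consumes 1, case_names Empty Int Un whole gen]:
  assumes "openin (init_top X F) W"
    and "P {}" and "\<And>a b. P a \<Longrightarrow> P b \<Longrightarrow> P (a \<inter> b)" and "\<And>K. (\<And>k. k \<in> K \<Longrightarrow> P k) \<Longrightarrow> P (\<Union>K)"
    and "P X" and "\<And>f U. f \<in> F \<Longrightarrow> open U \<Longrightarrow> P {x \<in> X. f x \<in> U}"
  shows "P W"
proof -
  have "generate_topology_on (insert X {{x \<in> X. f x \<in> U} | f U. f \<in> F \<and> open U}) W"
    using assms(1) unfolding init_top_def openin_topology_generated_by_iff .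
  then show ?thesis
  proof induct
    case (UN K)
    then show ?case using assms(4) by blast
  next
    case (Basis s)
    then show ?case using assms(5,6) by blast
  qed (use assms(2,3) in auto)
qed

text \<open>Preimages commute with finite intersections and arbitrary unions, so openness has to be
  checked on the subbasis only.\<close>

lemma openin_init_top_vimage:
  assumes "openin (init_top S F) W" and "openin T Y" and "\<phi> ` Y \<subseteq> S"
    and "\<And>f U. f \<in> F \<Longrightarrow> open U \<Longrightarrow> openin T {x \<in> Y. f (\<phi> x) \<in> U}"
  shows "openin T {x \<in> Y. \<phi> x \<in> W}"
  using assms(1)
proof (induct rule: init_top_induct)
  case (Int a b)
  have "{x \<in> Y. \<phi> x \<in> a \<inter> b} = {x \<in> Y. \<phi> x \<in> a} \<inter> {x \<in> Y. \<phi> x \<in> b}" by auto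
  then show ?case using openin_Int[OF Int] by simp
next
  case (Un K)
  have "{x \<in> Y. \<phi> x \<in> \<Union>K} = (\<Union>k\<in>K. {x \<in> Y. \<phi> x \<in> k})" by auto
  then show ?case using Un by auto
next
  case whole
  have "{x \<in> Y. \<phi> x \<in> S} = Y" using assms(3) by auto
  then show ?case using assms(2) by simp
next
  case (gen f U)
  have "{x \<in> Y. \<phi> x \<in> {x \<in> S. f x \<in> U}} = {x \<in> Y. f (\<phi> x) \<in> U}" using assms(3) by auto
  then show ?case using assms(4) gen by simp
qed simp

text \<open>The only part of \<^const>\<open>manifold\<close> that smoothness arguments use, so that it may be applied to open subspaces.\<close>

definition saturated :: "'a dspace \<Rightarrow> bool" where
  "saturated X \<longleftrightarrow> gen (pts X) (smf X) = X"

lemma pts_gen [simp]: "pts (gen X F) = X"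
  by (simp add: gen_def)

lemma pts_subsp [simp]: "pts (subsp X S) = S"
  by (simp add: subsp_def)

lemma pts_prodsp [simp]: "pts (prodsp X Y) = pts X \<times> pts Y"
  by (simp add: prodsp_def)

lemma pts_Rn_space [simp]: "pts (Rn_space n V) = V"
  by (simp add: Rn_space_def)

lemma smf_gen_extensional: "f \<in> smf (gen X F) \<Longrightarrow> f \<in> extensional X"
  by (simp add: gen_def)

lemma smf_gen_iff:
  "f \<in> smf (gen X F) \<longleftrightarrow> f \<in> extensional X \<and> (\<forall>p\<in>X. \<exists>k g G W.
       (\<forall>i<k. g i \<in> F) \<and> smooth_Rn k (Rn k) G \<and> openin (init_top X F) W \<and> p \<in> W \<and>
       (\<forall>q\<in>W. f q = G (\<lambda>i. if i < k then g i q else 0)))"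
  by (simp add: gen_def)

lemma smf_genE:
  assumes "f \<in> smf (gen X F)" "p \<in> X"
  obtains k g G W where "\<forall>i<k. g i \<in> F" "smooth_Rn k (Rn k) G" "openin (init_top X F) W" "p \<in> W"
       "\<forall>q\<in>W. f q = G (\<lambda>i. if i < k then g i q else 0)"
  using assms unfolding smf_gen_iff by blast

lemma gen_generator:
  assumes "f \<in> F" "f \<in> extensional X"
  shows "f \<in> smf (gen X F)"
  unfolding smf_gen_iff
proof (intro conjI ballI)
  fix p assume p: "p \<in> X"
  have "openin (init_top X F) X" using openin_topspace[of "init_top X F"] by simp
  moreover have "smooth_Rn 2 (Rn 2) (\<lambda>x. x 0)"
    using smooth_Rn_bilinear[of 2 _ 0 1 0 0] by simp
  ultimately show "\<exists>k g G W. (\<forall>i<k. g i \<in> F) \<and> smooth_Rn k (Rn k) G \<and> openin (init_top X F) W \<and> p \<in> W \<and>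
       (\<forall>q\<in>W. f q = G (\<lambda>i. if i < k then g i q else 0))"
    using assms p
    by (intro exI[of _ 2] exI[of _ "\<lambda>_. f"] exI[of _ "\<lambda>x. x 0"] exI[of _ X]) simp
qed fact

lemma saturated_extensional: "saturated X \<Longrightarrow> f \<in> smf X \<Longrightarrow> f \<in> extensional (pts X)"
  using smf_gen_extensional unfolding saturated_def by metis

lemma saturated_smfI:
  assumes "saturated X" "f \<in> extensional (pts X)"
    and "\<And>p. p \<in> pts X \<Longrightarrow> \<exists>k g G W.
       (\<forall>i<k. g i \<in> smf X) \<and> smooth_Rn k (Rn k) G \<and> openin (dtop X) W \<and> p \<in> W \<and>
       (\<forall>q\<in>W. f q = G (\<lambda>i. if i < k then g i q else 0))"
  shows "f \<in> smf X"
  using smf_gen_iff[of f "pts X" "smf X"] assms unfolding saturated_def dtop_def by simp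

lemma saturated_smfE:
  assumes "saturated X" "f \<in> smf X" "p \<in> pts X"
  obtains k g G W where "\<forall>i<k. g i \<in> smf X" "smooth_Rn k (Rn k) G" "openin (dtop X) W" "p \<in> W"
       "\<forall>q\<in>W. f q = G (\<lambda>i. if i < k then g i q else 0)"
  using smf_gen_iff[of f "pts X" "smf X"] assms unfolding saturated_def dtop_def by auto

lemma openin_dtop_pts [simp]: "openin (dtop X) (pts X)"
  using openin_topspace[of "dtop X"] by simp

lemma openin_dtop_subset: "openin (dtop X) W \<Longrightarrow> W \<subseteq> pts X"
  using openin_subset by fastforce

lemma openin_dtopI: "f \<in> smf X \<Longrightarrow> open U \<Longrightarrow> openin (dtop X) {x \<in> pts X. f x \<in> U}"
  unfolding dtop_def by (rule openin_init_topI)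

lemma smf_compose:
  assumes "saturated X" "\<And>i. i < k \<Longrightarrow> g i \<in> smf X" "smooth_Rn k (Rn k) G"
  shows "(\<lambda>x\<in>pts X. G (\<lambda>i. if i < k then g i x else 0)) \<in> smf X"
  using assms(2,3)
  by (intro saturated_smfI[OF assms(1)]) (auto intro!: exI[of _ k] exI[of _ g] exI[of _ G] exI[of _ "pts X"])

text \<open>The sheaf property: an expression of F near p in finitely many smooth functions is, on a
  smaller neighbourhood, also one of f.\<close>

lemma smf_locally:
  assumes "saturated X" "f \<in> extensional (pts X)"
    and "\<And>p. p \<in> pts X \<Longrightarrow> \<exists>W F. openin (dtop X) W \<and> p \<in> W \<and> F \<in> smf X \<and> (\<forall>q\<in>W. f q = F q)"
  shows "f \<in> smf X"
proof (rule saturated_smfI[OF assms(1)])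
  fix p assume "p \<in> pts X"
  then obtain W F where W: "openin (dtop X) W" "p \<in> W" "F \<in> smf X" "\<forall>q\<in>W. f q = F q"
    using assms(3) by blast
  obtain k g G W' where "\<forall>i<k. g i \<in> smf X" "smooth_Rn k (Rn k) G" "openin (dtop X) W'" "p \<in> W'"
       "\<forall>q\<in>W'. F q = G (\<lambda>i. if i < k then g i q else 0)"
    by (rule saturated_smfE[OF assms(1) W(3) \<open>p \<in> pts X\<close>])
  with W show "\<exists>k g G W. (\<forall>i<k. g i \<in> smf X) \<and> smooth_Rn k (Rn k) G \<and> openin (dtop X) W \<and> p \<in> W \<and>
       (\<forall>q\<in>W. f q = G (\<lambda>i. if i < k then g i q else 0))"
    by (intro exI[of _ k] exI[of _ g] exI[of _ G] exI[of _ "W \<inter> W'"]) auto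
qed fact

lemma smf_bilinear:
  assumes "saturated X" "f \<in> smf X" "g \<in> smf X"
  shows "(\<lambda>x\<in>pts X. a + b * f x + c * g x + d * (f x * g x)) \<in> smf X"
  using smf_compose[OF assms(1) _ smooth_Rn_bilinear[of 2 "Rn 2" a b c d], of "\<lambda>i. if i = 0 then f else g"] assms
  by simp

lemma smf_add: "saturated X \<Longrightarrow> f \<in> smf X \<Longrightarrow> g \<in> smf X \<Longrightarrow> (\<lambda>x\<in>pts X. f x + g x) \<in> smf X"
  using smf_bilinear[of X f g 0 1 1 0] by simp

lemma smf_mult: "saturated X \<Longrightarrow> f \<in> smf X \<Longrightarrow> g \<in> smf X \<Longrightarrow> (\<lambda>x\<in>pts X. f x * g x) \<in> smf X"
  using smf_bilinear[of X f g 0 0 0 1] by simp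

lemma smf_affine: "saturated X \<Longrightarrow> f \<in> smf X \<Longrightarrow> (\<lambda>x\<in>pts X. a + b * f x) \<in> smf X"
  using smf_bilinear[of X f f a b 0 0] by simp

lemma smf_const: "saturated X \<Longrightarrow> (\<lambda>x\<in>pts X. a) \<in> smf X"
  using smf_compose[OF _ _ smooth_Rn_bilinear[of 0 "Rn 0" a 0 0 0]] by simp

lemma smf_sum:
  assumes "saturated X" "finite I" "\<And>i. i \<in> I \<Longrightarrow> f i \<in> smf X"
  shows "(\<lambda>x\<in>pts X. \<Sum>i\<in>I. f i x) \<in> smf X"
  using assms(2,3)
proof (induct I rule: finite_induct)
  case empty show ?case unfolding sum.empty by (rule smf_const[OF assms(1)])
next
  case (insert j I)
  have "(\<lambda>x\<in>pts X. f j x + (\<lambda>x\<in>pts X. \<Sum>i\<in>I. f i x) x) \<in> smf X"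
    by (rule smf_add[OF assms(1)]) (use insert in auto)
  moreover have "(\<lambda>x\<in>pts X. \<Sum>i\<in>insert j I. f i x) = (\<lambda>x\<in>pts X. f j x + (\<lambda>x\<in>pts X. \<Sum>i\<in>I. f i x) x)"
    by (rule restrict_ext) (use insert(1,2) in simp)
  ultimately show ?case by metis
qed

section \<open>Smooth maps into generated structures, subspaces and products\<close>

lemma smooth_map_genI:
  assumes "saturated X" "\<phi> \<in> pts X \<rightarrow> S" "\<And>g. g \<in> F \<Longrightarrow> pull X \<phi> g \<in> smf X"
  shows "smooth_map X (gen S F) \<phi>"
  unfolding smooth_map_def
proof (intro conjI ballI)
  show "\<phi> \<in> pts X \<rightarrow> pts (gen S F)" using assms(2) by simp
  \<comment> \<open>Continuity follows from the generators alone; it supplies the neighbourhood on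
    which a local expression of h in the generators is pulled back term by term.\<close>
  have op: "openin (dtop X) {x \<in> pts X. \<phi> x \<in> W}" if W: "openin (init_top S F) W" for W
  proof (rule openin_init_top_vimage[OF W openin_dtop_pts])
    show "\<phi> ` pts X \<subseteq> S" using assms(2) by auto
    fix f U assume "f \<in> F" "open (U::real set)"
    then have "openin (dtop X) {x \<in> pts X. pull X \<phi> f x \<in> U}" using assms(3) openin_dtopI by blast
    moreover have "{x \<in> pts X. pull X \<phi> f x \<in> U} = {x \<in> pts X. f (\<phi> x) \<in> U}" by (auto simp: pull_def)
    ultimately show "openin (dtop X) {x \<in> pts X. f (\<phi> x) \<in> U}" by simp
  qed
  fix h assume h: "h \<in> smf (gen S F)"
  show "pull X \<phi> h \<in> smf X"
  proof (rule saturated_smfI[OF assms(1)])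
    show "pull X \<phi> h \<in> extensional (pts X)" by (simp add: pull_def)
    fix p assume p: "p \<in> pts X"
    then have "\<phi> p \<in> S" using assms(2) by auto
    obtain k g G W where W: "\<forall>i<k. g i \<in> F" "smooth_Rn k (Rn k) G" "openin (init_top S F) W" "\<phi> p \<in> W"
       "\<forall>q\<in>W. h q = G (\<lambda>i. if i < k then g i q else 0)"
      by (rule smf_genE[OF h \<open>\<phi> p \<in> S\<close>])
    show "\<exists>k g G W. (\<forall>i<k. g i \<in> smf X) \<and> smooth_Rn k (Rn k) G \<and> openin (dtop X) W \<and> p \<in> W \<and>
         (\<forall>q\<in>W. pull X \<phi> h q = G (\<lambda>i. if i < k then g i q else 0))"
      using W op[OF W(3)] p assms(3)
      by (intro exI[of _ k] exI[of _ "\<lambda>i. pull X \<phi> (g i)"] exI[of _ G] exI[of _ "{x \<in> pts X. \<phi> x \<in> W}"])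
        (auto simp: pull_def cong: if_cong)
  qed
qed

lemma smooth_map_cong:
  "(\<And>x. x \<in> pts X \<Longrightarrow> \<phi> x = \<psi> x) \<Longrightarrow> smooth_map X Y \<phi> \<longleftrightarrow> smooth_map X Y \<psi>"
proof -
  assume a: "\<And>x. x \<in> pts X \<Longrightarrow> \<phi> x = \<psi> x"
  then have "pull X \<phi> = pull X \<psi>" unfolding pull_def by (intro ext) (auto cong: restrict_cong)
  moreover have "\<phi> \<in> pts X \<rightarrow> pts Y \<longleftrightarrow> \<psi> \<in> pts X \<rightarrow> pts Y" using a by (auto simp: Pi_iff)
  ultimately show ?thesis unfolding smooth_map_def by simp
qed

lemma pull_pull: "\<phi> \<in> pts X \<rightarrow> pts Y \<Longrightarrow> pull X \<phi> (pull Y \<psi> g) = pull X (\<lambda>x. \<psi> (\<phi> x)) g"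
  unfolding pull_def by (auto intro!: restrict_ext simp: Pi_iff)

lemma smooth_map_compose:
  assumes "smooth_map X Y \<phi>" "smooth_map Y Z \<psi>"
  shows "smooth_map X Z (\<lambda>x. \<psi> (\<phi> x))"
  unfolding smooth_map_def
proof (intro conjI ballI)
  show "(\<lambda>x. \<psi> (\<phi> x)) \<in> pts X \<rightarrow> pts Z" using assms by (auto simp: smooth_map_def)
  fix g assume "g \<in> smf Z"
  then have "pull X \<phi> (pull Y \<psi> g) \<in> smf X" using assms by (auto simp: smooth_map_def)
  then show "pull X (\<lambda>x. \<psi> (\<phi> x)) g \<in> smf X"
    using pull_pull[of \<phi> X Y \<psi> g] assms(1) unfolding smooth_map_def by metis
qed

lemma smooth_map_into: "smooth_map X Y \<phi> \<Longrightarrow> x \<in> pts X \<Longrightarrow> \<phi> x \<in> pts Y"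
  by (auto simp: smooth_map_def)

lemma smooth_map_pull: "smooth_map X Y \<phi> \<Longrightarrow> g \<in> smf Y \<Longrightarrow> pull X \<phi> g \<in> smf X"
  by (auto simp: smooth_map_def)

lemma smooth_map_open_vimage:
  assumes "smooth_map X Y \<phi>" "openin (dtop Y) W"
  shows "openin (dtop X) {x \<in> pts X. \<phi> x \<in> W}"
proof (rule openin_init_top_vimage[OF assms(2)[unfolded dtop_def] openin_dtop_pts])
  show "\<phi> ` pts X \<subseteq> pts Y" using smooth_map_into[OF assms(1)] by auto
  fix f U assume "f \<in> smf Y" "open (U::real set)"
  then have "openin (dtop X) {x \<in> pts X. pull X \<phi> f x \<in> U}" 
    using assms openin_dtopI smooth_map_pull by blast
  moreover have "{x \<in> pts X. pull X \<phi> f x \<in> U} = {x \<in> pts X. f (\<phi> x) \<in> U}" by (auto simp: pull_def)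
  ultimately show "openin (dtop X) {x \<in> pts X. f (\<phi> x) \<in> U}" by simp
qed

lemma smooth_map_subspI:
  assumes "saturated X" "smooth_map X Y \<phi>" "\<phi> \<in> pts X \<rightarrow> S"
  shows "smooth_map X (subsp Y S) \<phi>"
  unfolding subsp_def
proof (rule smooth_map_genI[OF assms(1,3)])
  fix g assume "g \<in> (\<lambda>f. restrict f S) ` smf Y"
  then obtain f where f: "f \<in> smf Y" "g = restrict f S" by auto
  then have "pull X \<phi> g = pull X \<phi> f" using assms(3) by (auto simp: pull_def Pi_iff intro!: restrict_ext)
  then show "pull X \<phi> g \<in> smf X" using f smooth_map_pull[OF assms(2)] by simp
qed

lemma smooth_map_prodspI:
  assumes "saturated X" "smooth_map X Y \<phi>" "smooth_map X Z \<psi>"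
  shows "smooth_map X (prodsp Y Z) (\<lambda>x. (\<phi> x, \<psi> x))"
  unfolding prodsp_def
proof (rule smooth_map_genI[OF assms(1)])
  show "(\<lambda>x. (\<phi> x, \<psi> x)) \<in> pts X \<rightarrow> pts Y \<times> pts Z" using assms(2,3) by (auto simp: smooth_map_def)
  fix g assume "g \<in> {\<lambda>z\<in>pts Y \<times> pts Z. f (fst z) |f. f \<in> smf Y} \<union> {\<lambda>z\<in>pts Y \<times> pts Z. g (snd z) |g. g \<in> smf Z}"
  then consider f where "f \<in> smf Y" "g = (\<lambda>z\<in>pts Y \<times> pts Z. f (fst z))"
    | f where "f \<in> smf Z" "g = (\<lambda>z\<in>pts Y \<times> pts Z. f (snd z))" by auto
  then show "pull X (\<lambda>x. (\<phi> x, \<psi> x)) g \<in> smf X"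
  proof cases
    case 1
    then have "pull X (\<lambda>x. (\<phi> x, \<psi> x)) g = pull X \<phi> f"
      using smooth_map_into[OF assms(2)] smooth_map_into[OF assms(3)] by (auto simp: pull_def intro!: restrict_ext)
    then show ?thesis using smooth_map_pull[OF assms(2)] 1 by simp
  next
    case 2
    then have "pull X (\<lambda>x. (\<phi> x, \<psi> x)) g = pull X \<psi> f"
      using smooth_map_into[OF assms(2)] smooth_map_into[OF assms(3)] by (auto simp: pull_def intro!: restrict_ext)
    then show ?thesis using smooth_map_pull[OF assms(3)] 2 by simp
  qed
qed

lemma smooth_map_fst: "smooth_map (prodsp Y Z) Y fst"
  unfolding smooth_map_def
proof (intro conjI ballI)
  fix g assume "g \<in> smf Y"
  then have "(\<lambda>z\<in>pts Y \<times> pts Z. g (fst z)) \<in> smf (prodsp Y Z)"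
    unfolding prodsp_def by (intro gen_generator) auto
  then show "pull (prodsp Y Z) fst g \<in> smf (prodsp Y Z)" by (simp add: pull_def)
qed auto

lemma smooth_map_snd: "smooth_map (prodsp Y Z) Z snd"
  unfolding smooth_map_def
proof (intro conjI ballI)
  fix g assume "g \<in> smf Z"
  then have "(\<lambda>z\<in>pts Y \<times> pts Z. g (snd z)) \<in> smf (prodsp Y Z)"
    unfolding prodsp_def by (intro gen_generator) auto
  then show "pull (prodsp Y Z) snd g \<in> smf (prodsp Y Z)" by (simp add: pull_def)
qed auto

lemma smooth_map_subsp_incl:
  assumes "S \<subseteq> pts Y"
  shows "smooth_map (subsp Y S) Y (\<lambda>x. x)"
  unfolding smooth_map_def
proof (intro conjI ballI)
  show "(\<lambda>x. x) \<in> pts (subsp Y S) \<rightarrow> pts Y" using assms by auto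
  fix g assume "g \<in> smf Y"
  then have "restrict g S \<in> smf (subsp Y S)"
    unfolding subsp_def by (intro gen_generator) auto
  then show "pull (subsp Y S) (\<lambda>x. x) g \<in> smf (subsp Y S)"
    by (simp add: pull_def)
qed

section \<open>Open subspaces and locality\<close>

lemma openin_init_top_restrict:
  assumes "openin (init_top U ((\<lambda>f. restrict f U) ` smf X)) W" "openin (dtop X) U"
  shows "openin (dtop X) W"
  using assms(1)
proof (induct rule: init_top_induct)
  case (gen f V)
  then obtain g where g: "g \<in> smf X" "f = restrict g U" by auto
  have "{x \<in> U. f x \<in> V} = U \<inter> {x \<in> pts X. g x \<in> V}"
    using openin_dtop_subset[OF assms(2)] g by auto
  then show ?case using openin_dtopI[OF g(1) gen(2)] assms(2) by auto
qed (use assms(2) in auto)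

text \<open>A smooth function on U need not extend to X. But its local expression in restrictions of
  global functions makes sense for these functions themselves, and so defines F on all of X.\<close>

lemma smf_subsp_local:
  assumes "saturated X" "openin (dtop X) U" "f \<in> smf (subsp X U)" "p \<in> U"
  obtains W F where "openin (dtop X) W" "p \<in> W" "W \<subseteq> U" "F \<in> smf X" "\<And>q. q \<in> W \<Longrightarrow> f q = F q"
proof -
  let ?R = "(\<lambda>f. restrict f U) ` smf X"
  obtain k g G W where W: "\<forall>i<k. g i \<in> ?R" "smooth_Rn k (Rn k) G" "openin (init_top U ?R) W" "p \<in> W"
       "\<forall>q\<in>W. f q = G (\<lambda>i. if i < k then g i q else 0)"
    by (rule smf_genE[OF assms(3)[unfolded subsp_def] assms(4)])
  have WU: "W \<subseteq> U" using openin_init_top_subset[OF W(3)] .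
  from W(1) have "\<forall>i. \<exists>h. i < k \<longrightarrow> h \<in> smf X \<and> g i = restrict h U" by blast
  then obtain h where h: "\<And>i. i < k \<Longrightarrow> h i \<in> smf X \<and> g i = restrict (h i) U" by metis
  let ?F = "\<lambda>x\<in>pts X. G (\<lambda>i. if i < k then h i x else 0)"
  have "?F \<in> smf X" using smf_compose[OF assms(1) _ W(2)] h by blast
  moreover have "f q = ?F q" if "q \<in> W" for q
  proof -
    have "q \<in> U" "q \<in> pts X" using that WU openin_dtop_subset[OF assms(2)] by auto
    then show ?thesis using that W(5) h by (auto intro!: arg_cong[of _ _ G])
  qed
  ultimately show ?thesis
    using that[OF openin_init_top_restrict[OF W(3) assms(2)] W(4) WU] by blast
qed

lemma saturated_gen_subset: "smf (gen (pts X) (smf X)) \<subseteq> smf X \<Longrightarrow> (\<And>f. f \<in> smf X \<Longrightarrow> f \<in> extensional (pts X)) \<Longrightarrow> saturated X"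
proof -
  assume a: "smf (gen (pts X) (smf X)) \<subseteq> smf X" "\<And>f. f \<in> smf X \<Longrightarrow> f \<in> extensional (pts X)"
  then have "smf (gen (pts X) (smf X)) = smf X" using gen_generator by blast
  moreover have "pts (gen (pts X) (smf X)) = pts X" by simp
  ultimately show ?thesis unfolding saturated_def by (cases "gen (pts X) (smf X)"; cases X) auto
qed

text \<open>Generating once more from the smooth functions of U adds nothing: near p each of the
  finitely many functions involved agrees with a global one, and finitely many neighbourhoods can be
  intersected.\<close>

lemma saturated_subsp:
  fixes X :: "'a dspace"
  assumes X: "saturated X" and U: "openin (dtop X) U"
  shows "saturated (subsp X U)"
proof (rule saturated_gen_subset)
  let ?Y = "subsp X U"
  show "f \<in> extensional (pts ?Y)" if "f \<in> smf ?Y" for f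
    using that smf_gen_extensional unfolding subsp_def by fastforce
  \<comment> \<open>The topology of the subspace is defined by all smooth functions on U, not just
    by restrictions, so that its open sets are open in X depends on the local extensions.\<close>
  have opX: "openin (dtop X) W" if "openin (dtop ?Y) W" for W
    using that unfolding dtop_def pts_subsp
  proof (induct rule: init_top_induct)
    case (gen f V)
    have "\<exists>T. openin (dtop X) T \<and> p \<in> T \<and> T \<subseteq> {x \<in> U. f x \<in> V}" if p: "p \<in> {x \<in> U. f x \<in> V}" for p
    proof -
      obtain W F where W: "openin (dtop X) W" "p \<in> W" "W \<subseteq> U" "F \<in> smf X" "\<And>q. q \<in> W \<Longrightarrow> f q = F q"
        using smf_subsp_local[OF X U gen(1), of p] p by blast
      then have "openin (dtop X) (W \<inter> {x \<in> pts X. F x \<in> V})"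
        using openin_dtopI[OF W(4) gen(2)] by auto
      then show ?thesis using W p openin_dtop_subset[OF W(1)] by (intro exI[of _ "W \<inter> {x \<in> pts X. F x \<in> V}"]) auto
    qed
    then have "openin (dtop X) {x \<in> U. f x \<in> V}" by (subst openin_subopen) blast
    then show ?case by (simp add: dtop_def)
  qed (use U in \<open>auto simp: dtop_def\<close>)
  have opY: "openin (init_top U ((\<lambda>f. restrict f U) ` smf X)) (W \<inter> U)" if "openin (dtop X) W" for W
  proof -
    have "openin (init_top U ((\<lambda>f. restrict f U) ` smf X)) {x \<in> U. x \<in> W}"
    proof (rule openin_init_top_vimage[OF that[unfolded dtop_def]])
      show "openin (init_top U ((\<lambda>f. restrict f U) ` smf X)) U"
        using openin_topspace[of "init_top U ((\<lambda>f. restrict f U) ` smf X)"] by simp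
      show "(\<lambda>x. x) ` U \<subseteq> pts X" using openin_dtop_subset[OF U] by auto
      fix f V assume "f \<in> smf X" "open (V::real set)"
      then have "openin (init_top U ((\<lambda>f. restrict f U) ` smf X)) {x \<in> U. restrict f U x \<in> V}"
        by (intro openin_init_topI imageI)
      then show "openin (init_top U ((\<lambda>f. restrict f U) ` smf X)) {x \<in> U. f x \<in> V}"
        by (simp cong: conj_cong)
    qed
    moreover have "{x \<in> U. x \<in> W} = W \<inter> U" by auto
    ultimately show ?thesis by simp
  qed
  show "smf (gen (pts ?Y) (smf ?Y)) \<subseteq> smf ?Y"
  proof
    fix f assume f: "f \<in> smf (gen (pts ?Y) (smf ?Y))"
    show "f \<in> smf ?Y"
      unfolding subsp_def smf_gen_iff
    proof (intro conjI ballI)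
      show "f \<in> extensional U" using smf_gen_extensional[OF f] by simp
      fix p assume p: "p \<in> U"
      then have "\<exists>k g G W. (\<forall>i<k. g i \<in> smf ?Y) \<and> smooth_Rn k (Rn k) G \<and> openin (dtop ?Y) W \<and> p \<in> W \<and>
          (\<forall>q\<in>W. f q = G (\<lambda>i. if i < k then g i q else 0))"
        using f unfolding smf_gen_iff dtop_def by simp
      then obtain k g G W where W: "\<forall>i<k. g i \<in> smf ?Y" "smooth_Rn k (Rn k) G" "openin (dtop ?Y) W" "p \<in> W"
          "\<forall>q\<in>W. f q = G (\<lambda>i. if i < k then g i q else 0)"
        by blast
      have "\<forall>i. \<exists>T F. i < k \<longrightarrow> openin (dtop X) T \<and> p \<in> T \<and> T \<subseteq> U \<and> F \<in> smf X \<and> (\<forall>q\<in>T. g i q = F q)"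
      proof
        fix i
        show "\<exists>T F. i < k \<longrightarrow> openin (dtop X) T \<and> p \<in> T \<and> T \<subseteq> U \<and> F \<in> smf X \<and> (\<forall>q\<in>T. g i q = F q)"
        proof (cases "i < k")
          case True
          then obtain T F where "openin (dtop X) T" "p \<in> T" "T \<subseteq> U" "F \<in> smf X" "\<And>q. q \<in> T \<Longrightarrow> g i q = F q"
            using smf_subsp_local[OF X U _ p] W(1) by metis
          then show ?thesis by blast
        qed auto
      qed
      then obtain T F where T: "\<And>i. i < k \<Longrightarrow> openin (dtop X) (T i) \<and> p \<in> T i \<and> T i \<subseteq> U \<and> F i \<in> smf X \<and> (\<forall>q\<in>T i. g i q = F i q)"
        by metis
      \<comment> \<open>For \<open>k = 0\<close> the intersection would be \<open>UNIV\<close>,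
        which may leave \<open>pts X\<close>.\<close>
      let ?N = "W \<inter> (if k = 0 then pts X else \<Inter>i\<in>{..<k}. T i)"
      have "openin (dtop X) (if k = 0 then pts X else \<Inter>i\<in>{..<k}. T i)"
        using T by (auto intro!: openin_INT)
      then have "openin (dtop X) ?N" using opX[OF W(3)] by blast
      from opY[OF this] have N: "openin (init_top U ((\<lambda>f. restrict f U) ` smf X)) (?N \<inter> U)" .
      have "f q = G (\<lambda>i. if i < k then restrict (F i) U q else 0)" if q: "q \<in> ?N \<inter> U" for q
      proof -
        have "g i q = restrict (F i) U q" if "i < k" for i
        proof -
          have "q \<in> T i" "q \<in> U" using q that by (auto split: if_splits)
          then show ?thesis using T[OF that] by auto
        qed
        then have "(\<lambda>i. if i < k then g i q else 0) = (\<lambda>i. if i < k then restrict (F i) U q else 0)" by auto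
        moreover have "f q = G (\<lambda>i. if i < k then g i q else 0)" using q W(5) by blast
        ultimately show ?thesis by simp
      qed
      moreover have "p \<in> ?N \<inter> U" using W(4) T p openin_dtop_subset[OF U] by auto
      ultimately show "\<exists>k g G W. (\<forall>i<k. g i \<in> (\<lambda>f. restrict f U) ` smf X) \<and> smooth_Rn k (Rn k) G \<and>
          openin (init_top U ((\<lambda>f. restrict f U) ` smf X)) W \<and> p \<in> W \<and>
          (\<forall>q\<in>W. f q = G (\<lambda>i. if i < k then g i q else 0))"
        using W(2) T N
        by (intro exI[of _ k] exI[of _ "\<lambda>i. restrict (F i) U"] exI[of _ G] exI[of _ "?N \<inter> U"]) blast
    qed
  qed
qed

lemma smooth_map_locally:
  assumes "saturated X" "\<And>p. p \<in> pts X \<Longrightarrow> \<exists>U. openin (dtop X) U \<and> p \<in> U \<and> smooth_map (subsp X U) Y \<phi>"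
  shows "smooth_map X Y \<phi>"
  unfolding smooth_map_def
proof (intro conjI ballI)
  show "\<phi> \<in> pts X \<rightarrow> pts Y"
  proof
    fix p assume "p \<in> pts X"
    then obtain U where "p \<in> U" "smooth_map (subsp X U) Y \<phi>" using assms(2) by blast
    then show "\<phi> p \<in> pts Y" using smooth_map_into[of "subsp X U" Y \<phi> p] by simp
  qed
  fix g assume g: "g \<in> smf Y"
  show "pull X \<phi> g \<in> smf X"
  proof (rule smf_locally[OF assms(1)])
    show "pull X \<phi> g \<in> extensional (pts X)" by (simp add: pull_def)
    fix p assume "p \<in> pts X"
    then obtain U where U: "openin (dtop X) U" "p \<in> U" "smooth_map (subsp X U) Y \<phi>" using assms(2) by blast
    obtain W F where W: "openin (dtop X) W" "p \<in> W" "W \<subseteq> U" "F \<in> smf X"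
      "\<And>q. q \<in> W \<Longrightarrow> pull (subsp X U) \<phi> g q = F q"
      using smf_subsp_local[OF assms(1) U(1) smooth_map_pull[OF U(3) g] U(2)] by blast
    then show "\<exists>W F. openin (dtop X) W \<and> p \<in> W \<and> F \<in> smf X \<and> (\<forall>q\<in>W. pull X \<phi> g q = F q)"
      using openin_dtop_subset[OF W(1)]
      by (intro exI[of _ W] exI[of _ F]) (auto simp: pull_def subset_iff)
  qed
qed

text \<open>A substitute for a squared distance from p. Nonnegativity lets a sum control both
  summands, which settles intersections; a subbasic set is settled by the square of
  \<open>(f - f p) / e\<close>, where U contains the closed ball of radius e around
  \<open>f p\<close>.\<close>

lemma neighbourhood_function:
  assumes "saturated X" "openin (dtop X) W" "p \<in> W"
  obtains N where "N \<in> smf X" "N p = 0" "\<And>q. q \<in> pts X \<Longrightarrow> N q \<ge> 0" "{q \<in> pts X. N q \<le> 1} \<subseteq> W"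
proof -
  have "\<forall>p\<in>W. \<exists>N\<in>smf X. N p = 0 \<and> (\<forall>q\<in>pts X. N q \<ge> 0) \<and> {q \<in> pts X. N q \<le> 1} \<subseteq> W"
    using assms(2) unfolding dtop_def
  proof (induct rule: init_top_induct)
    case (Int a b)
    show ?case
    proof
      fix p assume p: "p \<in> a \<inter> b"
      obtain M where M: "M \<in> smf X" "M p = 0" "\<forall>q\<in>pts X. M q \<ge> 0" "{q \<in> pts X. M q \<le> 1} \<subseteq> a"
        using Int(1) p by blast
      obtain N where N: "N \<in> smf X" "N p = 0" "\<forall>q\<in>pts X. N q \<ge> 0" "{q \<in> pts X. N q \<le> 1} \<subseteq> b"
        using Int(2) p by blast
      let ?L = "\<lambda>x\<in>pts X. M x + N x"
      have "?L \<in> smf X" using smf_add[OF assms(1) M(1) N(1)] .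
      moreover have "?L p = 0"
      proof (cases "p \<in> pts X")
        case False
        \<comment> \<open>The induction does not record that a and b lie in \<open>pts X\<close>.
          Outside it, M and the sum are both \<open>undefined\<close>, and \<open>M p = 0\<close>
          identifies this value with 0.\<close>
        have "M p = undefined" using False M(1) saturated_extensional[OF assms(1)] by (metis extensional_arb)
        then show ?thesis using False M by simp
      qed (use M N in auto)
      moreover have "{q \<in> pts X. ?L q \<le> 1} \<subseteq> a \<inter> b"
      proof
        fix q assume "q \<in> {q \<in> pts X. ?L q \<le> 1}"
        then have "q \<in> pts X" "M q \<ge> 0" "N q \<ge> 0" "M q + N q \<le> 1" using M N by auto
        then have "q \<in> pts X" "M q \<le> 1" "N q \<le> 1" by linarith+
        then show "q \<in> a \<inter> b" using M(4) N(4) by auto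
      qed
      ultimately show "\<exists>N\<in>smf X. N p = 0 \<and> (\<forall>q\<in>pts X. N q \<ge> 0) \<and> {q \<in> pts X. N q \<le> 1} \<subseteq> a \<inter> b"
        using M(3) N(3) by (intro bexI[of _ ?L]) auto
    qed
  next
    case (Un K)
    show ?case
    proof
      fix p assume "p \<in> \<Union>K"
      then obtain k where "k \<in> K" "p \<in> k" by blast
      then obtain N where "N \<in> smf X" "N p = 0" "\<forall>q\<in>pts X. N q \<ge> 0" "{q \<in> pts X. N q \<le> 1} \<subseteq> k"
        using Un by blast
      then show "\<exists>N\<in>smf X. N p = 0 \<and> (\<forall>q\<in>pts X. N q \<ge> 0) \<and> {q \<in> pts X. N q \<le> 1} \<subseteq> \<Union>K"
        using \<open>k \<in> K\<close> by (intro bexI[of _ N]) auto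
    qed
  next
    case whole
    show ?case using smf_const[OF assms(1), of 0] by (intro ballI bexI[of _ "\<lambda>x\<in>pts X. 0"]) auto
  next
    case (gen f U)
    show ?case
    proof
      fix p assume p: "p \<in> {x \<in> pts X. f x \<in> U}"
      then obtain e where e: "e > 0" "cball (f p) e \<subseteq> U" using gen(2) open_contains_cball by blast
      let ?g = "\<lambda>x\<in>pts X. - f p / e + (1 / e) * f x"
      let ?N = "\<lambda>x\<in>pts X. ?g x * ?g x"
      have "?g \<in> smf X" using smf_affine[OF assms(1) gen(1)] .
      then have "?N \<in> smf X" using smf_mult[OF assms(1)] by blast
      moreover have "?N p = 0" using p by simp
      moreover have "\<forall>q\<in>pts X. ?N q \<ge> 0" by simp
      moreover have "{q \<in> pts X. ?N q \<le> 1} \<subseteq> {x \<in> pts X. f x \<in> U}"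
      proof
        fix q assume q: "q \<in> {q \<in> pts X. ?N q \<le> 1}"
        then have "(- f p / e + (1 / e) * f q)^2 \<le> 1"
          unfolding power2_eq_square by (metis (no_types, lifting) mem_Collect_eq restrict_apply')
        moreover have "- f p / e + (1 / e) * f q = (f q - f p) / e" by (simp add: diff_divide_distrib)
        ultimately have "\<bar>(f q - f p) / e\<bar> \<le> 1" by (simp only: abs_square_le_1)
        then have "\<bar>f q - f p\<bar> \<le> e" using e(1) by (simp add: field_simps)
        then have "f q \<in> cball (f p) e" by (simp add: dist_real_def)
        then show "q \<in> {x \<in> pts X. f x \<in> U}" using e(2) q by auto
      qed
      ultimately show "\<exists>N\<in>smf X. N p = 0 \<and> (\<forall>q\<in>pts X. N q \<ge> 0) \<and> {q \<in> pts X. N q \<le> 1} \<subseteq> {x \<in> pts X. f x \<in> U}"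
        by (intro bexI[of _ ?N]) auto
    qed
  qed simp
  then show ?thesis using assms(3) that by blast
qed

lemma smf_flat:
  assumes "saturated X" "f \<in> smf X"
  shows "(\<lambda>x\<in>pts X. flat P (f x)) \<in> smf X"
  using smf_compose[OF assms(1) _ smooth_Rn_flat[of "Rn 1" P], of "\<lambda>_. f"] assms(2) by simp

text \<open>V is there for extension by zero: a coefficient multiplied by b vanishes on V, and W and
  V cover the space.\<close>

lemma bump_function:
  assumes "saturated X" "openin (dtop X) W" "p \<in> W"
  obtains b U V where "b \<in> smf X" "openin (dtop X) U" "openin (dtop X) V" "p \<in> U"
    "\<And>q. q \<in> U \<Longrightarrow> b q = 1" "\<And>q. q \<in> V \<Longrightarrow> b q = 0" "U \<subseteq> W" "pts X = W \<union> V"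
proof -
  obtain N where N: "N \<in> smf X" "N p = 0" "\<And>q. q \<in> pts X \<Longrightarrow> N q \<ge> 0" "{q \<in> pts X. N q \<le> 1} \<subseteq> W"
    using neighbourhood_function[OF assms] by blast
  \<comment> \<open>With \<open>\<phi> y = exp (- 1 / y)\<close> for \<open>y > 0\<close> and \<open>0\<close> otherwise, \<open>e\<^sup>2 \<cdot> \<phi> (1/2 - \<phi> y)\<close> is exactly \<open>1\<close> for \<open>y \<le> 0\<close> and
    exactly \<open>0\<close> for \<open>y \<ge> 2\<close>; this avoids the reciprocals of the usual partition of unity.\<close>
  let ?t = "\<lambda>x\<in>pts X. - 1 + 3 * N x"
  let ?f = "\<lambda>x\<in>pts X. flat 1 (?t x)"
  let ?g = "\<lambda>x\<in>pts X. 1 / 2 + (- 1) * ?f x"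
  let ?h = "\<lambda>x\<in>pts X. flat 1 (?g x)"
  let ?b = "\<lambda>x\<in>pts X. 0 + exp 2 * ?h x"
  have "?t \<in> smf X" by (rule smf_affine[OF assms(1) N(1)])
  from smf_flat[OF assms(1) this] have "?f \<in> smf X" .
  from smf_affine[OF assms(1) this] have "?g \<in> smf X" .
  from smf_flat[OF assms(1) this] have "?h \<in> smf X" .
  from smf_affine[OF assms(1) this] have chi: "?b \<in> smf X" .
  \<comment> \<open>With t = 3 N - 1, N < 1/3 gives t < 0 and N > 1 gives t > 2: the two ranges on
    which the profile is constant.\<close>
  let ?U = "{x \<in> pts X. N x \<in> {..<1/3}}" and ?V = "{x \<in> pts X. N x \<in> {1<..}}"
  have U: "openin (dtop X) ?U" and V: "openin (dtop X) ?V"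
    by (rule openin_dtopI[OF N(1)], simp)+
  have pX: "p \<in> pts X" using assms(2,3) openin_dtop_subset by blast
  have "?b q = 1" if "q \<in> ?U" for q
  proof -
    have "?f q = 0" using that by (simp add: flat_def)
    then show ?thesis using that by (simp add: flat_def exp_minus)
  qed
  moreover have "?b q = 0" if "q \<in> ?V" for q
  proof -
    have "- 1 + 3 * N q > 2" using that by simp
    then have "1 / (- 1 + 3 * N q) < 1 / 2" by (simp add: field_simps)
    moreover have "exp (- (1 / (- 1 + 3 * N q))) \<ge> 1 + - (1 / (- 1 + 3 * N q))" by (rule exp_ge_add_one_self)
    ultimately have "exp (- (1 / (- 1 + 3 * N q))) > 1 / 2" by linarith
    then show ?thesis using that \<open>- 1 + 3 * N q > 2\<close> by (simp add: flat_def)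
  qed
  moreover have "?U \<subseteq> W" using N(4) by auto
  moreover have "pts X = W \<union> ?V" using N(4) openin_dtop_subset[OF assms(2)] by force
  moreover have "p \<in> ?U" using N(2) pX by simp
  ultimately show ?thesis using that[OF chi U V] by blast
qed

section \<open>Sections of vector bundles\<close>

lemma manifold_saturated: "manifold X \<Longrightarrow> saturated X"
  by (simp add: manifold_def saturated_def)

lemma smooth_map_id: "saturated X \<Longrightarrow> smooth_map X X (\<lambda>x. x)"
proof -
  assume s: "saturated X"
  have "pull X (\<lambda>x. x) g = g" if "g \<in> smf X" for g
    using saturated_extensional[OF s that] by (simp add: pull_def extensional_restrict)
  then show ?thesis by (auto simp: smooth_map_def)
qed

text \<open>A partial derivative in a direction \<open>i < n\<close> moves a point inside
  \<open>Rn n\<close>, so it sees only the values there; the first derivatives of f then serve for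
  f' as well.\<close>

lemma smooth_Rn_cong:
  assumes "smooth_Rn n (Rn n) f" "\<And>x. x \<in> Rn n \<Longrightarrow> f x = f' x"
  shows "smooth_Rn n (Rn n) f'"
  using assms(1)
proof cases
  case (1 g)
  have upd: "x(i := t) \<in> Rn n" if "x \<in> Rn n" "i < n" for x i t
    using that by (auto simp: Rn_def)
  show ?thesis
  proof (rule smooth_Rn.intros)
    show "continuous_on (Rn n) f'" using 1(1) assms(2) by (simp cong: continuous_on_cong)
    fix i x assume i: "i < n" "x \<in> Rn n"
    have "(\<lambda>t. f' (x(i := t))) = (\<lambda>t. f (x(i := t)))" using assms(2) upd[OF i(2,1)] by auto
    then show "((\<lambda>t. f' (x(i := t))) has_real_derivative g i x) (at (x i))" using 1(2)[OF i] by simp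
  qed (rule 1(3))
qed

lemma smooth_Rn_coordinate: "smooth_Rn n V (\<lambda>x. x i)"
proof (rule smooth_Rn.intros)
  show "continuous_on V (\<lambda>x. x i)"
    by (rule continuous_on_subset[OF continuous_on_product_coordinates]) simp
  show "((\<lambda>t. (x(j := t)) i) has_real_derivative (if i = j then 1 else 0)) (at (x j))" for j and x :: "nat \<Rightarrow> real"
    by (auto intro!: derivative_eq_intros)
  show "smooth_Rn n V (\<lambda>x. if i = j then 1 else 0)" for j
    using smooth_Rn_bilinear[of n V "if i = j then 1 else 0" 0 0 0] by simp
qed

lemma coordinate_smf: "(\<lambda>x\<in>Rn n. x i) \<in> smf (Rn_space n (Rn n))"
  using smooth_Rn_cong[OF smooth_Rn_coordinate[of n "Rn n" i], of "\<lambda>x\<in>Rn n. x i"] by (simp add: Rn_space_def)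

lemma smooth_map_Rn_space:
  assumes "saturated X" "\<And>i. i < r \<Longrightarrow> f i \<in> smf X"
  shows "smooth_map X (Rn_space r (Rn r)) (\<lambda>q i. if i < r then f i q else 0)"
  unfolding smooth_map_def
proof (intro conjI ballI)
  show "(\<lambda>q i. if i < r then f i q else 0) \<in> pts X \<rightarrow> pts (Rn_space r (Rn r))" by (simp add: Rn_def)
  fix g assume "g \<in> smf (Rn_space r (Rn r))"
  then have "smooth_Rn r (Rn r) g" by (simp add: Rn_space_def)
  from smf_compose[OF assms this] show "pull X (\<lambda>q i. if i < r then f i q else 0) g \<in> smf X"
    by (simp add: pull_def)
qed

section \<open>Linear algebra in the fibres\<close>

lemma vb_fvs: "vector_bundle E \<Longrightarrow> fibres_vector_spaces E"
  by (simp add: vector_bundle_def)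

lemma vb_saturated: "vector_bundle E \<Longrightarrow> saturated (tot E)" "vector_bundle E \<Longrightarrow> saturated (bas E)"
  by (simp_all add: vector_bundle_def manifold_saturated)

lemma vb_prj_smooth: "vector_bundle E \<Longrightarrow> smooth_map (tot E) (bas E) (prj E)"
  by (simp add: vector_bundle_def)

lemma vb_in_fib: "vector_bundle E \<Longrightarrow> u \<in> pts (tot E) \<Longrightarrow> prj E u \<in> pts (bas E) \<and> u \<in> fib E (prj E u)"
  using smooth_map_into[OF vb_prj_smooth] by (simp add: fib_def)

context
  fixes E :: "('e, 'm) vbun"
  assumes fvs: "fibres_vector_spaces E"
begin

lemma vzero_in: "m \<in> pts (bas E) \<Longrightarrow> vzero E m \<in> fib E m"
  using fvs unfolding fibres_vector_spaces_def by blast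

lemma vadd_in: "m \<in> pts (bas E) \<Longrightarrow> u \<in> fib E m \<Longrightarrow> v \<in> fib E m \<Longrightarrow> vadd E u v \<in> fib E m"
  using fvs unfolding fibres_vector_spaces_def by blast

lemma vscl_in: "m \<in> pts (bas E) \<Longrightarrow> u \<in> fib E m \<Longrightarrow> vscl E r u \<in> fib E m"
  using fvs unfolding fibres_vector_spaces_def by blast

lemma vadd_commute: "m \<in> pts (bas E) \<Longrightarrow> u \<in> fib E m \<Longrightarrow> v \<in> fib E m \<Longrightarrow> vadd E u v = vadd E v u"
  using fvs unfolding fibres_vector_spaces_def by blast

lemma vadd_zero_left: "m \<in> pts (bas E) \<Longrightarrow> u \<in> fib E m \<Longrightarrow> vadd E (vzero E m) u = u"
  using fvs unfolding fibres_vector_spaces_def by blast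

lemma vadd_zero_right: "m \<in> pts (bas E) \<Longrightarrow> u \<in> fib E m \<Longrightarrow> vadd E u (vzero E m) = u"
  using vadd_commute vadd_zero_left vzero_in by metis

lemma vadd_neg: "m \<in> pts (bas E) \<Longrightarrow> u \<in> fib E m \<Longrightarrow> vadd E u (vscl E (-1) u) = vzero E m"
  using fvs unfolding fibres_vector_spaces_def by blast

lemma vscl_one: "m \<in> pts (bas E) \<Longrightarrow> u \<in> fib E m \<Longrightarrow> vscl E 1 u = u"
  using fvs unfolding fibres_vector_spaces_def by blast

lemma vscl_vscl: "m \<in> pts (bas E) \<Longrightarrow> u \<in> fib E m \<Longrightarrow> vscl E r (vscl E s u) = vscl E (r * s) u"
  using fvs unfolding fibres_vector_spaces_def by blast

text \<open>No axiom mentions the scalar 0, so it is written as \<open>1 + (-1)\<close>.\<close>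

lemma vscl_zero: 
  assumes "m \<in> pts (bas E)" "u \<in> fib E m" 
  shows "vscl E 0 u = vzero E m"
proof -
  have "vscl E (1 + (-1)) u = vadd E (vscl E 1 u) (vscl E (-1) u)"
    using fvs assms unfolding fibres_vector_spaces_def by blast
  then show ?thesis using vadd_neg[OF assms] vscl_one[OF assms] by simp
qed

lemma vscl_vzero: "m \<in> pts (bas E) \<Longrightarrow> vscl E r (vzero E m) = vzero E m"
  using vscl_zero[OF _ vzero_in] vscl_vscl[OF _ vzero_in, of m r 0] by simp

lemma fib_dual_vzero: "m \<in> pts (bas E) \<Longrightarrow> \<xi> \<in> fib_dual E m \<Longrightarrow> \<xi> (vzero E m) = 0"
  using vscl_zero[OF _ vzero_in, of m] vzero_in by (auto simp: fib_dual_def) (metis mult_zero_left)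

end

section \<open>Dual bundles and sections\<close>

lemma fib_dualD:
  assumes "\<xi> \<in> fib_dual E m"
  shows "u \<in> fib E m \<Longrightarrow> v \<in> fib E m \<Longrightarrow> \<xi> (vadd E u v) = \<xi> u + \<xi> v"
    and "u \<in> fib E m \<Longrightarrow> \<xi> (vscl E r u) = r * \<xi> u"
    and "\<xi> \<in> extensional (fib E m)"
  using assms by (auto simp: fib_dual_def)

lemma pts_dual [simp]: "pts (tot (dual E)) = dual_pts E" and bas_dual [simp]: "bas (dual E) = bas E"
  and prj_dual [simp]: "prj (dual E) = fst"
  by (simp_all add: dual_def)

lemma ell_sect_smf: "s \<in> Sect E \<Longrightarrow> ell_sect E s \<in> smf (tot (dual E))"
  unfolding dual_def by (simp, rule gen_generator) (auto simp: ell_sect_def)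

lemma pull_prj_dual_smf: "f \<in> smf (bas E) \<Longrightarrow> pull (tot (dual E)) fst f \<in> smf (tot (dual E))"
  unfolding pull_def dual_def by (simp, rule gen_generator) auto

lemma smooth_map_into_dual:
  assumes "saturated X" "\<phi> \<in> pts X \<rightarrow> dual_pts E" "smooth_map X (bas E) (\<lambda>x. fst (\<phi> x))"
    and "\<And>s. s \<in> Sect E \<Longrightarrow> (\<lambda>x\<in>pts X. snd (\<phi> x) (s (fst (\<phi> x)))) \<in> smf X"
  shows "smooth_map X (tot (dual E)) \<phi>"
  unfolding dual_def vbun.simps
proof (rule smooth_map_genI[OF assms(1,2)])
  fix g assume "g \<in> {\<lambda>\<xi>\<in>dual_pts E. f (fst \<xi>) |f. f \<in> smf (bas E)} \<union> ell_sect E ` Sect E"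
  then consider f where "f \<in> smf (bas E)" "g = (\<lambda>\<xi>\<in>dual_pts E. f (fst \<xi>))"
    | s where "s \<in> Sect E" "g = ell_sect E s" by auto
  then show "pull X \<phi> g \<in> smf X"
  proof cases
    case 1
    have "pull X \<phi> g = pull X (\<lambda>x. fst (\<phi> x)) f"
      unfolding pull_def 1(2) using assms(2) by (intro restrict_ext) auto
    then show ?thesis using smooth_map_pull[OF assms(3) 1(1)] by simp
  next
    case 2
    have "pull X \<phi> g = (\<lambda>x\<in>pts X. snd (\<phi> x) (s (fst (\<phi> x))))"
      unfolding pull_def 2(2) ell_sect_def using assms(2) by (intro restrict_ext) auto
    then show ?thesis using assms(4)[OF 2(1)] by simp
  qed
qed

lemma Sect_smooth: "s \<in> Sect E \<Longrightarrow> smooth_map (bas E) (tot E) s"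
  by (simp add: Sect_def)

lemma Sect_fib: "s \<in> Sect E \<Longrightarrow> m \<in> pts (bas E) \<Longrightarrow> s m \<in> fib E m"
  using smooth_map_into[OF Sect_smooth, of s E m] by (auto simp: fib_def Sect_def)

lemma Sect_dual_fib: "\<xi> \<in> Sect (dual E) \<Longrightarrow> m \<in> pts (bas E) \<Longrightarrow> fst (\<xi> m) = m \<and> snd (\<xi> m) \<in> fib_dual E m \<and> \<xi> m \<in> dual_pts E"
  using Sect_fib[of \<xi> "dual E" m] by (auto simp: fib_def dual_pts_def)

lemma pairing_smf:
  assumes "\<xi> \<in> Sect (dual E)" "s \<in> Sect E"
  shows "pairing E \<xi> s \<in> smf (bas E)"
proof -
  have "pull (bas E) \<xi> (ell_sect E s) = pairing E \<xi> s"
    unfolding pull_def pairing_def ell_sect_def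
    using Sect_dual_fib[OF assms(1)] by (intro restrict_ext) auto
  then show ?thesis using smooth_map_pull[OF Sect_smooth[OF assms(1)] ell_sect_smf[OF assms(2)]] by simp
qed

lemma SectI:
  assumes "smooth_map (bas E) (tot E) s" "\<And>m. m \<in> pts (bas E) \<Longrightarrow> prj E (s m) = m"
  shows "restrict s (pts (bas E)) \<in> Sect E"
  using assms smooth_map_cong[of "bas E" s "restrict s (pts (bas E))" "tot E"] by (simp add: Sect_def)

section \<open>Local frames and extension of sections\<close>

locale trivialised =
  fixes E :: "('e, 'm) vbun" and U :: "'m set" and r :: nat and \<Phi> :: "'e \<Rightarrow> 'm \<times> (nat \<Rightarrow> real)"
  assumes vb: "vector_bundle E" and openU: "openin (dtop (bas E)) U" and triv: "local_trivialisation E r U \<Phi>"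
begin

definition TU :: "'e set" where "TU = {e \<in> pts (tot E). prj E e \<in> U}"

definition \<Psi> :: "'m \<times> (nat \<Rightarrow> real) \<Rightarrow> 'e" where "\<Psi> = inv_into TU \<Phi>"

lemma U_sub: "U \<subseteq> pts (bas E)"
  using openin_dtop_subset[OF openU] .

lemma openTU: "openin (dtop (tot E)) TU"
  unfolding TU_def by (rule smooth_map_open_vimage[OF vb_prj_smooth[OF vb] openU])

lemma bij: "bij_betw \<Phi> TU (U \<times> Rn r)"
  and smooth_Phi: "smooth_map (subsp (tot E) TU) (prodsp (subsp (bas E) U) (Rn_space r (Rn r))) \<Phi>"
  and smooth_Psi: "smooth_map (prodsp (subsp (bas E) U) (Rn_space r (Rn r))) (subsp (tot E) TU) \<Psi>"
  using triv unfolding local_trivialisation_def diffeo_def TU_def[symmetric] \<Psi>_def by simp_all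

lemma Phi_fst: "u \<in> fib E q \<Longrightarrow> q \<in> U \<Longrightarrow> fst (\<Phi> u) = q"
  and Phi_vscl: "u \<in> fib E q \<Longrightarrow> q \<in> U \<Longrightarrow> snd (\<Phi> (vscl E c u)) = (\<lambda>i. c * snd (\<Phi> u) i)"
  and Phi_vadd: "u \<in> fib E q \<Longrightarrow> v \<in> fib E q \<Longrightarrow> q \<in> U \<Longrightarrow>
    snd (\<Phi> (vadd E u v)) = (\<lambda>i. snd (\<Phi> u) i + snd (\<Phi> v) i)"
  using triv unfolding local_trivialisation_def by auto

lemma fib_TU: "u \<in> fib E q \<Longrightarrow> q \<in> U \<Longrightarrow> u \<in> TU"
  by (auto simp: fib_def TU_def)

lemma Psi_fib: 
  assumes "q \<in> U" "x \<in> Rn r" shows "\<Psi> (q, x) \<in> fib E q" "\<Phi> (\<Psi> (q, x)) = (q, x)"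
proof -
  have i: "(q, x) \<in> \<Phi> ` TU" using bij assms by (auto simp: bij_betw_def)
  then have "\<Psi> (q, x) \<in> TU" unfolding \<Psi>_def by (rule inv_into_into)
  moreover show p: "\<Phi> (\<Psi> (q, x)) = (q, x)" unfolding \<Psi>_def by (rule f_inv_into_f[OF i])
  ultimately have "\<Psi> (q, x) \<in> fib E (prj E (\<Psi> (q, x)))" "prj E (\<Psi> (q, x)) \<in> U" by (auto simp: fib_def TU_def)
  from Phi_fst[OF this] p this(1) show "\<Psi> (q, x) \<in> fib E q" by simp
qed

lemma Psi_Phi: "u \<in> TU \<Longrightarrow> \<Psi> (\<Phi> u) = u"
  unfolding \<Psi>_def using bij by (simp add: bij_betw_def)

lemma Psi_eqI: "u \<in> fib E q \<Longrightarrow> q \<in> U \<Longrightarrow> snd (\<Phi> u) = x \<Longrightarrow> \<Psi> (q, x) = u"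
  using Psi_Phi[OF fib_TU] Phi_fst by (metis prod.collapse)

lemma Psi_vadd:
  assumes "q \<in> U" "x \<in> Rn r" "y \<in> Rn r"
  shows "\<Psi> (q, \<lambda>i. x i + y i) = vadd E (\<Psi> (q, x)) (\<Psi> (q, y))"
  using assms Psi_fib[of q x] Psi_fib[of q y] U_sub
  by (intro Psi_eqI vadd_in[OF vb_fvs[OF vb]]) (auto simp: Phi_vadd[of _ q])

lemma Psi_vscl:
  assumes "q \<in> U" "x \<in> Rn r"
  shows "\<Psi> (q, \<lambda>i. c * x i) = vscl E c (\<Psi> (q, x))"
  using assms Psi_fib[of q x] U_sub
  by (intro Psi_eqI vscl_in[OF vb_fvs[OF vb]]) (auto simp: Phi_vscl[of _ q])

lemma Psi_zero: "q \<in> U \<Longrightarrow> \<Psi> (q, \<lambda>_. 0) = vzero E q"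
  using Psi_vscl[of q "\<lambda>_. 0" 0] vscl_zero[OF vb_fvs[OF vb], of q "\<Psi> (q, \<lambda>_. 0)"] Psi_fib[of q "\<lambda>_. 0"] U_sub
  by (auto simp: Rn_def)

lemma smooth_Psi_coeffs:
  assumes "\<And>i. i < r \<Longrightarrow> f i \<in> smf (bas E)"
  shows "smooth_map (subsp (bas E) U) (tot E) (\<lambda>q. \<Psi> (q, \<lambda>i. if i < r then f i q else 0))"
proof -
  let ?X = "subsp (bas E) U"
  have sat: "saturated ?X" by (rule saturated_subsp[OF vb_saturated(2)[OF vb] openU])
  have "smooth_map ?X (Rn_space r (Rn r)) (\<lambda>q i. if i < r then f i q else 0)"
    by (rule smooth_map_compose[OF smooth_map_subsp_incl[OF U_sub] 
          smooth_map_Rn_space[OF vb_saturated(2)[OF vb] assms]])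
  from smooth_map_prodspI[OF sat smooth_map_id[OF sat] this]
  have "smooth_map ?X (subsp (tot E) TU) (\<lambda>q. \<Psi> (q, \<lambda>i. if i < r then f i q else 0))"
    by (rule smooth_map_compose[OF _ smooth_Psi])
  from smooth_map_compose[OF this smooth_map_subsp_incl] show ?thesis by (auto simp: TU_def)
qed

text \<open>Induction over truncations of the coordinate vector: each step adds one multiple of a
  frame vector, so additivity in two arguments suffices.\<close>

lemma fib_dual_expand:
  assumes "\<xi> \<in> fib_dual E q" "q \<in> U" "x \<in> Rn r"
  shows "\<xi> (\<Psi> (q, x)) = (\<Sum>i<r. x i * \<xi> (\<Psi> (q, \<lambda>j. if j = i then 1 else 0)))"
proof -
  have "k \<le> r \<Longrightarrow> \<xi> (\<Psi> (q, \<lambda>j. if j < k then x j else 0)) = 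
    (\<Sum>i<k. x i * \<xi> (\<Psi> (q, \<lambda>j. if j = i then 1 else 0)))" for k
  proof (induct k)
    case 0
    then show ?case using Psi_zero[OF assms(2)] fib_dual_vzero[OF vb_fvs[OF vb] _ assms(1)] U_sub assms(2) by auto
  next
    case (Suc k)
    let ?a = "\<lambda>j. if j < k then x j else 0" and ?d = "\<lambda>j. if j = k then 1 else (0::real)"
    have R: "?a \<in> Rn r" "?d \<in> Rn r" "(\<lambda>j. x k * ?d j) \<in> Rn r" using Suc(2) by (auto simp: Rn_def)
    have "(\<lambda>j. if j < Suc k then x j else 0) = (\<lambda>j. ?a j + x k * ?d j)" by (auto simp: less_Suc_eq)
    then have "\<Psi> (q, \<lambda>j. if j < Suc k then x j else 0) = vadd E (\<Psi> (q, ?a)) (vscl E (x k) (\<Psi> (q, ?d)))"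
      using Psi_vadd[OF assms(2) R(1,3)] Psi_vscl[OF assms(2) R(2)] by simp
    moreover have "vscl E (x k) (\<Psi> (q, ?d)) \<in> fib E q"
      using Psi_fib[OF assms(2) R(2)] vscl_in[OF vb_fvs[OF vb]] U_sub assms(2) by auto
    ultimately have "\<xi> (\<Psi> (q, \<lambda>j. if j < Suc k then x j else 0)) = \<xi> (\<Psi> (q, ?a)) + x k * \<xi> (\<Psi> (q, ?d))"
      using fib_dualD[OF assms(1)] Psi_fib[OF assms(2) R(1)] Psi_fib[OF assms(2) R(2)] by simp
    then show ?case using Suc by simp
  qed
  from this[of r] have "\<xi> (\<Psi> (q, \<lambda>j. if j < r then x j else 0)) = 
    (\<Sum>i<r. x i * \<xi> (\<Psi> (q, \<lambda>j. if j = i then 1 else 0)))" by simp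
  moreover have "(\<lambda>j. if j < r then x j else 0) = x" using assms(3) by (auto simp: Rn_def)
  ultimately show ?thesis by simp
qed

end

lemma vb_trivialised:
  assumes "vector_bundle E" "m \<in> pts (bas E)"
  obtains U r \<Phi> where "trivialised E U r \<Phi>" "m \<in> U"
  using assms unfolding vector_bundle_def trivialised_def by blast

text \<open>\<open>vector_bundle\<close> does not list smoothness of the zero section; in every
  trivialisation it has constant coefficients 0.\<close>

lemma smooth_vzero:
  assumes "vector_bundle E"
  shows "smooth_map (bas E) (tot E) (vzero E)"
proof (rule smooth_map_locally[OF vb_saturated(2)[OF assms]])
  fix p assume "p \<in> pts (bas E)"
  then obtain U r \<Phi> where t: "trivialised E U r \<Phi>" "p \<in> U" using vb_trivialised[OF assms] by blast
  interpret trivialised E U r \<Phi> by fact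
  have "smooth_map (subsp (bas E) U) (tot E) (\<lambda>q. \<Psi> (q, \<lambda>i. if i < r then (\<lambda>x\<in>pts (bas E). 0) q else 0))"
    by (rule smooth_Psi_coeffs) (rule smf_const[OF vb_saturated(2)[OF assms]])
  moreover have "\<Psi> (q, \<lambda>i. if i < r then (\<lambda>x\<in>pts (bas E). 0) q else 0) = vzero E q" if "q \<in> U" for q
  proof -
    have "(\<lambda>i. if i < r then (\<lambda>x\<in>pts (bas E). 0) q else 0) = (\<lambda>_. 0::real)" using subsetD[OF U_sub that] by (intro ext) simp
    then show ?thesis using Psi_zero[OF that] by simp
  qed
  ultimately have "smooth_map (subsp (bas E) U) (tot E) (vzero E)"
    by (subst smooth_map_cong[where \<psi> = "\<lambda>q. \<Psi> (q, \<lambda>i. if i < r then (\<lambda>x\<in>pts (bas E). 0) q else 0)"]) auto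
  then show "\<exists>U. openin (dtop (bas E)) U \<and> p \<in> U \<and> smooth_map (subsp (bas E) U) (tot E) (vzero E)"
    using openU t(2) by blast
qed

context trivialised
begin

text \<open>Extension by zero. Smoothness is local: on U the section is given by its coefficients,
  on V it is the zero section, and U and V cover the base.\<close>

lemma section_of_coeffs:
  assumes f: "\<And>i. i < r \<Longrightarrow> f i \<in> smf (bas E)"
    and V: "openin (dtop (bas E)) V" "pts (bas E) = U \<union> V" "\<And>i q. i < r \<Longrightarrow> q \<in> V \<Longrightarrow> f i q = 0"
  shows "(\<lambda>q\<in>pts (bas E). if q \<in> U then \<Psi> (q, \<lambda>i. if i < r then f i q else 0) else vzero E q) \<in> Sect E"
proof (rule SectI)
  let ?s = "\<lambda>q. if q \<in> U then \<Psi> (q, \<lambda>i. if i < r then f i q else 0) else vzero E q"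
  have R: "(\<lambda>i. if i < r then f i q else 0) \<in> Rn r" for q by (simp add: Rn_def)
  show "prj E (?s m) = m" if "m \<in> pts (bas E)" for m
    using vzero_in[OF vb_fvs[OF vb] that] Psi_fib(1)[OF _ R, of m] by (auto simp: fib_def)
  show "smooth_map (bas E) (tot E) ?s"
  proof (rule smooth_map_locally[OF vb_saturated(2)[OF vb]])
    fix p assume "p \<in> pts (bas E)"
    then consider "p \<in> U" | "p \<in> V" using V(2) by blast
    then show "\<exists>U. openin (dtop (bas E)) U \<and> p \<in> U \<and> smooth_map (subsp (bas E) U) (tot E) ?s"
    proof cases
      case 1
      have "smooth_map (subsp (bas E) U) (tot E) ?s"
        using smooth_Psi_coeffs[OF f] by (subst smooth_map_cong[where \<psi> = "\<lambda>q. \<Psi> (q, \<lambda>i. if i < r then f i q else 0)"]) auto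
      then show ?thesis using 1 openU by blast
    next
      case 2
      have "?s q = vzero E q" if "q \<in> V" for q
      proof (cases "q \<in> U")
        case True
        have "(\<lambda>i. if i < r then f i q else 0) = (\<lambda>_. 0)" using V(3) that by auto
        then show ?thesis using True Psi_zero by simp
      qed simp
      moreover have "smooth_map (subsp (bas E) V) (tot E) (vzero E)"
        using smooth_map_compose[OF smooth_map_subsp_incl smooth_vzero[OF vb]] openin_dtop_subset[OF V(1)] by simp
      ultimately have "smooth_map (subsp (bas E) V) (tot E) ?s"
        by (subst smooth_map_cong[where \<psi> = "vzero E"]) auto
      then show ?thesis using 2 V(1) by blast
    qed
  qed
qed

end

lemma section_through:
  assumes "vector_bundle E" "m \<in> pts (bas E)" "u \<in> fib E m"
  obtains s where "s \<in> Sect E" "s m = u"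
proof -
  obtain W r \<Phi> where t: "trivialised E W r \<Phi>" "m \<in> W" using vb_trivialised[OF assms(1,2)] by blast
  interpret trivialised E W r \<Phi> by fact
  have sat: "saturated (bas E)" using vb_saturated(2)[OF vb] .
  obtain b U V where b: "b \<in> smf (bas E)" "openin (dtop (bas E)) U" "openin (dtop (bas E)) V" "m \<in> U"
    "\<And>q. q \<in> U \<Longrightarrow> b q = 1" "\<And>q. q \<in> V \<Longrightarrow> b q = 0" "U \<subseteq> W" "pts (bas E) = W \<union> V"
    using bump_function[OF sat openU t(2)] by blast
  \<comment> \<open>The fibre coordinates of u, kept constant and cut off by the bump
    function.\<close>
  define f where "f i = (\<lambda>x\<in>pts (bas E). 0 + snd (\<Phi> u) i * b x)" for i
  let ?s = "\<lambda>q\<in>pts (bas E). if q \<in> W then \<Psi> (q, \<lambda>i. if i < r then f i q else 0) else vzero E q"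
  have fs: "f i \<in> smf (bas E)" for i unfolding f_def by (rule smf_affine[OF sat b(1)])
  have f0: "f i q = 0" if "q \<in> V" for i q
    using subsetD[OF openin_dtop_subset[OF b(3)] that] b(6)[OF that] by (simp add: f_def)
  have "?s \<in> Sect E"
    by (rule section_of_coeffs[OF fs b(3,8) f0])
  moreover have "?s m = u"
  proof -
    have "\<Phi> u \<in> W \<times> Rn r" using bij fib_TU[OF assms(3) t(2)] by (auto simp: bij_betw_def)
    then have "(\<lambda>i. if i < r then f i m else 0) = snd (\<Phi> u)"
      using b(4,5) assms(2) by (auto simp: f_def Rn_def)
    then show ?thesis using assms(2) t(2) Psi_eqI[OF assms(3) t(2)] by simp
  qed
  ultimately show ?thesis using that by blast
qed

text \<open>Over a trivialising set, \<open>ell E \<beta> u\<close> is the sum of the fibre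
  coordinates of u times the values of \<open>\<beta>\<close> on the local frame. Since
  \<open>pairing_smf\<close> speaks of global sections, the frame has to be cut off by a bump
  function.\<close>

lemma ell_smf:
  assumes "vector_bundle E" "\<beta> \<in> Sect (dual E)"
  shows "ell E \<beta> \<in> smf (tot E)"
proof (rule smf_locally[OF vb_saturated(1)[OF assms(1)]])
  show "ell E \<beta> \<in> extensional (pts (tot E))" by (simp add: ell_def)
  fix u0 assume u0: "u0 \<in> pts (tot E)"
  define m where "m = prj E u0"
  have m: "m \<in> pts (bas E)" using vb_in_fib[OF assms(1) u0] m_def by simp
  obtain W r \<Phi> where t: "trivialised E W r \<Phi>" "m \<in> W" using vb_trivialised[OF assms(1) m] by blast
  interpret trivialised E W r \<Phi> by fact
  have sat: "saturated (bas E)" using vb_saturated(2)[OF vb] .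
  obtain b U V where b: "b \<in> smf (bas E)" "openin (dtop (bas E)) U" "openin (dtop (bas E)) V" "m \<in> U"
    "\<And>q. q \<in> U \<Longrightarrow> b q = 1" "\<And>q. q \<in> V \<Longrightarrow> b q = 0" "U \<subseteq> W" "pts (bas E) = W \<union> V"
    using bump_function[OF sat openU t(2)] by blast
  \<comment> \<open>Coefficients of the i-th frame section, multiplied by the bump function.\<close>
  define f where "f i j = (\<lambda>x\<in>pts (bas E). 0 + (if j = i then 1 else 0) * b x)" for i j :: nat
  define s where "s i = (\<lambda>q\<in>pts (bas E). if q \<in> W then \<Psi> (q, \<lambda>j. if j < r then f i j q else 0) else vzero E q)" for i
  have fs: "f i j \<in> smf (bas E)" for i j unfolding f_def by (rule smf_affine[OF sat b(1)])
  have f0: "f i j q = 0" if "q \<in> V" for i j q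
    using subsetD[OF openin_dtop_subset[OF b(3)] that] b(6)[OF that] by (simp add: f_def)
  have s: "s i \<in> Sect E" for i
    unfolding s_def by (rule section_of_coeffs[OF fs b(3,8) f0])
  have s1: "s i q = \<Psi> (q, \<lambda>j. if j = i then 1 else 0)" if "q \<in> U" "i < r" for i q
  proof -
    have q: "q \<in> pts (bas E)" "q \<in> W" using that b(7) U_sub by auto
    then have "(\<lambda>j. if j < r then f i j q else 0) = (\<lambda>j. if j = i then 1 else 0)"
      using b(5) that by (auto simp: f_def)
    then show ?thesis using q by (simp add: s_def)
  qed
  let ?X = "subsp (tot E) TU"
  have satX: "saturated ?X" by (rule saturated_subsp[OF vb_saturated(1)[OF vb] openTU])
  have TU_sub: "TU \<subseteq> pts (tot E)" using openin_dtop_subset[OF openTU] .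
  let ?x = "\<lambda>i. pull ?X (\<lambda>u. snd (\<Phi> u)) (\<lambda>x\<in>Rn r. x i)"
  let ?y = "\<lambda>i. pull ?X (\<lambda>u. prj E u) (pairing E \<beta> (s i))"
  have x: "?x i \<in> smf ?X" for i
    by (rule smooth_map_pull[OF smooth_map_compose[OF smooth_Phi smooth_map_snd] coordinate_smf])
  have y: "?y i \<in> smf ?X" for i
    by (rule smooth_map_pull[OF smooth_map_compose[OF smooth_map_subsp_incl[OF TU_sub] vb_prj_smooth[OF vb]]
          pairing_smf[OF assms(2) s]])
  let ?H = "\<lambda>u\<in>pts ?X. \<Sum>i<r. (\<lambda>u\<in>pts ?X. ?x i u * ?y i u) u"
  have "?H \<in> smf ?X" by (rule smf_sum[OF satX finite_lessThan smf_mult[OF satX x y]])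
  moreover have u0T: "u0 \<in> TU" using u0 t(2) by (simp add: TU_def m_def)
  ultimately obtain N F where N: "openin (dtop (tot E)) N" "u0 \<in> N" "N \<subseteq> TU" "F \<in> smf (tot E)" 
    "\<And>u. u \<in> N \<Longrightarrow> ?H u = F u"
    using smf_subsp_local[OF vb_saturated(1)[OF vb] openTU] by blast
  \<comment> \<open>Restriction to the set where the bump function is 1, so that the sections
    \<open>s i\<close> are the actual frame.\<close>
  let ?N = "N \<inter> {u \<in> pts (tot E). prj E u \<in> U}"
  have "openin (dtop (tot E)) ?N"
    using N(1) smooth_map_open_vimage[OF vb_prj_smooth[OF vb] b(2)] by (rule openin_Int)
  moreover have "u0 \<in> ?N" using N(2) u0 b(4) by (simp add: m_def)
  moreover have "ell E \<beta> u = F u" if u: "u \<in> ?N" for u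
  proof -
    let ?q = "prj E u"
    have T: "u \<in> TU" "u \<in> pts (tot E)" "?q \<in> U" "?q \<in> W" "?q \<in> pts (bas E)"
      using u N(3) b(7) U_sub by auto
    have Pu: "\<Phi> u \<in> W \<times> Rn r" using bij T(1) by (auto simp: bij_betw_def)
    then have R: "snd (\<Phi> u) \<in> Rn r" by auto
    have "u \<in> fib E ?q" using T by (simp add: fib_def)
    then have "\<Psi> (?q, snd (\<Phi> u)) = u" using Psi_eqI T(4) by blast
    then have "ell E \<beta> u = snd (\<beta> ?q) (\<Psi> (?q, snd (\<Phi> u)))" using T(2) by (simp add: ell_def)
    also have "\<dots> = (\<Sum>i<r. snd (\<Phi> u) i * snd (\<beta> ?q) (\<Psi> (?q, \<lambda>j. if j = i then 1 else 0)))"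
      using Sect_dual_fib[OF assms(2) T(5)] by (intro fib_dual_expand T(4) R) auto
    also have "\<dots> = ?H u"
      using T R s1[OF T(3)] by (auto simp: pull_def pairing_def intro!: sum.cong)
    also have "\<dots> = F u" using N(5) u by blast
    finally show ?thesis .
  qed
  ultimately show "\<exists>W F. openin (dtop (tot E)) W \<and> u0 \<in> W \<and> F \<in> smf (tot E) \<and> (\<forall>q\<in>W. ell E \<beta> q = F q)"
    using N(4) by blast
qed

section \<open>Decomposed double vector bundles\<close>

lemma vb_morphismD:
  assumes "vb_morphism E F \<Phi> \<phi>"
  shows "smooth_map (tot E) (tot F) \<Phi>" "smooth_map (bas E) (bas F) \<phi>"
    "u \<in> pts (tot E) \<Longrightarrow> prj F (\<Phi> u) = \<phi> (prj E u)"
    "u \<in> pts (tot E) \<Longrightarrow> \<Phi> (vscl E r u) = vscl F r (\<Phi> u)"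
    "u \<in> pts (tot E) \<Longrightarrow> v \<in> pts (tot E) \<Longrightarrow> prj E u = prj E v \<Longrightarrow> \<Phi> (vadd E u v) = vadd F (\<Phi> u) (\<Phi> v)"
  using assms unfolding vb_morphism_def by blast+

locale decomposed_dvb =
  fixes D :: "('d, 'a, 'b, 'm) dvbun" and \<sigma> :: "'a \<times> 'b \<times> 'd \<Rightarrow> 'd"
  assumes dvb: "double_vector_bundle D" and dec: "decomposition D \<sigma>"
begin

abbreviation "A \<equiv> sideA D"
abbreviation "B \<equiv> sideB D"
abbreviation "C \<equiv> core D"
abbreviation "DA \<equiv> overA D"
abbreviation "DB \<equiv> overB D"
abbreviation "M \<equiv> bas (sideA D)"
abbreviation "zA \<equiv> vzero (sideA D)"
abbreviation "zB \<equiv> vzero (sideB D)"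
abbreviation "zC \<equiv> vzero (core D)"

lemma vbs: "vector_bundle DA" "vector_bundle DB" "vector_bundle A" "vector_bundle B"
  using dvb by (simp_all add: double_vector_bundle_def)

lemmas fvss = vbs[THEN vb_fvs]

lemma bases [simp]: "tot DB = tot DA" "bas DA = tot A" "bas DB = tot B" "bas B = M" "bas C = M"
  using dvb by (simp_all add: double_vector_bundle_def core_def)

lemma prj_square: "d \<in> pts (tot DA) \<Longrightarrow> prj B (prj DB d) = prj A (prj DA d)"
  using dvb by (simp add: double_vector_bundle_def)

lemma prj_morphism: "vb_morphism DA B (prj DB) (prj A)"
  using dvb by (simp add: double_vector_bundle_def)

lemma prj_fib: "u \<in> fib E m \<Longrightarrow> prj E u = m" "u \<in> fib E m \<Longrightarrow> u \<in> pts (tot E)"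
  by (auto simp: fib_def)

lemma fib_base: "a \<in> fib A m \<Longrightarrow> m \<in> pts M" "b \<in> fib B m \<Longrightarrow> m \<in> pts M"
  using smooth_map_into[OF vb_prj_smooth[OF vbs(3)]] smooth_map_into[OF vb_prj_smooth[OF vbs(4)]] 
  by (auto simp: fib_def)

lemma zeros: 
  assumes "m \<in> pts M"
  shows "zA m \<in> fib A m" "zB m \<in> fib B m"
  using vzero_in[OF fvss(3)] vzero_in[OF fvss(4)] assms by auto

lemma fib_C: 
  assumes "m \<in> pts M" 
  shows "c \<in> fib C m \<longleftrightarrow> c \<in> fib DA (zA m) \<and> prj DB c = zB m"
  using zeros prj_fib assms by (fastforce simp: fib_def core_def)

lemma fib_C_base: "c \<in> fib C m \<Longrightarrow> m \<in> pts M"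
  using zeros prj_fib by (fastforce simp: fib_def core_def)

text \<open>The zero is its own multiple by the scalar 0, and \<open>prj DB\<close> is linear on the
  fibres of \<open>D \<rightarrow> A\<close>.\<close>

lemma prj_DB_zero:
  assumes "a \<in> fib A m" shows "prj DB (vzero DA a) = zB m"
proof -
  have a: "a \<in> pts (bas DA)" "m \<in> pts M" using assms fib_base by (auto simp: fib_def)
  have z: "vzero DA a \<in> fib DA a" by (rule vzero_in[OF fvss(1) a(1)])
  then have zp: "vzero DA a \<in> pts (tot DA)" by (simp add: fib_def)
  have "prj B (prj DB (vzero DA a)) = m" using prj_square[OF zp] prj_fib(1)[OF z] assms by (simp add: fib_def)
  moreover have "prj DB (vzero DA a) \<in> pts (tot B)" using smooth_map_into[OF vb_prj_smooth[OF vbs(2)]] zp by simp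
  ultimately have f: "prj DB (vzero DA a) \<in> fib B m" by (simp add: fib_def)
  have "vscl DA 0 (vzero DA a) = vzero DA a" by (rule vscl_vzero[OF fvss(1) a(1)])
  then have "prj DB (vzero DA a) = vscl B 0 (prj DB (vzero DA a))"
    using vb_morphismD(4)[OF prj_morphism zp, of 0] by simp
  then show ?thesis using vscl_zero[OF fvss(4) _ f] a by simp
qed

text \<open>A fibre of the core is the kernel of \<open>prj DB\<close> in the fibre of
  \<open>D \<rightarrow> A\<close> over the zero of A. Only closure needs an argument, namely that
  \<open>prj DB\<close> is linear; the equations are inherited.\<close>

lemma fvs_C: "fibres_vector_spaces C"
  unfolding fibres_vector_spaces_def
proof
  fix m assume "m \<in> pts (bas C)"
  then have m: "m \<in> pts M" by simp
  have zA: "zA m \<in> pts (bas DA)" using zeros(1)[OF m] by (simp add: fib_def)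
  have ops: "vadd C = vadd DA" "vscl C = vscl DA" "vzero C m = vzero DA (zA m)" by (simp_all add: core_def)
  have z: "vzero DA (zA m) \<in> fib C m"
    using fib_C[OF m] vzero_in[OF fvss(1) zA] prj_DB_zero[OF zeros(1)[OF m]] by simp
  have add: "vadd DA u v \<in> fib C m" if "u \<in> fib C m" "v \<in> fib C m" for u v
  proof -
    have f: "u \<in> fib DA (zA m)" "v \<in> fib DA (zA m)" "prj DB u = zB m" "prj DB v = zB m" using that fib_C[OF m] by auto
    have "prj DB (vadd DA u v) = vadd B (zB m) (zB m)"
      using vb_morphismD(5)[OF prj_morphism, of u v] f by (simp add: fib_def)
    then show ?thesis using fib_C[OF m] vadd_in[OF fvss(1) zA f(1,2)] vadd_zero_left[OF fvss(4) _ zeros(2)[OF m]] m by simp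
  qed
  have scl: "vscl DA r u \<in> fib C m" if "u \<in> fib C m" for r u
  proof -
    have f: "u \<in> fib DA (zA m)" "prj DB u = zB m" using that fib_C[OF m] by auto
    have "prj DB (vscl DA r u) = vscl B r (zB m)"
      using vb_morphismD(4)[OF prj_morphism, of u r] f by (simp add: fib_def)
    then show ?thesis using fib_C[OF m] vscl_in[OF fvss(1) zA f(1)] vscl_vzero[OF fvss(4)] m by simp
  qed
  have sub: "u \<in> fib DA (zA m)" if "u \<in> fib C m" for u using that fib_C[OF m] by simp
  note F = bspec[OF fvss(1)[unfolded fibres_vector_spaces_def] zA]
  show "vzero C m \<in> fib C m \<and>
     (\<forall>u\<in>fib C m. \<forall>v\<in>fib C m. vadd C u v \<in> fib C m \<and> vadd C u v = vadd C v u) \<and>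
     (\<forall>u\<in>fib C m. \<forall>v\<in>fib C m. \<forall>w\<in>fib C m. vadd C (vadd C u v) w = vadd C u (vadd C v w)) \<and>
     (\<forall>u\<in>fib C m. vadd C (vzero C m) u = u \<and> vadd C u (vscl C (-1) u) = vzero C m \<and> vscl C 1 u = u) \<and>
     (\<forall>r. \<forall>u\<in>fib C m. vscl C r u \<in> fib C m) \<and>
     (\<forall>r s. \<forall>u\<in>fib C m. vscl C r (vscl C s u) = vscl C (r * s) u \<and>
        vscl C (r + s) u = vadd C (vscl C r u) (vscl C s u)) \<and>
     (\<forall>r. \<forall>u\<in>fib C m. \<forall>v\<in>fib C m. vscl C r (vadd C u v) = vadd C (vscl C r u) (vscl C r v))"
    unfolding ops
  proof (intro conjI allI ballI)
    fix u assume u: "u \<in> fib C m"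
    show "vadd DA (vzero DA (zA m)) u = u" "vadd DA u (vscl DA (-1) u) = vzero DA (zA m)" "vscl DA 1 u = u"
      using F sub[OF u] by blast+
    show "vscl DA r (vscl DA s u) = vscl DA (r * s) u" "vscl DA (r + s) u = vadd DA (vscl DA r u) (vscl DA s u)" for r s
      using F sub[OF u] by blast+
    fix v assume v: "v \<in> fib C m"
    show "vadd DA u v = vadd DA v u" "vscl DA r (vadd DA u v) = vadd DA (vscl DA r u) (vscl DA r v)" for r
      using F sub[OF u] sub[OF v] by blast+
    fix w assume w: "w \<in> fib C m"
    show "vadd DA (vadd DA u v) w = vadd DA u (vadd DA v w)"
      using F sub[OF u] sub[OF v] sub[OF w] by blast
  qed (fact z add scl)+
qed

lemma zC: "m \<in> pts M \<Longrightarrow> zC m \<in> fib C m"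
  using vzero_in[OF fvs_C] by simp

section \<open>Coordinates on D given by the decomposition\<close>

abbreviation "S \<equiv> decomposed A B C"

definition Tr :: "('a \<times> 'b \<times> 'd) set" where
  "Tr = {(a, b, c). \<exists>m. a \<in> fib A m \<and> b \<in> fib B m \<and> c \<in> fib C m}"

lemma pts_S: "pts (tot (overA S)) = Tr" "pts (tot (overB S)) = Tr"
  by (auto simp: decomposed_def Let_def Tr_def fib_def)

lemma S_ops:
  "prj (overA S) (a, b, c) = a" "prj (overB S) (a, b, c) = b"
  "vadd (overA S) (a, b, c) (a', b', c') = (a, vadd B b b', vadd C c c')"
  "vscl (overA S) r (a, b, c) = (a, vscl B r b, vscl C r c)"
  "vadd (overB S) (a, b, c) (a', b', c') = (vadd A a a', b, vadd C c c')"
  "vscl (overB S) r (a, b, c) = (vscl A r a, b, vscl C r c)"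
  by (simp_all add: decomposed_def Let_def)

lemma TrI: "a \<in> fib A m \<Longrightarrow> b \<in> fib B m \<Longrightarrow> c \<in> fib C m \<Longrightarrow> (a, b, c) \<in> Tr"
  by (auto simp: Tr_def)

lemma sigma_bij: "bij_betw \<sigma> Tr (pts (tot DA))"
  and sigma_smooth: "smooth_map (tot (overA S)) (tot DA) \<sigma>"
  and sigma_inv_smooth: "smooth_map (tot DA) (tot (overA S)) (inv_into Tr \<sigma>)"
  and sigma_A: "vb_morphism (overA S) DA \<sigma> (\<lambda>a. a)"
  and sigma_B: "vb_morphism (overB S) DB \<sigma> (\<lambda>b. b)"
  using dec unfolding decomposition_def diffeo_def Let_def pts_S(1) by auto

lemma sigma_core: "c \<in> fib C m \<Longrightarrow> \<sigma> (zA m, zB m, c) = c"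
  using dec unfolding decomposition_def Let_def by (auto simp: fib_def)

context
  fixes m a b c
  assumes a: "a \<in> fib A m" and b: "b \<in> fib B m" and c: "c \<in> fib C m"
begin

lemma sigma_pts: "\<sigma> (a, b, c) \<in> pts (tot DA)"
  using sigma_bij TrI[OF a b c] by (auto simp: bij_betw_def)

lemma prjA_sigma [simp]: "prj DA (\<sigma> (a, b, c)) = a"
  using vb_morphismD(3)[OF sigma_A, of "(a, b, c)"] TrI[OF a b c] by (simp add: pts_S S_ops)

lemma prjB_sigma [simp]: "prj DB (\<sigma> (a, b, c)) = b"
  using vb_morphismD(3)[OF sigma_B, of "(a, b, c)"] TrI[OF a b c] by (simp add: pts_S S_ops)

lemma sigma_fib: "\<sigma> (a, b, c) \<in> fib DA a" "\<sigma> (a, b, c) \<in> fib DB b"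
  using sigma_pts by (auto simp: fib_def)

lemma inv_sigma: "inv_into Tr \<sigma> (\<sigma> (a, b, c)) = (a, b, c)"
  by (rule inv_into_f_f[OF _ TrI[OF a b c]]) (use sigma_bij in \<open>simp add: bij_betw_def\<close>)

lemma sigma_addA: "b' \<in> fib B m \<Longrightarrow> c' \<in> fib C m \<Longrightarrow>
    vadd DA (\<sigma> (a, b, c)) (\<sigma> (a, b', c')) = \<sigma> (a, vadd B b b', vadd C c c')"
  using vb_morphismD(5)[OF sigma_A, of "(a, b, c)" "(a, b', c')"] TrI[OF a b c] TrI[OF a]
  by (simp add: pts_S S_ops)

lemma sigma_addB: "a' \<in> fib A m \<Longrightarrow> c' \<in> fib C m \<Longrightarrow>
    vadd DB (\<sigma> (a, b, c)) (\<sigma> (a', b, c')) = \<sigma> (vadd A a a', b, vadd C c c')"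
  using vb_morphismD(5)[OF sigma_B, of "(a, b, c)" "(a', b, c')"] TrI[OF a b c] TrI[OF _ b]
  by (simp add: pts_S S_ops)

lemma sigma_sclA: "vscl DA r (\<sigma> (a, b, c)) = \<sigma> (a, vscl B r b, vscl C r c)"
  using vb_morphismD(4)[OF sigma_A, of "(a, b, c)" r] TrI[OF a b c] by (simp add: pts_S S_ops)

lemma sigma_sclB: "vscl DB r (\<sigma> (a, b, c)) = \<sigma> (vscl A r a, b, vscl C r c)"
  using vb_morphismD(4)[OF sigma_B, of "(a, b, c)" r] TrI[OF a b c] by (simp add: pts_S S_ops)

end

lemma fib_DA_E:
  assumes "d \<in> fib DA a"
  obtains m b c where "a \<in> fib A m" "b \<in> fib B m" "c \<in> fib C m" "d = \<sigma> (a, b, c)"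
proof -
  have "d \<in> pts (tot DA)" using assms by (simp add: fib_def)
  then have "d \<in> \<sigma> ` Tr" using sigma_bij by (simp add: bij_betw_def)
  then obtain m a' b c where x: "a' \<in> fib A m" "b \<in> fib B m" "c \<in> fib C m" "d = \<sigma> (a', b, c)"
    unfolding Tr_def by auto
  moreover have "a' = a" using x prjA_sigma assms by (auto simp: fib_def)
  ultimately show ?thesis using that by blast
qed

lemma fib_DA_m:
  assumes "d \<in> fib DA a" "a \<in> fib A m"
  obtains b c where "b \<in> fib B m" "c \<in> fib C m" "d = \<sigma> (a, b, c)"
proof -
  obtain m' b c where x: "a \<in> fib A m'" "b \<in> fib B m'" "c \<in> fib C m'" "d = \<sigma> (a, b, c)"
    using fib_DA_E[OF assms(1)] .
  then have "m' = m" using assms(2) prj_fib(1) by metis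
  with x that show ?thesis by blast
qed

lemma fib_DB_m:
  assumes "d \<in> fib DB b" "b \<in> fib B m"
  obtains a c where "a \<in> fib A m" "c \<in> fib C m" "d = \<sigma> (a, b, c)"
proof -
  have "d \<in> fib DA (prj DA d)" using assms by (simp add: fib_def)
  then obtain m' b' c where x: "prj DA d \<in> fib A m'" "b' \<in> fib B m'" "c \<in> fib C m'" "d = \<sigma> (prj DA d, b', c)"
    using fib_DA_E by blast
  have "b' = b" using prjB_sigma[OF x(1-3)] x(4) prj_fib(1)[OF assms(1)] by simp
  then have "m' = m" using x(2) assms(2) prj_fib(1) by metis
  with x \<open>b' = b\<close> that show ?thesis by blast
qed

text \<open>Multiplication by 0 over A keeps the A-component and kills the other two.\<close>

lemma zero_DA: 
  assumes "a \<in> fib A m" shows "vzero DA a = \<sigma> (a, zB m, zC m)"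
proof -
  have m: "m \<in> pts M" using fib_base assms by blast
  note z = assms zeros(2)[OF m] zC[OF m]
  have "vscl DA 0 (\<sigma> (a, zB m, zC m)) = vzero DA a"
    using vscl_zero[OF fvss(1) _ sigma_fib(1)[OF z]] prj_fib(2)[OF assms] by simp
  then show ?thesis using sigma_sclA[OF z, of 0] vscl_vzero[OF fvss(4)] vscl_vzero[OF fvs_C] m by simp
qed

lemma zero_DB: 
  assumes "b \<in> fib B m" shows "vzero DB b = \<sigma> (zA m, b, zC m)"
proof -
  have m: "m \<in> pts M" using fib_base assms by blast
  note z = zeros(1)[OF m] assms zC[OF m]
  have "vscl DB 0 (\<sigma> (zA m, b, zC m)) = vzero DB b"
    using vscl_zero[OF fvss(2) _ sigma_fib(2)[OF z]] prj_fib(2)[OF assms] by simp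
  then show ?thesis using sigma_sclB[OF z, of 0] vscl_vzero[OF fvss(3)] vscl_vzero[OF fvs_C] m by simp
qed

text \<open>The zero over b has coordinates (0, b, 0) and the core element (0, 0, c). Both lie over
  the zero of A, where addition is componentwise in B and C.\<close>

lemma zero_DB_plus_core:
  assumes "b \<in> fib B m" "c \<in> fib C m"
  shows "vadd DA (vzero DB b) c = \<sigma> (zA m, b, c)"
proof -
  have m: "m \<in> pts M" using fib_base assms by blast
  have "vadd DA (\<sigma> (zA m, b, zC m)) (\<sigma> (zA m, zB m, c)) = \<sigma> (zA m, b, c)"
    using sigma_addA[OF zeros(1)[OF m] assms(1) zC[OF m] zeros(2)[OF m] assms(2)]
      vadd_zero_right[OF fvss(4) _ assms(1)] vadd_zero_left[OF fvs_C _ assms(2)] m by simp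
  then show ?thesis using zero_DB[OF assms(1)] sigma_core[OF assms(2)] by simp
qed

lemma zero_DA_plus_core:
  assumes "a \<in> fib A m" "c \<in> fib C m"
  shows "vadd DB (vzero DA a) c = \<sigma> (a, zB m, c)"
proof -
  have m: "m \<in> pts M" using fib_base assms by blast
  have "vadd DB (\<sigma> (a, zB m, zC m)) (\<sigma> (zA m, zB m, c)) = \<sigma> (a, zB m, c)"
    using sigma_addB[OF assms(1) zeros(2)[OF m] zC[OF m] zeros(1)[OF m] assms(2)]
      vadd_zero_right[OF fvss(3) _ assms(1)] vadd_zero_left[OF fvs_C _ assms(2)] m by simp
  then show ?thesis using zero_DA[OF assms(1)] sigma_core[OF assms(2)] by simp
qed

text \<open>The \<open>C\<close>-component in \<open>D \<cong> A \<oplus> B \<oplus> C\<close>.\<close>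

definition kC :: "'d \<Rightarrow> 'd" where "kC d = snd (snd (inv_into Tr \<sigma> d))"

lemma kC_sigma [simp]: "a \<in> fib A m \<Longrightarrow> b \<in> fib B m \<Longrightarrow> c \<in> fib C m \<Longrightarrow> kC (\<sigma> (a, b, c)) = c"
  by (simp add: kC_def inv_sigma)

lemma kC_fib: 
  assumes "d \<in> fib DA a" "a \<in> fib A m" 
  shows "kC d \<in> fib C m" "prj DB d \<in> fib B m"
  using fib_DA_m[OF assms] kC_sigma[OF assms(2)] prjB_sigma[OF assms(2)] by metis+

section \<open>Coordinates on the vertical dual\<close>

text \<open>The image of \<open>(a, g, f)\<close> under \<open>A \<oplus> C\<^sup>* \<oplus> B\<^sup>* \<cong> D\<^sub>A\<^sup>*\<close>.\<close>

definition vel :: "'a \<Rightarrow> ('d \<Rightarrow> real) \<Rightarrow> ('b \<Rightarrow> real) \<Rightarrow> 'a \<times> ('d \<Rightarrow> real)" where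
  "vel a g f = (a, \<lambda>d\<in>fib DA a. g (kC d) + f (prj DB d))"

lemma fst_vel [simp]: "fst (vel a g f) = a"
  by (simp add: vel_def)

lemma vel_sigma: "a \<in> fib A m \<Longrightarrow> b \<in> fib B m \<Longrightarrow> c \<in> fib C m \<Longrightarrow> snd (vel a g f) (\<sigma> (a, b, c)) = g c + f b"
  by (simp add: vel_def sigma_fib)

text \<open>Every d over a is some \<open>\<sigma> (a, b, c)\<close>, so a functional is determined
  by these values. All structure maps of the vertical dual are brought into coordinates this
  way.\<close>

lemma vel_eqI:
  assumes "fst \<Theta> = a" "a \<in> fib A m" "snd \<Theta> \<in> extensional (fib DA a)"
    and "\<And>b c. b \<in> fib B m \<Longrightarrow> c \<in> fib C m \<Longrightarrow> snd \<Theta> (\<sigma> (a, b, c)) = g c + f b"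
  shows "\<Theta> = vel a g f"
proof (rule prod_eqI)
  show "snd \<Theta> = snd (vel a g f)"
  proof (rule extensionalityI[OF assms(3)])
    show "snd (vel a g f) \<in> extensional (fib DA a)" by (simp add: vel_def)
    fix d assume "d \<in> fib DA a"
    then obtain b c where x: "b \<in> fib B m" "c \<in> fib C m" "d = \<sigma> (a, b, c)" using fib_DA_m[OF _ assms(2)] by blast
    then show "snd \<Theta> d = snd (vel a g f) d" using assms(4) vel_sigma[OF assms(2) x(1,2)] by simp
  qed
qed (simp add: assms(1))

lemma vel_dual_pts:
  assumes a: "a \<in> fib A m" and g: "g \<in> fib_dual C m" and f: "f \<in> fib_dual B m"
  shows "vel a g f \<in> dual_pts DA"
proof -
  have m: "m \<in> pts M" using fib_base a by blast
  have "snd (vel a g f) \<in> fib_dual DA a"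
    unfolding fib_dual_def
  proof (intro CollectI conjI ballI allI)
    show "snd (vel a g f) \<in> extensional (fib DA a)" by (simp add: vel_def)
    fix u assume "u \<in> fib DA a"
    then obtain b c where x: "b \<in> fib B m" "c \<in> fib C m" "u = \<sigma> (a, b, c)" using fib_DA_m[OF _ a] by blast
    show "snd (vel a g f) (vscl DA r u) = r * snd (vel a g f) u" for r
      using x a sigma_sclA[OF a x(1,2)] vel_sigma[OF a] vscl_in[OF fvss(4)] vscl_in[OF fvs_C] m
        fib_dualD(2)[OF g x(2)] fib_dualD(2)[OF f x(1)] by (simp add: algebra_simps)
    fix v assume "v \<in> fib DA a"
    then obtain b' c' where y: "b' \<in> fib B m" "c' \<in> fib C m" "v = \<sigma> (a, b', c')" using fib_DA_m[OF _ a] by blast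
    show "snd (vel a g f) (vadd DA u v) = snd (vel a g f) u + snd (vel a g f) v"
      using x y a sigma_addA[OF a x(1,2) y(1,2)] vel_sigma[OF a] vadd_in[OF fvss(4) _ x(1) y(1)] vadd_in[OF fvs_C _ x(2) y(2)] m
        fib_dualD(1)[OF g x(2) y(2)] fib_dualD(1)[OF f x(1) y(1)] by (simp add: algebra_simps)
  qed
  then show ?thesis using prj_fib(2)[OF a] by (simp add: dual_pts_def vel_def)
qed

lemma p_ver_vel:
  assumes a: "a \<in> fib A m" and g: "g \<in> fib_dual C m" and f: "f \<in> fib_dual B m"
  shows "p_ver D (vel a g f) = (m, g)"
proof -
  have m: "m \<in> pts M" using fib_base a by blast
  have "(\<lambda>c\<in>fib C m. snd (vel a g f) (vadd DB (vzero DA a) c)) = g"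
  proof (rule extensionalityI[OF restrict_extensional fib_dualD(3)[OF g]])
    fix c assume c: "c \<in> fib C m"
    then show "(\<lambda>c\<in>fib C m. snd (vel a g f) (vadd DB (vzero DA a) c)) c = g c"
      using zero_DA_plus_core[OF a c] vel_sigma[OF a zeros(2)[OF m] c] fib_dual_vzero[OF fvss(4) _ f] m by simp
  qed
  then show ?thesis using prj_fib(1)[OF a] by (simp add: p_ver_def Let_def)
qed

lemma zero_functional: "(\<lambda>u\<in>fib E m. 0) \<in> fib_dual E m" if "fibres_vector_spaces E" "m \<in> pts (bas E)"
  using vadd_in[OF that] vscl_in[OF that] by (auto simp: fib_dual_def)

text \<open>Subtracting the zero over b from \<open>\<sigma> (zA m, b, c)\<close> over A leaves the
  core element c, on which g is evaluated.\<close>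

lemma ver_zero_vel:
  assumes m: "m \<in> pts M" and g: "g \<in> fib_dual C m"
  shows "ver_zero D (m, g) = vel (zA m) g (\<lambda>u\<in>fib B m. 0)"
proof (rule vel_eqI[OF _ zeros(1)[OF m]])
  fix b c assume b: "b \<in> fib B m" and c: "c \<in> fib C m"
  note z = zeros[OF m] zC[OF m]
  have nb: "vscl B (-1) b \<in> fib B m" using vscl_in[OF fvss(4) _ b] m by simp
  have "vscl DA (-1) (vzero DB b) = \<sigma> (zA m, vscl B (-1) b, zC m)"
    using zero_DB[OF b] sigma_sclA[OF z(1) b z(3)] vscl_vzero[OF fvs_C] m by simp
  then have "vadd DA (\<sigma> (zA m, b, c)) (vscl DA (-1) (vzero DB b)) = c"
    using sigma_addA[OF z(1) b c nb z(3)] vadd_neg[OF fvss(4) _ b] vadd_zero_right[OF fvs_C _ c] sigma_core[OF c] m by simp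
  then show "snd (ver_zero D (m, g)) (\<sigma> (zA m, b, c)) = g c + (\<lambda>u\<in>fib B m. 0) b"
    using b sigma_fib(1)[OF z(1) b c] prjB_sigma[OF z(1) b c] by (simp add: ver_zero_def Let_def)
qed (simp_all add: ver_zero_def Let_def)

lemma ver_core_vel:
  assumes m: "m \<in> pts M" and f: "f \<in> fib_dual B m"
  shows "ver_core D (m, f) = vel (zA m) (\<lambda>u\<in>fib C m. 0) f"
proof (rule vel_eqI[OF _ zeros(1)[OF m]])
  fix b c assume b: "b \<in> fib B m" and c: "c \<in> fib C m"
  then show "snd (ver_core D (m, f)) (\<sigma> (zA m, b, c)) = (\<lambda>u\<in>fib C m. 0) c + f b"
    using sigma_fib(1)[OF zeros(1)[OF m] b c] prjB_sigma[OF zeros(1)[OF m] b c] by (simp add: ver_core_def Let_def)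
qed (simp_all add: ver_core_def Let_def)

text \<open>Core sections and \<open>hom_hat\<close> of the vertical dual have this form at a point
  g of the dual of C; in coordinates it is (0, g, 0) plus (0, 0, f).\<close>

lemma core_plus_vel:
  assumes m: "m \<in> pts M" and g: "g \<in> fib_dual C m" and f: "f \<in> fib_dual B m"
  shows "vadd (dual DA) (ver_zero D (m, g)) (ver_core D (m, f)) = vel (zA m) g f"
  unfolding ver_zero_vel[OF m g] ver_core_vel[OF m f]
proof (rule vel_eqI[OF _ zeros(1)[OF m]])
  let ?x = "vadd (dual DA) (vel (zA m) g (\<lambda>u\<in>fib B m. 0)) (vel (zA m) (\<lambda>u\<in>fib C m. 0) f)"
  show "fst ?x = zA m" "snd ?x \<in> extensional (fib DA (zA m))" by (simp_all add: dual_def)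
  fix b c assume x: "b \<in> fib B m" "c \<in> fib C m"
  then show "snd ?x (\<sigma> (zA m, b, c)) = g c + f b"
    using vel_sigma[OF zeros(1)[OF m] x] sigma_fib(1)[OF zeros(1)[OF m] x] by (simp add: dual_def)
qed

lemma dual_lift_vel:
  assumes g: "(m, g) \<in> dual_pts C" and a: "a m \<in> fib A m"
  shows "dual_lift D \<sigma> a (m, g) = vel (a m) g (\<lambda>u\<in>fib B m. 0)"
proof -
  have "dual_lift D \<sigma> a (m, g) = dual_map_inv (overA S) DA \<sigma>
     (a m, \<lambda>(x, b, c)\<in>fib (overA S) (a m). g c + snd (vzero (dual B) m) b)"
    using g by (simp add: dual_lift_def dual_decomposition_def Let_def)
  also have "\<dots> = vel (a m) g (\<lambda>u\<in>fib B m. 0)"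
  proof (rule vel_eqI[OF _ a])
    fix b c assume x: "b \<in> fib B m" "c \<in> fib C m"
    have "(a m, b, c) \<in> fib (overA S) (a m)"
      using TrI[OF a x] unfolding fib_def pts_S by (simp add: S_ops)
    then show "snd (dual_map_inv (overA S) DA \<sigma> (a m, \<lambda>(x, b, c)\<in>fib (overA S) (a m). g c + snd (vzero (dual B) m) b)) (\<sigma> (a m, b, c))
        = g c + (\<lambda>u\<in>fib B m. 0) b"
      using x sigma_fib(1)[OF a x] inv_sigma[OF a x] by (simp add: dual_map_inv_def pts_S dual_def)
  qed (simp_all add: dual_map_inv_def)
  finally show ?thesis .
qed

text \<open>\<open>ver_add\<close> picks some splitting of d over B. Any splitting has components
  (a, b, c1) and (0, b, c2) with c1 + c2 = c, so the linearity of g makes the value independent of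
  the choice.\<close>

lemma ver_add_vel:
  assumes a: "a \<in> fib A m" and g: "g \<in> fib_dual C m" and f: "f \<in> fib_dual B m"
  shows "ver_add D (vel a g (\<lambda>u\<in>fib B m. 0)) (vel (zA m) g f) = vel a g f"
proof (rule vel_eqI[OF _ a])
  have m: "m \<in> pts M" using fib_base a by blast
  have a0: "vadd A a (zA m) = a" using vadd_zero_right[OF fvss(3) _ a] m by simp
  show "fst (ver_add D (vel a g (\<lambda>u\<in>fib B m. 0)) (vel (zA m) g f)) = a"
    "snd (ver_add D (vel a g (\<lambda>u\<in>fib B m. 0)) (vel (zA m) g f)) \<in> extensional (fib DA a)"
    using a0 by (simp_all add: ver_add_def Let_def)
  fix b c assume x: "b \<in> fib B m" "c \<in> fib C m"
  let ?P = "\<lambda>(d1, d2). d1 \<in> fib DA a \<and> d2 \<in> fib DA (zA m) \<and> prj DB d1 = prj DB d2 \<and> vadd DB d1 d2 = \<sigma> (a, b, c)"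
  \<comment> \<open>A splitting exists: the whole C-component may be put into the first
    summand.\<close>
  have "?P (\<sigma> (a, b, c), \<sigma> (zA m, b, zC m))"
    using sigma_fib[OF a x] sigma_fib[OF zeros(1)[OF m] x(1) zC[OF m]] prjB_sigma[OF a x] prjB_sigma[OF zeros(1)[OF m] x(1) zC[OF m]]
      sigma_addB[OF a x zeros(1)[OF m] zC[OF m]] a0 vadd_zero_right[OF fvs_C _ x(2)] m by simp
  then have P: "?P (SOME z. ?P z)" by (rule someI)
  obtain d1 d2 where d1: "(SOME z. ?P z) = (d1, d2)" by (rule prod.exhaust)
  have d2: "?P (d1, d2)" using P unfolding d1 .
  note d = d1 d2
  obtain b1 c1 where 1: "b1 \<in> fib B m" "c1 \<in> fib C m" "d1 = \<sigma> (a, b1, c1)"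
    using fib_DA_m[OF _ a] d(2) by blast
  obtain b2 c2 where 2: "b2 \<in> fib B m" "c2 \<in> fib C m" "d2 = \<sigma> (zA m, b2, c2)"
    using fib_DA_m[OF _ zeros(1)[OF m]] d(2) by blast
  have e: "b2 = b1" using d(2) 1 2 prjB_sigma[OF a 1(1,2)] prjB_sigma[OF zeros(1)[OF m] 2(1,2)] by simp
  have c12: "vadd C c1 c2 \<in> fib C m" using vadd_in[OF fvs_C _ 1(2) 2(2)] m by simp
  have "\<sigma> (a, b1, vadd C c1 c2) = \<sigma> (a, b, c)"
    using d(2) 1 2 e sigma_addB[OF a 1(1,2) zeros(1)[OF m] 2(2)] a0 by simp
  from arg_cong[OF this, of "inv_into Tr \<sigma>"] have bc: "b1 = b" "vadd C c1 c2 = c"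
    using inv_sigma[OF a 1(1) c12] inv_sigma[OF a x] by simp_all
  have "snd (ver_add D (vel a g (\<lambda>u\<in>fib B m. 0)) (vel (zA m) g f)) (\<sigma> (a, b, c)) =
     snd (vel a g (\<lambda>u\<in>fib B m. 0)) d1 + snd (vel (zA m) g f) d2"
    using a0 sigma_fib(1)[OF a x] d(1) by (simp add: ver_add_def Let_def)
  also have "\<dots> = g c1 + (g c2 + f b)"
    using vel_sigma[OF a 1(1,2), of g "\<lambda>u\<in>fib B m. 0"] vel_sigma[OF zeros(1)[OF m] 2(1,2), of g f] 1 2 e bc by simp
  also have "\<dots> = g c + f b" using fib_dualD(1)[OF g 1(2) 2(2)] bc by simp
  finally show "snd (ver_add D (vel a g (\<lambda>u\<in>fib B m. 0)) (vel (zA m) g f)) (\<sigma> (a, b, c)) = g c + f b" .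
qed

section \<open>The horizontal dual and its pairing with the vertical dual\<close>

lemma dual_DB_add:
  assumes "\<Psi> \<in> dual_pts DB" "fst \<Psi> \<in> fib B m" "a \<in> fib A m" "c \<in> fib C m"
  shows "snd \<Psi> (\<sigma> (a, fst \<Psi>, c)) = snd \<Psi> (\<sigma> (a, fst \<Psi>, zC m)) + snd \<Psi> (\<sigma> (zA m, fst \<Psi>, c))"
proof -
  have m: "m \<in> pts M" using fib_base assms by blast
  have "\<sigma> (a, fst \<Psi>, c) = vadd DB (\<sigma> (a, fst \<Psi>, zC m)) (\<sigma> (zA m, fst \<Psi>, c))"
    using sigma_addB[OF assms(3,2) zC[OF m] zeros(1)[OF m] assms(4)]
      vadd_zero_right[OF fvss(3) _ assms(3)] vadd_zero_left[OF fvs_C _ assms(4)] m by simp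
  then show ?thesis
    using fib_dualD(1)[of "snd \<Psi>" DB "fst \<Psi>"] assms(1) sigma_fib(2)[OF assms(3,2) zC[OF m]]
      sigma_fib(2)[OF zeros(1)[OF m] assms(2,4)] by (auto simp: dual_pts_def)
qed

lemma p_hor_eq:
  assumes "fst \<Psi> \<in> fib B m"
  shows "p_hor D \<Psi> = (m, \<lambda>c\<in>fib C m. snd \<Psi> (\<sigma> (zA m, fst \<Psi>, c)))"
  using prj_fib(1)[OF assms] zero_DB_plus_core[OF assms] by (auto simp: p_hor_def Let_def intro!: restrict_ext)

lemma p_hor_dual:
  assumes P: "\<Psi> \<in> dual_pts DB" and b: "fst \<Psi> \<in> fib B m"
  shows "p_hor D \<Psi> \<in> dual_pts C" "fst (p_hor D \<Psi>) = m" "snd (p_hor D \<Psi>) \<in> fib_dual C m"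
proof -
  have m: "m \<in> pts M" using fib_base b by blast
  have P': "snd \<Psi> \<in> fib_dual DB (fst \<Psi>)" using P by (auto simp: dual_pts_def)
  note z = zeros(1)[OF m]
  note zz = vadd_zero_left[OF fvss(3) _ z] vscl_vzero[OF fvss(3)]
  show "fst (p_hor D \<Psi>) = m" using p_hor_eq[OF b] by simp
  show "snd (p_hor D \<Psi>) \<in> fib_dual C m"
    unfolding p_hor_eq[OF b] snd_conv fib_dual_def
  proof (intro CollectI conjI ballI allI)
    fix u assume u: "u \<in> fib C m"
    have r: "vscl C r u \<in> fib C m" for r using vscl_in[OF fvs_C _ u] m by simp
    show "(\<lambda>c\<in>fib C m. snd \<Psi> (\<sigma> (zA m, fst \<Psi>, c))) (vscl C r u) = r * (\<lambda>c\<in>fib C m. snd \<Psi> (\<sigma> (zA m, fst \<Psi>, c))) u" for r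
      using u r sigma_sclB[OF z b u, of r] fib_dualD(2)[OF P' sigma_fib(2)[OF z b u], of r] zz m by simp
    fix v assume v: "v \<in> fib C m"
    have "vadd C u v \<in> fib C m" using vadd_in[OF fvs_C _ u v] m by simp
    then show "(\<lambda>c\<in>fib C m. snd \<Psi> (\<sigma> (zA m, fst \<Psi>, c))) (vadd C u v) =
       (\<lambda>c\<in>fib C m. snd \<Psi> (\<sigma> (zA m, fst \<Psi>, c))) u + (\<lambda>c\<in>fib C m. snd \<Psi> (\<sigma> (zA m, fst \<Psi>, c))) v"
      using u v sigma_addB[OF z b u z v] fib_dualD(1)[OF P' sigma_fib(2)[OF z b u] sigma_fib(2)[OF z b v]] zz m by simp
  qed simp
  then have "(m, snd (p_hor D \<Psi>)) \<in> dual_pts C" using m by (simp add: dual_pts_def)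
  then show "p_hor D \<Psi> \<in> dual_pts C" using p_hor_eq[OF b] by simp
qed

text \<open>The chosen d is \<open>\<sigma> (a, fst \<Psi>, c)\<close> with c unknown. Its
  contributions to the two terms cancel because both functionals restrict to the same element of the
  dual of C, so the value is that for c = 0.\<close>

lemma dual_pairing_vel:
  assumes P: "\<Psi> \<in> dual_pts DB" and b: "fst \<Psi> \<in> fib B m" and a: "a \<in> fib A m" 
    and f: "f \<in> fib_dual B m"
  shows "dual_pairing D (vel a (snd (p_hor D \<Psi>)) f) \<Psi> = snd \<Psi> (\<sigma> (a, fst \<Psi>, zC m)) - f (fst \<Psi>)"
proof -
  have m: "m \<in> pts M" using fib_base b by blast
  let ?P = "\<lambda>d. d \<in> fib DA a \<and> d \<in> fib DB (fst \<Psi>)"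
  have "?P (\<sigma> (a, fst \<Psi>, zC m))" using sigma_fib[OF a b zC[OF m]] by blast
  then have d: "?P (SOME d. ?P d)" by (rule someI)
  obtain b' c where x: "b' \<in> fib B m" "c \<in> fib C m" "(SOME d. ?P d) = \<sigma> (a, b', c)"
    by (rule fib_DA_m[OF conjunct1[OF d] a])
  have e: "b' = fst \<Psi>" using d x(3) prjB_sigma[OF a x(1,2)] by (simp add: fib_def)
  have "dual_pairing D (vel a (snd (p_hor D \<Psi>)) f) \<Psi> = 
     snd \<Psi> (\<sigma> (a, fst \<Psi>, c)) - snd (vel a (snd (p_hor D \<Psi>)) f) (\<sigma> (a, fst \<Psi>, c))"
    using x(3) e by (simp add: dual_pairing_def Let_def)
  also have "\<dots> = snd \<Psi> (\<sigma> (a, fst \<Psi>, zC m)) + snd \<Psi> (\<sigma> (zA m, fst \<Psi>, c)) - (snd (p_hor D \<Psi>) c + f (fst \<Psi>))"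
    using dual_DB_add[OF P b a x(2)] vel_sigma[OF a b x(2)] by simp
  also have "snd (p_hor D \<Psi>) c = snd \<Psi> (\<sigma> (zA m, fst \<Psi>, c))" using p_hor_eq[OF b] x(2) by simp
  finally show ?thesis by simp
qed

text \<open>The image of \<open>(b, g, 0)\<close> under \<open>B \<oplus> C\<^sup>* \<oplus> A\<^sup>* \<cong> D\<^sub>B\<^sup>*\<close>.\<close>

definition hel :: "'b \<Rightarrow> ('d \<Rightarrow> real) \<Rightarrow> 'b \<times> ('d \<Rightarrow> real)" where
  "hel b g = (b, \<lambda>d\<in>fib DB b. g (kC d))"

lemma fst_hel [simp]: "fst (hel b g) = b"
  by (simp add: hel_def)

lemma hel_sigma: "a \<in> fib A m \<Longrightarrow> b \<in> fib B m \<Longrightarrow> c \<in> fib C m \<Longrightarrow> snd (hel b g) (\<sigma> (a, b, c)) = g c"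
  by (simp add: hel_def sigma_fib)

text \<open>Supplies a test point over any b and any g with the same foot point m. It annihilates
  \<open>\<sigma> (a, b, zC m)\<close>, so horizontal lifts contribute nothing there.\<close>

lemma hel_dual_pts:
  assumes b: "b \<in> fib B m" and g: "g \<in> fib_dual C m"
  shows "hel b g \<in> dual_pts DB" "p_hor D (hel b g) = (m, g)"
proof -
  have m: "m \<in> pts M" using fib_base b by blast
  have "snd (hel b g) \<in> fib_dual DB b"
    unfolding fib_dual_def
  proof (intro CollectI conjI ballI allI)
    show "snd (hel b g) \<in> extensional (fib DB b)" by (simp add: hel_def)
    fix u assume "u \<in> fib DB b"
    then obtain a c where x: "a \<in> fib A m" "c \<in> fib C m" "u = \<sigma> (a, b, c)" using fib_DB_m[OF _ b] by blast
    show "snd (hel b g) (vscl DB r u) = r * snd (hel b g) u" for r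
      using x b sigma_sclB[OF x(1) b x(2)] hel_sigma[OF _ b] vscl_in[OF fvss(3)] vscl_in[OF fvs_C] m
        fib_dualD(2)[OF g x(2)] by simp
    fix v assume "v \<in> fib DB b"
    then obtain a' c' where y: "a' \<in> fib A m" "c' \<in> fib C m" "v = \<sigma> (a', b, c')" using fib_DB_m[OF _ b] by blast
    show "snd (hel b g) (vadd DB u v) = snd (hel b g) u + snd (hel b g) v"
      using x y b sigma_addB[OF x(1) b x(2) y(1,2)] hel_sigma[OF _ b] vadd_in[OF fvss(3) _ x(1) y(1)] vadd_in[OF fvs_C _ x(2) y(2)] m
        fib_dualD(1)[OF g x(2) y(2)] by simp
  qed
  then show "hel b g \<in> dual_pts DB" using prj_fib(2)[OF b] by (simp add: dual_pts_def hel_def)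
  have "(\<lambda>c\<in>fib C m. snd (hel b g) (\<sigma> (zA m, b, c))) = g"
    by (rule extensionalityI[OF restrict_extensional fib_dualD(3)[OF g]]) (simp add: hel_sigma[OF zeros(1)[OF m] b])
  then show "p_hor D (hel b g) = (m, g)" using p_hor_eq[of "hel b g" m] b by simp
qed

end

section \<open>Sections of a double vector bundle and of its vertical dual\<close>

context decomposed_dvb
begin

section \<open>Smoothness read through the decomposition\<close>

lemma tot_S: "tot (overA S) = subsp (prodsp (tot A) (prodsp (tot B) (tot C))) Tr"
proof -
  have "tot (overA S) = subsp (prodsp (tot A) (prodsp (tot B) (tot C))) (pts (tot (overA S)))"
    by (simp add: decomposed_def Let_def)
  then show ?thesis by (simp add: pts_S)
qed

lemma Tr_sub: "Tr \<subseteq> pts (prodsp (tot A) (prodsp (tot B) (tot C)))"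
  by (auto simp: Tr_def fib_def)

lemma smooth_sigma:
  assumes "saturated X" "smooth_map X (tot A) a" "smooth_map X (tot B) b" "smooth_map X (tot C) c"
    and "\<And>x. x \<in> pts X \<Longrightarrow> a x \<in> fib A (m x) \<and> b x \<in> fib B (m x) \<and> c x \<in> fib C (m x)"
  shows "smooth_map X (tot DA) (\<lambda>x. \<sigma> (a x, b x, c x))"
proof -
  have "smooth_map X (tot (overA S)) (\<lambda>x. (a x, b x, c x))"
    unfolding tot_S
    by (intro smooth_map_subspI smooth_map_prodspI assms(1-4)) (use assms(5) in \<open>auto simp: Tr_def\<close>)
  then show ?thesis by (rule smooth_map_compose[OF _ sigma_smooth])
qed

lemma smooth_kC: "smooth_map (tot DA) (tot C) kC"
proof -
  have "smooth_map (tot (overA S)) (tot C) (\<lambda>x. snd (snd x))"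
    unfolding tot_S
    by (rule smooth_map_compose[OF smooth_map_compose[OF smooth_map_subsp_incl[OF Tr_sub] smooth_map_snd] smooth_map_snd])
  from smooth_map_compose[OF sigma_inv_smooth this] show ?thesis by (simp add: kC_def[abs_def])
qed

lemma satM: "saturated M"
  using vb_saturated(2)[OF vbs(3)] .

lemma smooth_zA: "smooth_map M (tot A) zA"
  using smooth_vzero[OF vbs(3)] .

text \<open>The core is not known to be a vector bundle, so its zero section is taken as the
  composite of the zero sections of A and of \<open>D \<rightarrow> A\<close>, which lands in the
  core.\<close>

lemma smooth_zC: "smooth_map M (tot C) zC"
proof -
  have z: "zC = (\<lambda>m. vzero DA (zA m))" by (simp add: core_def)
  have "smooth_map M (tot DA) zC"
    unfolding z using smooth_map_compose[OF smooth_zA, of "tot DA" "vzero DA"] smooth_vzero[OF vbs(1)] by simp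
  moreover have "zC \<in> pts M \<rightarrow> pts (tot C)" using zC by (auto simp: fib_def)
  moreover have "tot C = subsp (tot DA) (pts (tot C))" by (simp add: core_def)
  ultimately show ?thesis using smooth_map_subspI[OF satM, of "tot DA" zC "pts (tot C)"] by metis
qed

lemma Sect_A_fib: "a \<in> Sect A \<Longrightarrow> m \<in> pts M \<Longrightarrow> a m \<in> fib A m"
  using Sect_fib[of a A m] by simp

lemma Sect_B_fib: "b \<in> Sect B \<Longrightarrow> m \<in> pts M \<Longrightarrow> b m \<in> fib B m"
  using Sect_fib[of b B m] by simp

lemma Sect_C_fib: "c \<in> Sect C \<Longrightarrow> m \<in> pts M \<Longrightarrow> c m \<in> fib C m"
  using Sect_fib[of c C m] by simp

text \<open>Restricting a section of \<open>D \<rightarrow> A\<close> to the image of a and taking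
  components is smooth because the decomposition is a diffeomorphism. With a the zero section it
  produces sections of the core; for general a it serves to test smoothness into the vertical
  dual.\<close>

lemma Sect_along:
  assumes s: "s \<in> Sect DA" and a: "smooth_map M (tot A) a" "\<And>m. m \<in> pts M \<Longrightarrow> a m \<in> fib A m"
  shows "(\<lambda>m\<in>pts M. kC (s (a m))) \<in> Sect C" "(\<lambda>m\<in>pts M. prj DB (s (a m))) \<in> Sect B"
    and "\<And>m. m \<in> pts M \<Longrightarrow> s (a m) = \<sigma> (a m, prj DB (s (a m)), kC (s (a m)))"
proof -
  have sm: "smooth_map M (tot DA) (\<lambda>m. s (a m))"
    using smooth_map_compose[OF a(1)] Sect_smooth[OF s] by simp
  have f: "s (a m) \<in> fib DA (a m)" if "m \<in> pts M" for m
    using Sect_fib[OF s, of "a m"] a(2)[OF that] by (simp add: fib_def)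
  have "restrict (\<lambda>m. kC (s (a m))) (pts (bas C)) \<in> Sect C"
    using smooth_map_compose[OF sm smooth_kC] prj_fib(1)[OF kC_fib(1)[OF f a(2)]] by (intro SectI) auto
  then show "(\<lambda>m\<in>pts M. kC (s (a m))) \<in> Sect C" by simp
  have "smooth_map M (tot B) (\<lambda>m. prj DB (s (a m)))"
    using smooth_map_compose[OF sm vb_morphismD(1)[OF prj_morphism]] .
  then have "restrict (\<lambda>m. prj DB (s (a m))) (pts (bas B)) \<in> Sect B"
    using prj_fib(1)[OF kC_fib(2)[OF f a(2)]] by (intro SectI) auto
  then show "(\<lambda>m\<in>pts M. prj DB (s (a m))) \<in> Sect B" by simp
  fix m assume m: "m \<in> pts M"
  obtain b c where x: "b \<in> fib B m" "c \<in> fib C m" "s (a m) = \<sigma> (a m, b, c)" using fib_DA_m[OF f[OF m] a(2)[OF m]] .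
  show "s (a m) = \<sigma> (a m, prj DB (s (a m)), kC (s (a m)))"
    unfolding x(3) using prjB_sigma[OF a(2)[OF m] x(1,2)] kC_sigma[OF a(2)[OF m] x(1,2)] by simp
qed

lemma core_section_eq:
  assumes "b \<in> fib B m" "c m \<in> fib C m"
  shows "core_section D (\<lambda>c. c) c b = \<sigma> (zA m, b, c m)"
  using zero_DB_plus_core[OF assms] prj_fib[OF assms(1)] by (simp add: core_section_def)

lemma pts_B: "b \<in> pts (tot B) \<Longrightarrow> b \<in> fib B (prj B b) \<and> prj B b \<in> pts M"
  using vb_in_fib[OF vbs(4)] by auto

lemma core_section_Sect:
  assumes c: "c \<in> Sect C" shows "core_section D (\<lambda>c. c) c \<in> Sect DB"
proof -
  let ?f = "\<lambda>b. \<sigma> (zA (prj B b), b, c (prj B b))"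
  have p: "smooth_map (tot B) M (prj B)" using vb_prj_smooth[OF vbs(4)] by simp
  have "smooth_map (tot B) (tot DA) ?f"
    using smooth_map_compose[OF p smooth_zA] smooth_map_id[OF vb_saturated(1)[OF vbs(4)]] 
      smooth_map_compose[OF p] Sect_smooth[OF c] zeros(1) Sect_C_fib[OF c] pts_B vb_saturated(1)[OF vbs(4)]
    by (intro smooth_sigma[where m = "prj B"]) auto
  then have "restrict ?f (pts (bas DB)) \<in> Sect DB"
    using prjB_sigma[OF zeros(1) _ Sect_C_fib[OF c]] pts_B by (intro SectI) auto
  moreover have "restrict ?f (pts (bas DB)) = core_section D (\<lambda>c. c) c"
  proof
    fix b show "restrict ?f (pts (bas DB)) b = core_section D (\<lambda>c. c) c b"
      using core_section_eq[of b "prj B b" c] pts_B[of b] Sect_C_fib[OF c] 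
      by (cases "b \<in> pts (tot B)") (auto simp: core_section_def)
  qed
  ultimately show ?thesis by simp
qed

text \<open>That \<open>C\<close> and \<open>B\<^sup>*\<close> have enough sections is deduced from \<open>D \<rightarrow> A\<close> and \<open>D\<^sub>A\<^sup>* \<rightarrow> A\<close>, which are vector
  bundles by hypothesis: restrict a section to the zero section of \<open>A\<close> and project.\<close>

lemma Sect_C_through:
  assumes "c \<in> fib C m"
  obtains s where "s \<in> Sect C" "s m = c"
proof -
  have m: "m \<in> pts M" using fib_C_base assms by blast
  have "c \<in> fib DA (zA m)" "zA m \<in> pts (bas DA)" using fib_C[OF m] assms zeros(1)[OF m] by (auto simp: fib_def)
  then obtain s where s: "s \<in> Sect DA" "s (zA m) = c" using section_through[OF vbs(1)] by metis
  have "kC c = c" using sigma_core[OF assms] kC_sigma[OF zeros[OF m] assms] by simp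
  then show ?thesis using that[OF Sect_along(1)[OF s(1) smooth_zA zeros(1)]] s(2) m by simp
qed

text \<open>Pairing a section of the vertical dual with this one along the zero section of A
  extracts its component in the dual of B, evaluated on s.\<close>

lemma horizontal_Sect:
  assumes s: "s \<in> Sect B"
  shows "(\<lambda>a\<in>pts (tot A). \<sigma> (a, s (prj A a), zC (prj A a))) \<in> Sect DA"
proof -
  let ?f = "\<lambda>a. \<sigma> (a, s (prj A a), zC (prj A a))"
  have p: "smooth_map (tot A) M (prj A)" using vb_prj_smooth[OF vbs(3)] .
  have A: "a \<in> fib A (prj A a) \<and> prj A a \<in> pts M" if "a \<in> pts (tot A)" for a
    using vb_in_fib[OF vbs(3) that] by auto
  have "smooth_map (tot A) (tot DA) ?f"
    using smooth_map_compose[OF p smooth_zC] smooth_map_id[OF vb_saturated(1)[OF vbs(3)]] 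
      smooth_map_compose[OF p] Sect_smooth[OF s] zC Sect_B_fib[OF s] A vb_saturated(1)[OF vbs(3)]
    by (intro smooth_sigma[where m = "prj A"]) auto
  then have "restrict ?f (pts (bas DA)) \<in> Sect DA"
    using prjA_sigma[OF _ Sect_B_fib[OF s] zC] A by (intro SectI) auto
  then show ?thesis by simp
qed

end

locale dualised_dvb = decomposed_dvb +
  assumes dual_dvb: "double_vector_bundle (vertical_dual D)"
begin

lemma vertical_dual_simps [simp]:
  "overA (vertical_dual D) = dual DA" "sideA (vertical_dual D) = A" "sideB (vertical_dual D) = dual C"
  "tot (overB (vertical_dual D)) = tot (dual DA)" "bas (overB (vertical_dual D)) = tot (dual C)"
  "prj (overB (vertical_dual D)) = p_ver D" "vadd (overB (vertical_dual D)) = ver_add D"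
  "vzero (overB (vertical_dual D)) = ver_zero D"
  by (simp_all add: vertical_dual_def)

section \<open>Sections of the vertical dual\<close>

lemma vb_dual_DA: "vector_bundle (dual DA)" and vb_dual_C: "vector_bundle (dual C)"
  using dual_dvb by (simp_all add: double_vector_bundle_def)

lemma dual_C: "\<gamma> \<in> dual_pts C \<Longrightarrow> fst \<gamma> \<in> pts M \<and> snd \<gamma> \<in> fib_dual C (fst \<gamma>)"
  by (auto simp: dual_pts_def)

lemma smooth_fst_dual_C: "smooth_map (tot (dual C)) M fst"
  using vb_prj_smooth[OF vb_dual_C] by simp

lemma Sect_dual_B: "\<beta> \<in> Sect (dual B) \<Longrightarrow> m \<in> pts M \<Longrightarrow> fst (\<beta> m) = m \<and> snd (\<beta> m) \<in> fib_dual B m"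
  using Sect_dual_fib[of \<beta> B m] by simp

lemma Sect_dual_B_through:
  assumes m: "m \<in> pts M" and f: "f \<in> fib_dual B m"
  obtains \<beta> where "\<beta> \<in> Sect (dual B)" "\<beta> m = (m, f)"
proof -
  let ?v = "vel (zA m) (\<lambda>u\<in>fib C m. 0) f"
  have z: "(\<lambda>u\<in>fib C m. 0) \<in> fib_dual C m" using zero_functional[OF fvs_C] m by simp
  have "?v \<in> fib (dual DA) (zA m)" "zA m \<in> pts (bas (dual DA))" 
    using vel_dual_pts[OF zeros(1)[OF m] z f] zeros(1)[OF m] by (auto simp: fib_def)
  then obtain T where T: "T \<in> Sect (dual DA)" "T (zA m) = ?v" using section_through[OF vb_dual_DA] by metis
  have Tf: "fst (T (zA q)) = zA q \<and> snd (T (zA q)) \<in> fib_dual DA (zA q)" if "q \<in> pts M" for q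
    using Sect_dual_fib[OF T(1)] zeros(1)[OF that] by (auto simp: fib_def)
  \<comment> \<open>The component in the dual of B of T along the zero section of A; at m it is f by
    the choice of T.\<close>
  define \<beta> where "\<beta> q = (q, \<lambda>b\<in>fib B q. snd (T (zA q)) (\<sigma> (zA q, b, zC q)))" for q
  have dp: "\<beta> q \<in> dual_pts B" if q: "q \<in> pts M" for q
  proof -
    note zz = zeros(1)[OF q] zC[OF q]
    have "snd (\<beta> q) \<in> fib_dual B q"
      unfolding fib_dual_def
    proof (intro CollectI conjI ballI allI)
      show "snd (\<beta> q) \<in> extensional (fib B q)" by (simp add: \<beta>_def)
      fix u assume u: "u \<in> fib B q"
      show "snd (\<beta> q) (vscl B r u) = r * snd (\<beta> q) u" for r
        using u q sigma_sclA[OF zz(1) u zz(2), of r] vscl_in[OF fvss(4) _ u, of r] vscl_vzero[OF fvs_C, of q r]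
          fib_dualD(2)[OF conjunct2[OF Tf[OF q]] sigma_fib(1)[OF zz(1) u zz(2)], of r] by (simp add: \<beta>_def)
      fix v assume v: "v \<in> fib B q"
      show "snd (\<beta> q) (vadd B u v) = snd (\<beta> q) u + snd (\<beta> q) v"
        using u v q sigma_addA[OF zz(1) u zz(2) v zz(2)] vadd_in[OF fvss(4) _ u v] vadd_zero_left[OF fvs_C _ zz(2)]
          fib_dualD(1)[OF conjunct2[OF Tf[OF q]] sigma_fib(1)[OF zz(1) u zz(2)] sigma_fib(1)[OF zz(1) v zz(2)]] by (simp add: \<beta>_def)
    qed
    then show ?thesis using q by (simp add: dual_pts_def \<beta>_def)
  qed
  have "smooth_map M (tot (dual B)) \<beta>"
  proof (rule smooth_map_into_dual[OF satM])
    show "\<beta> \<in> pts M \<rightarrow> dual_pts B" using dp by blast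
    show "smooth_map M (bas B) (\<lambda>x. fst (\<beta> x))" using smooth_map_id[OF satM] by (simp add: \<beta>_def)
    fix s assume s: "s \<in> Sect B"
    let ?S = "\<lambda>a\<in>pts (tot A). \<sigma> (a, s (prj A a), zC (prj A a))"
    have "pairing DA T ?S \<in> smf (tot A)" using pairing_smf[OF T(1) horizontal_Sect[OF s]] by simp
    then have "pull M zA (pairing DA T ?S) \<in> smf M" by (rule smooth_map_pull[OF smooth_zA])
    moreover have "pull M zA (pairing DA T ?S) = (\<lambda>x\<in>pts M. snd (\<beta> x) (s (fst (\<beta> x))))"
      unfolding pull_def
    proof (rule restrict_ext)
      fix q assume q: "q \<in> pts M"
      show "pairing DA T ?S (zA q) = snd (\<beta> q) (s (fst (\<beta> q)))"
        using prj_fib[OF zeros(1)[OF q]] Sect_B_fib[OF s q] by (simp add: pairing_def \<beta>_def)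
    qed
    ultimately show "(\<lambda>x\<in>pts M. snd (\<beta> x) (s (fst (\<beta> x)))) \<in> smf M" by simp
  qed
  then have "restrict \<beta> (pts (bas (dual B))) \<in> Sect (dual B)"
    by (intro SectI) (auto simp: \<beta>_def)
  moreover have "restrict \<beta> (pts (bas (dual B))) m = (m, f)"
  proof -
    have "(\<lambda>b\<in>fib B m. snd (T (zA m)) (\<sigma> (zA m, b, zC m))) = f"
    proof (rule extensionalityI[OF restrict_extensional fib_dualD(3)[OF f]])
      fix b assume b: "b \<in> fib B m"
      show "(\<lambda>b\<in>fib B m. snd (T (zA m)) (\<sigma> (zA m, b, zC m))) b = f b"
        using vel_sigma[OF zeros(1)[OF m] b zC[OF m]] T(2) b zC[OF m] by simp
    qed
    then show ?thesis using m by (simp add: \<beta>_def)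
  qed
  ultimately show ?thesis using that by blast
qed

text \<open>Tested against a section s of \<open>D \<rightarrow> A\<close>, the functional splits
  into the linear function of the C-component of \<open>s (a m)\<close>, in the variable from the
  dual of C, and a function pulled back from M. The lift is the case of zero \<open>\<beta>\<close>,
  core sections that of zero a.\<close>

lemma smooth_vel:
  assumes a: "smooth_map M (tot A) a" "\<And>m. m \<in> pts M \<Longrightarrow> a m \<in> fib A m"
    and \<beta>: "\<And>m. m \<in> pts M \<Longrightarrow> \<beta> m \<in> fib_dual B m" 
    and \<beta>s: "\<And>s. s \<in> Sect B \<Longrightarrow> (\<lambda>m\<in>pts M. \<beta> m (s m)) \<in> smf M"
  shows "(\<lambda>\<gamma>\<in>dual_pts C. vel (a (fst \<gamma>)) (snd \<gamma>) (\<beta> (fst \<gamma>))) \<in> Sect (overB (vertical_dual D))"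
proof -
  let ?f = "\<lambda>\<gamma>. vel (a (fst \<gamma>)) (snd \<gamma>) (\<beta> (fst \<gamma>))"
  have sat: "saturated (tot (dual C))" using vb_saturated(1)[OF vb_dual_C] .
  have "smooth_map (tot (dual C)) (tot (dual DA)) ?f"
  proof (rule smooth_map_into_dual[OF sat])
    show "?f \<in> pts (tot (dual C)) \<rightarrow> dual_pts DA"
      using vel_dual_pts[OF a(2) _ \<beta>] dual_C by auto
    show "smooth_map (tot (dual C)) (bas DA) (\<lambda>x. fst (?f x))"
      using smooth_map_compose[OF smooth_fst_dual_C a(1)] by simp
    fix s assume s: "s \<in> Sect DA"
    let ?c = "\<lambda>m\<in>pts M. kC (s (a m))" and ?b = "\<lambda>m\<in>pts M. prj DB (s (a m))"
    have al1: "?c \<in> Sect C" by (rule Sect_along(1)[OF s a])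
    have al2: "?b \<in> Sect B" by (rule Sect_along(2)[OF s a])
    have al3: "s (a m) = \<sigma> (a m, prj DB (s (a m)), kC (s (a m)))" if "m \<in> pts M" for m
      by (rule Sect_along(3)[OF s a that])
    note al = al1 al2 al3
    let ?p = "pull (tot (dual C)) fst (\<lambda>m\<in>pts M. \<beta> m (?b m))"
    have "(\<lambda>x\<in>pts (tot (dual C)). ell_sect C ?c x + ?p x) \<in> smf (tot (dual C))"
      by (rule smf_add[OF sat ell_sect_smf[OF al(1)] smooth_map_pull[OF smooth_fst_dual_C \<beta>s[OF al(2)]]])
    moreover have "(\<lambda>x\<in>pts (tot (dual C)). ell_sect C ?c x + ?p x) = 
      (\<lambda>x\<in>pts (tot (dual C)). snd (?f x) (s (fst (?f x))))"
    proof (rule restrict_ext)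
      fix x assume "x \<in> pts (tot (dual C))"
      then have x: "x \<in> dual_pts C" "fst x \<in> pts M" using dual_C by auto
      have kc: "kC (s (a (fst x))) \<in> fib C (fst x)" "prj DB (s (a (fst x))) \<in> fib B (fst x)"
        using Sect_C_fib[OF al(1) x(2)] Sect_B_fib[OF al(2) x(2)] x(2) by simp_all
      have "snd (?f x) (s (a (fst x))) = snd x (kC (s (a (fst x)))) + \<beta> (fst x) (prj DB (s (a (fst x))))"
        using vel_sigma[OF a(2)[OF x(2)] kc(2,1)] al(3)[OF x(2)] by metis
      then show "ell_sect C ?c x + ?p x = snd (?f x) (s (fst (?f x)))"
        using x by (simp add: ell_sect_def pull_def)
    qed
    ultimately show "(\<lambda>x\<in>pts (tot (dual C)). snd (?f x) (s (fst (?f x)))) \<in> smf (tot (dual C))" by simp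
  qed
  then have "restrict ?f (pts (bas (overB (vertical_dual D)))) \<in> Sect (overB (vertical_dual D))"
    using p_ver_vel[OF a(2) _ \<beta>] dual_C by (intro SectI) auto
  then show ?thesis by simp
qed

lemma zero_fun_B: "m \<in> pts M \<Longrightarrow> (\<lambda>u\<in>fib B m. 0) \<in> fib_dual B m"
  using zero_functional[OF fvss(4)] by simp

lemma dual_lift_eq:
  assumes "a \<in> Sect A"
  shows "dual_lift D \<sigma> a = (\<lambda>\<gamma>\<in>dual_pts C. vel (a (fst \<gamma>)) (snd \<gamma>) (\<lambda>u\<in>fib B (fst \<gamma>). 0))"
proof
  fix \<gamma> show "dual_lift D \<sigma> a \<gamma> = (\<lambda>\<gamma>\<in>dual_pts C. vel (a (fst \<gamma>)) (snd \<gamma>) (\<lambda>u\<in>fib B (fst \<gamma>). 0)) \<gamma>"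
    using dual_lift_vel[of "fst \<gamma>" "snd \<gamma>" a] Sect_A_fib[OF assms] dual_C[of \<gamma>]
    by (cases "\<gamma> \<in> dual_pts C") (simp_all add: dual_lift_def)
qed

lemma dual_lift_Sect: "a \<in> Sect A \<Longrightarrow> dual_lift D \<sigma> a \<in> Sect (overB (vertical_dual D))"
proof -
  assume a: "a \<in> Sect A"
  have z: "(\<lambda>m\<in>pts M. (\<lambda>u\<in>fib B m. 0) (s m)) \<in> smf M" if s: "s \<in> Sect B" for s
  proof -
    have "(\<lambda>m\<in>pts M. (\<lambda>u\<in>fib B m. 0) (s m)) = (\<lambda>m\<in>pts M. 0::real)"
      by (rule restrict_ext) (use Sect_B_fib[OF s] in simp)
    then show ?thesis using smf_const[OF satM, of 0] by metis
  qed
  show ?thesis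
    unfolding dual_lift_eq[OF a]
    by (rule smooth_vel[OF Sect_smooth[OF a] Sect_A_fib[OF a] zero_fun_B z])
qed

lemma dual_lift_linear:
  assumes a: "a \<in> Sect A" shows "linear_section (vertical_dual D) (dual_lift D \<sigma> a) a"
proof -
  let ?h = "dual_lift D \<sigma> a"
  have h: "?h \<gamma> = vel (a (fst \<gamma>)) (snd \<gamma>) (\<lambda>u\<in>fib B (fst \<gamma>). 0)" if "\<gamma> \<in> dual_pts C" for \<gamma>
    unfolding dual_lift_eq[OF a] using that by simp
  have "vb_morphism (dual C) (dual DA) ?h a"
    unfolding vb_morphism_def
  proof (intro conjI ballI allI impI)
    show "smooth_map (tot (dual C)) (tot (dual DA)) ?h"
      using Sect_smooth[OF dual_lift_Sect[OF a]] by simp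
    show "smooth_map (bas (dual C)) (bas (dual DA)) a" using Sect_smooth[OF a] by simp
    fix u assume "u \<in> pts (tot (dual C))"
    then have u: "u \<in> dual_pts C" "fst u \<in> pts M" using dual_C by auto
    note af = Sect_A_fib[OF a u(2)]
    have uf: "u \<in> fib (dual C) (fst u)" using u by (simp add: fib_def)
    show "prj (dual DA) (?h u) = a (prj (dual C) u)" using h[OF u(1)] by simp
    show "?h (vscl (dual C) r u) = vscl (dual DA) r (?h u)" for r
    proof -
      have ru: "vscl (dual C) r u \<in> dual_pts C" using vscl_in[OF vb_fvs[OF vb_dual_C] _ uf, of r] u by (simp add: fib_def)
      have "vscl (dual DA) r (?h u) = vel (a (fst u)) (snd (vscl (dual C) r u)) (\<lambda>u\<in>fib B (fst u). 0)"
      proof (rule vel_eqI[OF _ af])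
        fix b c assume x: "b \<in> fib B (fst u)" "c \<in> fib C (fst u)"
        show "snd (vscl (dual DA) r (?h u)) (\<sigma> (a (fst u), b, c)) = snd (vscl (dual C) r u) c + (\<lambda>u\<in>fib B (fst u). 0) b"
          using h[OF u(1)] vel_sigma[OF af x] sigma_fib(1)[OF af x] x by (simp add: dual_def)
      qed (simp_all add: h[OF u(1)] dual_def)
      then show ?thesis using h[OF ru] by (simp add: dual_def)
    qed
    fix v assume "v \<in> pts (tot (dual C))" "prj (dual C) u = prj (dual C) v"
    then have v: "v \<in> dual_pts C" "fst v = fst u" by auto
    have vf: "v \<in> fib (dual C) (fst u)" using v by (simp add: fib_def)
    show "?h (vadd (dual C) u v) = vadd (dual DA) (?h u) (?h v)"
    proof -
      have ru: "vadd (dual C) u v \<in> dual_pts C" using vadd_in[OF vb_fvs[OF vb_dual_C] _ uf vf] u by (simp add: fib_def)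
      have "vadd (dual DA) (?h u) (?h v) = vel (a (fst u)) (snd (vadd (dual C) u v)) (\<lambda>u\<in>fib B (fst u). 0)"
      proof (rule vel_eqI[OF _ af])
        fix b c assume x: "b \<in> fib B (fst u)" "c \<in> fib C (fst u)"
        show "snd (vadd (dual DA) (?h u) (?h v)) (\<sigma> (a (fst u), b, c)) = snd (vadd (dual C) u v) c + (\<lambda>u\<in>fib B (fst u). 0) b"
          using h[OF u(1)] h[OF v(1)] v(2) vel_sigma[OF af x] sigma_fib(1)[OF af x] x by (simp add: dual_def)
      qed (simp_all add: h[OF u(1)] dual_def)
      then show ?thesis using h[OF ru] by (simp add: dual_def)
    qed
  qed
  then show ?thesis using a dual_lift_Sect[OF a] by (simp add: linear_section_def)
qed

lemma hom_hat_dual_eq: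
  assumes "\<gamma> \<in> dual_pts C" "T \<gamma> \<in> dual_pts B" "fst (T \<gamma>) = fst \<gamma>"
  shows "hom_hat (vertical_dual D) (ver_core D) T \<gamma> = vel (zA (fst \<gamma>)) (snd \<gamma>) (snd (T \<gamma>))"
proof -
  have m: "fst \<gamma> \<in> pts M" "snd \<gamma> \<in> fib_dual C (fst \<gamma>)" "snd (T \<gamma>) \<in> fib_dual B (fst \<gamma>)"
    using dual_C[OF assms(1)] assms(2,3) by (auto simp: dual_pts_def)
  have "T \<gamma> = (fst \<gamma>, snd (T \<gamma>))" using assms(3) by (simp add: prod_eq_iff)
  then show ?thesis using core_plus_vel[OF m] assms(1) by (simp add: hom_hat_def)
qed

lemma core_section_dual_eq:
  assumes \<beta>: "\<beta> \<in> Sect (dual B)"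
  shows "core_section (vertical_dual D) (ver_core D) \<beta> = 
    (\<lambda>\<gamma>\<in>dual_pts C. vel (zA (fst \<gamma>)) (snd \<gamma>) (snd (\<beta> (fst \<gamma>))))"
proof
  fix \<gamma> show "core_section (vertical_dual D) (ver_core D) \<beta> \<gamma> = 
    (\<lambda>\<gamma>\<in>dual_pts C. vel (zA (fst \<gamma>)) (snd \<gamma>) (snd (\<beta> (fst \<gamma>)))) \<gamma>"
  proof (cases "\<gamma> \<in> dual_pts C")
    case True
    then have m: "fst \<gamma> \<in> pts M" using dual_C by blast
    then show ?thesis
      using hom_hat_dual_eq[OF True, of "\<lambda>\<gamma>. \<beta> (fst \<gamma>)"] True Sect_dual_fib[OF \<beta>] 
      by (simp add: hom_hat_def core_section_def)
  qed (simp add: core_section_def)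
qed

lemma core_section_dual_Sect:
  assumes \<beta>: "\<beta> \<in> Sect (dual B)"
  shows "core_section (vertical_dual D) (ver_core D) \<beta> \<in> Sect (overB (vertical_dual D))"
  unfolding core_section_dual_eq[OF \<beta>]
proof (rule smooth_vel[OF smooth_zA zeros(1), where \<beta> = "\<lambda>m. snd (\<beta> m)"])
  show "snd (\<beta> m) \<in> fib_dual B m" if "m \<in> pts M" for m using Sect_dual_B[OF \<beta> that] by simp
  show "(\<lambda>m\<in>pts M. snd (\<beta> m) (s m)) \<in> smf M" if "s \<in> Sect B" for s
    using pairing_smf[OF \<beta> that] by (simp add: pairing_def)
qed

section \<open>The functions on the dual of \<open>D \<rightarrow> B\<close> defined by these
  sections\<close>

lemma dual_DB: "\<Psi> \<in> dual_pts DB \<Longrightarrow> fst \<Psi> \<in> fib B (prj B (fst \<Psi>)) \<and> prj B (fst \<Psi>) \<in> pts M"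
  using pts_B[of "fst \<Psi>"] by (auto simp: dual_pts_def)

lemma ell_core_dual_vel:
  assumes P: "\<Psi> \<in> dual_pts DB" "fst \<Psi> \<in> fib B m" and T: "\<Theta> (p_hor D \<Psi>) = vel a (snd (p_hor D \<Psi>)) f"
    and "a \<in> fib A m" "f \<in> fib_dual B m"
  shows "ell_core_dual D \<Theta> \<Psi> = snd \<Psi> (\<sigma> (a, fst \<Psi>, zC m)) - f (fst \<Psi>)"
  using dual_pairing_vel[OF P assms(4,5)] P(1) T by (simp add: ell_core_dual_def)

text \<open>With zero A-component the functional \<open>\<Psi>\<close> is evaluated on the zero over
  b and contributes nothing; what remains is the subtracted vertical term. The form
  \<open>0 + (-1) * _\<close> is the one for which \<open>smf_affine\<close> gives
  smoothness.\<close>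

lemma ell_core_dual_core_section:
  assumes \<beta>: "\<beta> \<in> Sect (dual B)"
  shows "ell_core_dual D (core_section (vertical_dual D) (ver_core D) \<beta>) = 
    pull (tot (dual DB)) fst (\<lambda>b\<in>pts (tot B). 0 + (-1) * ell B \<beta> b)"
proof
  fix \<Psi>
  show "ell_core_dual D (core_section (vertical_dual D) (ver_core D) \<beta>) \<Psi> = 
    pull (tot (dual DB)) fst (\<lambda>b\<in>pts (tot B). 0 + (-1) * ell B \<beta> b) \<Psi>"
  proof (cases "\<Psi> \<in> dual_pts DB")
    case P: True
    let ?m = "prj B (fst \<Psi>)"
    have b: "fst \<Psi> \<in> fib B ?m" and m: "?m \<in> pts M" using dual_DB[OF P] by auto
    note ph = p_hor_dual[OF P b]
    have f: "snd (\<beta> ?m) \<in> fib_dual B ?m" using Sect_dual_B[OF \<beta> m] by simp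
    have "ell_core_dual D (core_section (vertical_dual D) (ver_core D) \<beta>) \<Psi> = 
      snd \<Psi> (\<sigma> (zA ?m, fst \<Psi>, zC ?m)) - snd (\<beta> ?m) (fst \<Psi>)"
      using ph by (intro ell_core_dual_vel[OF P b _ zeros(1)[OF m] f]) (simp add: core_section_dual_eq[OF \<beta>])
    also have "snd \<Psi> (\<sigma> (zA ?m, fst \<Psi>, zC ?m)) = 0"
      using zero_DB[OF b] fib_dual_vzero[OF fvss(2), of "fst \<Psi>" "snd \<Psi>"] P by (auto simp: dual_pts_def)
    finally show ?thesis using P prj_fib(2)[OF b] by (simp add: pull_def ell_def)
  qed (simp add: ell_core_dual_def pull_def)
qed

text \<open>The projection to the dual of C is evaluation on the sum over A of the zero over b and a
  core element, which is the value of a core section.\<close>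

lemma pull_p_hor_ell:
  assumes c: "c \<in> Sect C"
  shows "pull (tot (dual DB)) (p_hor D) (ell_sect C c) = ell_sect DB (core_section D (\<lambda>c. c) c)"
proof
  fix \<Psi>
  show "pull (tot (dual DB)) (p_hor D) (ell_sect C c) \<Psi> = ell_sect DB (core_section D (\<lambda>c. c) c) \<Psi>"
  proof (cases "\<Psi> \<in> dual_pts DB")
    case P: True
    let ?m = "prj B (fst \<Psi>)"
    have b: "fst \<Psi> \<in> fib B ?m" and m: "?m \<in> pts M" using dual_DB[OF P] by auto
    show ?thesis using P p_hor_dual[OF P b] p_hor_eq[OF b] core_section_eq[OF b, of c] Sect_C_fib[OF c m]
      by (simp add: pull_def ell_sect_def)
  qed (simp add: ell_sect_def pull_def)
qed

lemma pull_p_hor_prj: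
  "pull (tot (dual DB)) (p_hor D) (pull (tot (dual C)) fst f) = pull (tot (dual DB)) fst (pull (tot B) (prj B) f)"
proof
  fix \<Psi>
  show "pull (tot (dual DB)) (p_hor D) (pull (tot (dual C)) fst f) \<Psi> = pull (tot (dual DB)) fst (pull (tot B) (prj B) f) \<Psi>"
  proof (cases "\<Psi> \<in> dual_pts DB")
    case P: True
    let ?m = "prj B (fst \<Psi>)"
    have b: "fst \<Psi> \<in> fib B ?m" using dual_DB[OF P] by auto
    show ?thesis using P p_hor_dual[OF P b] prj_fib(2)[OF b] by (simp add: pull_def)
  qed (simp add: pull_def)
qed

text \<open>With zero component in the dual of B, the pairing leaves only the value of
  \<open>\<Psi>\<close> on \<open>\<sigma> (a m, b, zC m)\<close>, which is the value of h at
  b.\<close>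

lemma ell_core_dual_lift:
  assumes a: "a \<in> Sect A" and h: "\<And>b m. b \<in> fib B m \<Longrightarrow> h b = \<sigma> (a m, b, zC m)"
  shows "ell_core_dual D (dual_lift D \<sigma> a) = ell_sect DB h"
proof
  fix \<Psi>
  show "ell_core_dual D (dual_lift D \<sigma> a) \<Psi> = ell_sect DB h \<Psi>"
  proof (cases "\<Psi> \<in> dual_pts DB")
    case P: True
    let ?m = "prj B (fst \<Psi>)"
    have b: "fst \<Psi> \<in> fib B ?m" and m: "?m \<in> pts M" using dual_DB[OF P] by auto
    note ph = p_hor_dual[OF P b]
    have "ell_core_dual D (dual_lift D \<sigma> a) \<Psi> = snd \<Psi> (\<sigma> (a ?m, fst \<Psi>, zC ?m)) - (\<lambda>u\<in>fib B ?m. 0) (fst \<Psi>)"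
      using ph by (intro ell_core_dual_vel[OF P b _ Sect_A_fib[OF a m] zero_fun_B[OF m]]) (simp add: dual_lift_eq[OF a])
    then show ?thesis using h[OF b] P b by (simp add: ell_sect_def)
  qed (simp add: ell_core_dual_def ell_sect_def)
qed

end

section \<open>The dual \<open>VB\<close>-algebroid\<close>

locale dual_vb_algebroids = dualised_dvb D \<sigma>
  for D :: "('d, 'a, 'b, 'm) dvbun" and \<sigma> +
  fixes V :: "('d, 'a, 'b, 'm) vbalg" and V' :: "('a \<times> ('d \<Rightarrow> real), 'a, 'm \<times> ('d \<Rightarrow> real), 'm) vbalg"
    and h :: "('m \<Rightarrow> 'a) \<Rightarrow> 'b \<Rightarrow> 'd" and pb
  assumes dvbV: "dvb V = D" and dvbV': "dvb V' = vertical_dual D"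
    and vbalg: "vb_algebroid V" and vbalg': "vb_algebroid V'"
    and lift: "horizontal_lift D h" and lift_dec: "decomposition_of_lift D h \<sigma>"
    and pb: "dual_poisson V pb"
    and pb_brk: "\<And>\<Theta>1 \<Theta>2. \<Theta>1 \<in> Sect (overB (vertical_dual D)) \<Longrightarrow> \<Theta>2 \<in> Sect (overB (vertical_dual D)) \<Longrightarrow>
      ell_core_dual D (brk V' \<Theta>1 \<Theta>2) = pb (ell_core_dual D \<Theta>1) (ell_core_dual D \<Theta>2)"
    and pb_anch: "\<And>\<Theta> g. \<Theta> \<in> Sect (overB (vertical_dual D)) \<Longrightarrow> g \<in> smf (tot (dual C)) \<Longrightarrow>
      pull (tot (dual DB)) (p_hor D) (lie (tot (dual C)) (anch V' \<circ> \<Theta>) g) =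
      pb (ell_core_dual D \<Theta>) (pull (tot (dual DB)) (p_hor D) g)"
begin

abbreviation "P \<equiv> tot (dual DB)"
abbreviation "hat \<equiv> core_section D (\<lambda>c. c)"
abbreviation "hat' \<equiv> core_section (vertical_dual D) (ver_core D)"
abbreviation "hT \<equiv> dual_lift D \<sigma>"

lemma pb_rules:
  "f \<in> smf P \<Longrightarrow> g \<in> smf P \<Longrightarrow> pb f g = (\<lambda>x\<in>pts P. - pb g f x)"
  "f \<in> smf P \<Longrightarrow> g \<in> smf P \<Longrightarrow> pb f (\<lambda>x\<in>pts P. r * g x) = (\<lambda>x\<in>pts P. r * pb f g x)"
  "\<tau>1 \<in> Sect DB \<Longrightarrow> \<tau>2 \<in> Sect DB \<Longrightarrow> pb (ell_sect DB \<tau>1) (ell_sect DB \<tau>2) = ell_sect DB (brk V \<tau>1 \<tau>2)"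
  "\<tau>1 \<in> Sect DB \<Longrightarrow> k \<in> smf (tot B) \<Longrightarrow> pb (ell_sect DB \<tau>1) (pull P fst k) = pull P fst (lie (tot B) (anch V \<circ> \<tau>1) k)"
proof -
  note p = pb[unfolded dual_poisson_def Let_def dvbV bases prj_dual]
  then have q: "poisson P pb" by (rule conjunct1)
  show "f \<in> smf P \<Longrightarrow> g \<in> smf P \<Longrightarrow> pb f g = (\<lambda>x\<in>pts P. - pb g f x)"
    "f \<in> smf P \<Longrightarrow> g \<in> smf P \<Longrightarrow> pb f (\<lambda>x\<in>pts P. r * g x) = (\<lambda>x\<in>pts P. r * pb f g x)"
    using q unfolding poisson_def by meson+
  show "\<tau>1 \<in> Sect DB \<Longrightarrow> \<tau>2 \<in> Sect DB \<Longrightarrow> pb (ell_sect DB \<tau>1) (ell_sect DB \<tau>2) = ell_sect DB (brk V \<tau>1 \<tau>2)"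
    "\<tau>1 \<in> Sect DB \<Longrightarrow> k \<in> smf (tot B) \<Longrightarrow> pb (ell_sect DB \<tau>1) (pull P fst k) = pull P fst (lie (tot B) (anch V \<circ> \<tau>1) k)"
    using p by meson+
qed

lemma h_linear: "a \<in> Sect A \<Longrightarrow> linear_section D (h a) a"
  using lift by (simp add: horizontal_lift_def)

lemma h_Sect: "a \<in> Sect A \<Longrightarrow> h a \<in> Sect DB"
  using h_linear by (simp add: linear_section_def)

lemma h_sigma: "a \<in> Sect A \<Longrightarrow> b \<in> fib B m \<Longrightarrow> h a b = \<sigma> (a m, b, zC m)"
  using lift_dec prj_fib[of b B m] by (simp add: decomposition_of_lift_def Let_def)

lemma ell_hT: "a \<in> Sect A \<Longrightarrow> ell_core_dual D (hT a) = ell_sect DB (h a)"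
  by (rule ell_core_dual_lift[OF _ h_sigma])

text \<open>The bracket of two lifts is linear over the bracket in A, and linearity includes that
  the covered map is a section.\<close>

lemma brkA_Sect:
  assumes "a1 \<in> Sect A" "a2 \<in> Sect A"
  shows "brkA V a1 a2 \<in> Sect A" "brkA V' a1 a2 \<in> Sect A"
proof -
  have "linear_section D (brk V (h a1) (h a2)) (brkA V a1 a2)"
    using vbalg h_linear assms unfolding vb_algebroid_def Let_def dvbV by blast
  then show "brkA V a1 a2 \<in> Sect A" by (simp add: linear_section_def)
  have "linear_section (vertical_dual D) (brk V' (hT a1) (hT a2)) (brkA V' a1 a2)"
    using vbalg' dual_lift_linear assms unfolding vb_algebroid_def Let_def dvbV' by blast
  then show "brkA V' a1 a2 \<in> Sect A" by (simp add: linear_section_def)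
qed

lemma zero_fun_C: "m \<in> pts M \<Longrightarrow> (\<lambda>u\<in>fib C m. 0) \<in> fib_dual C m"
  using zero_functional[OF fvs_C] by simp

text \<open>The anchors of \<open>V\<close> and \<open>V'\<close> over \<open>M\<close> agree: compare the Hamiltonian vector field of
  \<open>\<ell>\<^bsub>h(a)\<^esub>\<close> on functions pulled back from \<open>M\<close> to \<open>D\<^sub>B\<^sup>*\<close> through \<open>C\<^sup>*\<close> and through \<open>B\<close>.\<close>

lemma lie_anchA:
  assumes a: "a \<in> Sect A" and f: "f \<in> smf M"
  shows "lie M (anchA V' \<circ> a) f = lie M (anchA V \<circ> a) f"
  unfolding lie_def
proof (rule restrict_ext)
  fix m assume m: "m \<in> pts M"
  let ?g = "pull (tot (dual C)) fst f" and ?k = "pull (tot B) (prj B) f"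
  let ?\<Psi> = "hel (zB m) (\<lambda>u\<in>fib C m. 0)" and ?\<gamma> = "(m, \<lambda>u\<in>fib C m. 0)"
  note hel = hel_dual_pts[OF zeros(2)[OF m] zero_fun_C[OF m]]
  have \<gamma>: "?\<gamma> \<in> dual_pts C" using zero_fun_C[OF m] m by (simp add: dual_pts_def)
  have g: "?g \<in> smf (tot (dual C))" using pull_prj_dual_smf[of f C] f by simp
  have k: "?k \<in> smf (tot B)" using smooth_map_pull[OF vb_prj_smooth[OF vbs(4)]] f by simp
  have m1: "vb_morphism (dual DA) (tangent_prolongation (dual C)) (anch V') (anchA V')"
    using vbalg' by (simp add: vb_algebroid_def Let_def dvbV')
  have m2: "vb_morphism DA (tangent_prolongation B) (anch V) (anchA V)"
    using vbalg by (simp add: vb_algebroid_def Let_def dvbV)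
  have t: "hT a ?\<gamma> \<in> dual_pts DA" "fst (hT a ?\<gamma>) = a m"
    using \<gamma> dual_lift_eq[OF a] vel_dual_pts[OF Sect_A_fib[OF a m] zero_fun_C[OF m] zero_fun_B[OF m]] by simp_all
  \<comment> \<open>The projection of the prolongation is the tangent map of the bundle projection,
    so the anchor of A acts on f as the anchor above it acts on the pull-back of f.\<close>
  have e1: "snd (anchA V' (a m)) f = snd (anch V' (hT a ?\<gamma>)) ?g"
    using vb_morphismD(3)[OF m1, of "hT a ?\<gamma>", symmetric] t f by (simp add: tangent_prolongation_def tangent_map_def)
  have "h a (zB m) = \<sigma> (a m, zB m, zC m)" by (rule h_sigma[OF a zeros(2)[OF m]])
  then have d: "h a (zB m) \<in> pts (tot DA)" "prj DA (h a (zB m)) = a m"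
    using sigma_pts[OF Sect_A_fib[OF a m] zeros(2)[OF m] zC[OF m]] prjA_sigma[OF Sect_A_fib[OF a m] zeros(2)[OF m] zC[OF m]] by simp_all
  have e2: "snd (anchA V (a m)) f = snd (anch V (h a (zB m))) ?k"
    using vb_morphismD(3)[OF m2, of "h a (zB m)", symmetric] d f by (simp add: tangent_prolongation_def tangent_map_def)
  have "pull P (p_hor D) (lie (tot (dual C)) (anch V' \<circ> hT a) ?g) ?\<Psi> = pull P fst (lie (tot B) (anch V \<circ> h a) ?k) ?\<Psi>"
    using pb_anch[OF dual_lift_Sect[OF a] g] pb_rules(4)[OF h_Sect[OF a] k] by (simp add: ell_hT[OF a] pull_p_hor_prj)
  then have "snd (anch V' (hT a ?\<gamma>)) ?g = snd (anch V (h a (zB m))) ?k"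
    using hel \<gamma> prj_fib(2)[OF zeros(2)[OF m]] by (simp add: pull_def lie_def)
  then show "snd ((anchA V' \<circ> a) m) f = snd ((anchA V \<circ> a) m) f" using e1 e2 by simp
qed

lemma connection_anchA:
  assumes "connection A (anchA V') E nab"
  shows "connection A (anchA V) E nab"
  using assms lie_anchA unfolding connection_def by simp

section \<open>Comparison of the structure operators\<close>

lemma neg_ell_smf: 
  assumes "\<beta> \<in> Sect (dual B)" 
  shows "(\<lambda>b\<in>pts (tot B). 0 + (-1) * ell B \<beta> b) \<in> smf (tot B)"
  by (rule smf_affine[OF vb_saturated(1)[OF vbs(4)] ell_smf[OF vbs(4) assms]])

lemma dual_C_D: "\<gamma> \<in> dual_pts C \<Longrightarrow> \<gamma> \<in> fib (dual C) (fst \<gamma>)"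
  by (simp add: fib_def)

text \<open>Both sides arise from the bracket of minus the linear function of \<open>\<beta>\<close>
  with that of the core section of c, at the point over the zeros of B and of the dual of C. Through
  \<open>V'\<close> it differentiates the linear function of c along \<open>del' \<xi>\<close>;
  through \<open>V\<close>, after exchanging the arguments, it differentiates the linear function of
  \<open>\<beta>\<close> along \<open>del c\<close>. The minus from the exchange cancels the one of
  the pairing.\<close>

lemma differential_dual:
  assumes mor: "vb_morphism C B del (\<lambda>m. m)" and mor': "vb_morphism (dual B) (dual C) del' (\<lambda>m. m)"
    and anc: "\<And>c b. c \<in> Sect C \<Longrightarrow> b \<in> pts (tot B) \<Longrightarrow> anch V (hat c b) = vertical_lift B (del \<circ> c) b"
    and anc': "\<And>\<beta> \<gamma>. \<beta> \<in> Sect (dual B) \<Longrightarrow> \<gamma> \<in> dual_pts C \<Longrightarrow> anch V' (hat' \<beta> \<gamma>) = vertical_lift (dual C) (del' \<circ> \<beta>) \<gamma>"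
    and \<xi>: "\<xi> \<in> dual_pts B"
  shows "del' \<xi> = dual_map C B del \<xi>"
proof -
  define m where "m = fst \<xi>"
  have m: "m \<in> pts M" and f: "snd \<xi> \<in> fib_dual B m" using \<xi> by (auto simp: dual_pts_def m_def)
  have dm: "del' \<xi> \<in> dual_pts C" "fst (del' \<xi>) = m"
    using smooth_map_into[OF vb_morphismD(1)[OF mor'], of \<xi>] vb_morphismD(3)[OF mor', of \<xi>] \<xi> by (simp_all add: m_def)
  have ex: "snd (del' \<xi>) \<in> fib_dual C m" using dual_C[OF dm(1)] dm(2) by simp
  \<comment> \<open>The anchor conditions concern core sections only, so \<open>\<xi>\<close> here,
    and c below, must be extended to sections.\<close>
  obtain \<beta> where \<beta>: "\<beta> \<in> Sect (dual B)" "\<beta> m = \<xi>"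
    using Sect_dual_B_through[OF m f] by (metis m_def prod.collapse)
  let ?n = "\<lambda>b\<in>pts (tot B). 0 + (-1) * ell B \<beta> b"
  let ?\<Psi> = "hel (zB m) (\<lambda>u\<in>fib C m. 0)" and ?\<gamma> = "(m, \<lambda>u\<in>fib C m. 0)"
  note hel = hel_dual_pts[OF zeros(2)[OF m] zero_fun_C[OF m]]
  have \<gamma>: "?\<gamma> \<in> dual_pts C" using zero_fun_C[OF m] m by (simp add: dual_pts_def)
  have zBp: "zB m \<in> pts (tot B)" "prj B (zB m) = m" using prj_fib[OF zeros(2)[OF m]] by auto
  have main: "snd (del' \<xi>) c = snd \<xi> (del c)" if c: "c \<in> fib C m" for c
  proof -
    obtain s where s: "s \<in> Sect C" "s m = c" using Sect_C_through[OF c] by blast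
    have dc: "del c \<in> fib B m"
      using smooth_map_into[OF vb_morphismD(1)[OF mor], of c] vb_morphismD(3)[OF mor, of c] c by (simp add: fib_def)
    have n: "pull P fst ?n \<in> smf P" using pull_prj_dual_smf[of ?n DB] neg_ell_smf[OF \<beta>(1)] by simp
    have e: "ell_sect DB (hat s) \<in> smf P" by (rule ell_sect_smf[OF core_section_Sect[OF s(1)]])
    have "pull P (p_hor D) (lie (tot (dual C)) (anch V' \<circ> hat' \<beta>) (ell_sect C s)) ?\<Psi> =
       pb (pull P fst ?n) (ell_sect DB (hat s)) ?\<Psi>"
      using pb_anch[OF core_section_dual_Sect[OF \<beta>(1)] ell_sect_smf[OF s(1)]]
      by (simp only: ell_core_dual_core_section[OF \<beta>(1)] pull_p_hor_ell[OF s(1)])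
    \<comment> \<open>The rules for the bracket have a linear function first and a pulled-back one
      second; antisymmetry brings the arguments into this order.\<close>
    also have "\<dots> = - pb (ell_sect DB (hat s)) (pull P fst ?n) ?\<Psi>"
      using pb_rules(1)[OF n e] hel(1) by simp
    also have "\<dots> = - lie (tot B) (anch V \<circ> hat s) ?n (zB m)"
      using pb_rules(4)[OF core_section_Sect[OF s(1)] neg_ell_smf[OF \<beta>(1)]] hel(1) by (simp add: pull_def)
    also have "lie (tot B) (anch V \<circ> hat s) ?n (zB m) = snd (vertical_lift B (del \<circ> s) (zB m)) ?n"
      using anc[OF s(1) zBp(1)] zBp by (simp add: lie_def)
    also have "\<dots> = deriv (\<lambda>t. ?n (vadd B (zB m) (vscl B t (del c)))) 0"
      using neg_ell_smf[OF \<beta>(1)] zBp s(2) by (simp add: vertical_lift_def)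
    \<comment> \<open>Along the ray from the zero of the fibre the function is linear in t, so the
      derivative defining the vertical lift is its slope.\<close>
    also have "(\<lambda>t. ?n (vadd B (zB m) (vscl B t (del c)))) = (\<lambda>t. - (t * snd \<xi> (del c)))"
    proof
      fix t
      have v: "vscl B t (del c) \<in> fib B m" using vscl_in[OF fvss(4) _ dc] m by simp
      then have "vadd B (zB m) (vscl B t (del c)) = vscl B t (del c)" using vadd_zero_left[OF fvss(4)] m by simp
      then show "?n (vadd B (zB m) (vscl B t (del c))) = - (t * snd \<xi> (del c))"
        using prj_fib[OF v] \<beta>(2) fib_dualD(2)[OF f dc] by (simp add: ell_def)
    qed
    also have "deriv (\<lambda>t. - (t * snd \<xi> (del c))) 0 = - snd \<xi> (del c)"
      by (rule DERIV_imp_deriv) (auto intro!: derivative_eq_intros)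
    finally have R: "pull P (p_hor D) (lie (tot (dual C)) (anch V' \<circ> hat' \<beta>) (ell_sect C s)) ?\<Psi> = snd \<xi> (del c)"
      by (simp only: minus_minus)
    have "pull P (p_hor D) (lie (tot (dual C)) (anch V' \<circ> hat' \<beta>) (ell_sect C s)) ?\<Psi> =
       snd (vertical_lift (dual C) (del' \<circ> \<beta>) ?\<gamma>) (ell_sect C s)"
      using anc'[OF \<beta>(1) \<gamma>] \<gamma> hel by (simp add: pull_def lie_def)
    also have "\<dots> = deriv (\<lambda>t. ell_sect C s (vadd (dual C) ?\<gamma> (vscl (dual C) t (del' \<xi>)))) 0"
      using ell_sect_smf[OF s(1)] \<gamma> \<beta>(2) by (simp add: vertical_lift_def)
    also have "(\<lambda>t. ell_sect C s (vadd (dual C) ?\<gamma> (vscl (dual C) t (del' \<xi>)))) = (\<lambda>t. t * snd (del' \<xi>) c)"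
    proof
      fix t
      note F = vb_fvs[OF vb_dual_C]
      have dx: "del' \<xi> \<in> fib (dual C) m" "?\<gamma> \<in> fib (dual C) m" using dm \<gamma> by (simp_all add: fib_def)
      have "vadd (dual C) ?\<gamma> (vscl (dual C) t (del' \<xi>)) \<in> fib (dual C) m"
        using vadd_in[OF F _ dx(2) vscl_in[OF F _ dx(1)]] m by simp
      then have "vadd (dual C) ?\<gamma> (vscl (dual C) t (del' \<xi>)) \<in> dual_pts C" by (simp add: fib_def)
      then show "ell_sect C s (vadd (dual C) ?\<gamma> (vscl (dual C) t (del' \<xi>))) = t * snd (del' \<xi>) c"
        using s(2) c dm(2) by (simp add: ell_sect_def) (simp add: dual_def)
    qed
    also have "deriv (\<lambda>t. t * snd (del' \<xi>) c) 0 = snd (del' \<xi>) c"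
      by (rule DERIV_imp_deriv) (auto intro!: derivative_eq_intros)
    finally show ?thesis using R by metis
  qed
  have "snd (del' \<xi>) = (\<lambda>u\<in>fib C m. snd \<xi> (del u))"
    by (rule extensionalityI[OF fib_dualD(3)[OF ex] restrict_extensional]) (simp add: main)
  then show ?thesis using dm(2) by (simp add: dual_map_def m_def prod_eq_iff)
qed

text \<open>The bracket of the lift with the core section of \<open>\<beta>\<close> becomes minus
  the derivative of \<open>ell B \<beta>\<close> along the linear vector field of
  \<open>h a\<close>, that is, minus the linear function of \<open>nab' a \<beta>\<close>. The minus
  stands on both sides, so \<open>nab''\<close> and \<open>nab'\<close> have the same values and the
  duality identity carries over.\<close>

lemma connection_dual_B:
  assumes dc: "dual_connection A (anchA V) B nab nab'" and con: "connection A (anchA V') (dual B) nab''"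
    and lie_ell: "\<And>a \<beta>. a \<in> Sect A \<Longrightarrow> \<beta> \<in> Sect (dual B) \<Longrightarrow>
      lie (tot B) (\<lambda>b\<in>pts (tot B). anch V (h a b)) (ell B \<beta>) = ell B (nab' a \<beta>)"
    and brk: "\<And>a \<beta>. a \<in> Sect A \<Longrightarrow> \<beta> \<in> Sect (dual B) \<Longrightarrow> brk V' (hT a) (hat' \<beta>) = hat' (nab'' a \<beta>)"
  shows "dual_connection A (anchA V) B nab nab''"
  unfolding dual_connection_def
proof (intro conjI ballI connection_anchA con)
  fix a \<beta> s m assume a: "a \<in> Sect A" and \<beta>: "\<beta> \<in> Sect (dual B)" and s: "s \<in> Sect B" and "m \<in> pts (bas B)"
  then have m: "m \<in> pts M" by simp
  have b: "s m \<in> fib B m" by (rule Sect_B_fib[OF s m])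
  have n: "nab'' a \<beta> \<in> Sect (dual B)" using con a \<beta> by (simp add: connection_def)
  let ?n = "\<lambda>\<beta>. \<lambda>b\<in>pts (tot B). 0 + (-1) * ell B \<beta> b"
  let ?\<Psi> = "hel (s m) (\<lambda>u\<in>fib C m. 0)"
  note hel = hel_dual_pts[OF b zero_fun_C[OF m]]
  \<comment> \<open>\<open>lie\<close> looks at points of \<open>tot B\<close> only, so the
    restricted field and the composite give the same derivative.\<close>
  have l: "lie (tot B) (anch V \<circ> h a) (ell B \<beta>) = ell B (nab' a \<beta>)"
    unfolding lie_ell[OF a \<beta>, symmetric] by (auto simp: lie_def intro!: restrict_ext)
  have ell: "ell B \<beta> \<in> smf (tot B)" by (rule ell_smf[OF vbs(4) \<beta>])
  then have pell: "pull P fst (ell B \<beta>) \<in> smf P" using pull_prj_dual_smf[of _ DB] by simp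
  have pn: "pull P fst (?n \<beta>) = (\<lambda>x\<in>pts P. (-1) * pull P fst (ell B \<beta>) x)"
    unfolding pull_def
  proof (rule restrict_ext)
    fix x assume "x \<in> pts P"
    then show "?n \<beta> (fst x) = (-1) * (\<lambda>x\<in>pts P. ell B \<beta> (fst x)) x"
      by (auto simp: dual_pts_def)
  qed
  have "pull P fst (?n (nab'' a \<beta>)) = pb (ell_sect DB (h a)) (pull P fst (?n \<beta>))"
    using pb_brk[OF dual_lift_Sect[OF a] core_section_dual_Sect[OF \<beta>]]
    unfolding brk[OF a \<beta>] ell_core_dual_core_section[OF n] ell_core_dual_core_section[OF \<beta>] ell_hT[OF a] .
  also have "\<dots> = (\<lambda>x\<in>pts P. (-1) * pb (ell_sect DB (h a)) (pull P fst (ell B \<beta>)) x)"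
    unfolding pn by (rule pb_rules(2)[OF ell_sect_smf[OF h_Sect[OF a]] pell])
  also have "\<dots> = (\<lambda>x\<in>pts P. (-1) * pull P fst (ell B (nab' a \<beta>)) x)"
    unfolding pb_rules(4)[OF h_Sect[OF a] ell] l ..
  finally have "pull P fst (?n (nab'' a \<beta>)) ?\<Psi> = (\<lambda>x\<in>pts P. (-1) * pull P fst (ell B (nab' a \<beta>)) x) ?\<Psi>"
    by (rule fun_cong)
  then have "snd (nab'' a \<beta> m) (s m) = snd (nab' a \<beta> m) (s m)"
    using hel(1) prj_fib[OF b] by (simp add: pull_def ell_def)
  then show "pairing B (nab'' a \<beta>) s m + pairing B \<beta> (nab a s) m = lie (bas B) (anchA V \<circ> a) (pairing B \<beta> s) m"
    using dc a \<beta> s m by (auto simp: dual_connection_def pairing_def)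
qed

text \<open>The canonical map from C to its bidual. The connection on the dual of C is tied to the
  anchor through linear functions of sections of the bidual, and evaluation at c is the one whose
  linear function is that of c.\<close>

lemma evaluation_Sect:
  assumes c: "c \<in> Sect C"
  shows "(\<lambda>m\<in>pts M. (m, \<lambda>\<xi>\<in>fib (dual C) m. snd \<xi> (c m))) \<in> Sect (dual (dual C))"
proof -
  let ?e = "\<lambda>m. (m, \<lambda>\<xi>\<in>fib (dual C) m. snd \<xi> (c m))"
  have dp: "?e m \<in> dual_pts (dual C)" if m: "m \<in> pts M" for m
  proof -
    note F = vb_fvs[OF vb_dual_C]
    have "(\<lambda>\<xi>\<in>fib (dual C) m. snd \<xi> (c m)) \<in> fib_dual (dual C) m"
      unfolding fib_dual_def
    proof (intro CollectI conjI ballI allI)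
      fix u assume u: "u \<in> fib (dual C) m"
      have "vscl (dual C) r u \<in> fib (dual C) m" for r using vscl_in[OF F _ u] m by simp
      then show "(\<lambda>\<xi>\<in>fib (dual C) m. snd \<xi> (c m)) (vscl (dual C) r u) = r * (\<lambda>\<xi>\<in>fib (dual C) m. snd \<xi> (c m)) u" for r
        using u prj_fib(1)[OF u] Sect_C_fib[OF c m] by (simp del: prj_dual) (simp add: dual_def)
      fix v assume v: "v \<in> fib (dual C) m"
      have "vadd (dual C) u v \<in> fib (dual C) m" using vadd_in[OF F _ u v] m by simp
      then show "(\<lambda>\<xi>\<in>fib (dual C) m. snd \<xi> (c m)) (vadd (dual C) u v) =
         (\<lambda>\<xi>\<in>fib (dual C) m. snd \<xi> (c m)) u + (\<lambda>\<xi>\<in>fib (dual C) m. snd \<xi> (c m)) v"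
        using u v prj_fib(1)[OF u] Sect_C_fib[OF c m] by (simp del: prj_dual) (simp add: dual_def)
    qed simp
    then show ?thesis using m by (simp add: dual_pts_def[of "dual C"])
  qed
  have "smooth_map M (tot (dual (dual C))) ?e"
  proof (rule smooth_map_into_dual[OF satM])
    show "?e \<in> pts M \<rightarrow> dual_pts (dual C)" using dp by blast
    show "smooth_map M (bas (dual C)) (\<lambda>m. fst (?e m))" using smooth_map_id[OF satM] by simp
    fix \<eta> assume \<eta>: "\<eta> \<in> Sect (dual C)"
    have "(\<lambda>m\<in>pts M. snd (?e m) (\<eta> (fst (?e m)))) = pairing C \<eta> c"
      unfolding pairing_def bases
      by (rule restrict_ext) (use Sect_fib[OF \<eta>] in simp)
    then show "(\<lambda>m\<in>pts M. snd (?e m) (\<eta> (fst (?e m)))) \<in> smf M" using pairing_smf[OF \<eta> c] by simp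
  qed
  then have "restrict ?e (pts (bas (dual (dual C)))) \<in> Sect (dual (dual C))"
    by (intro SectI) auto
  then show ?thesis by simp
qed

text \<open>The dual of \<open>nab'\<close> on the bidual, applied to evaluation at c, is the anchor
  of the lift acting on the linear function of c; the bracket turns this into the linear function of
  the core section of \<open>nab a c\<close>. So the duality between the dual of C and the bidual,
  read on evaluations, is the one between C and its dual, up to the anchor of A, which
  \<open>lie_anchA\<close> exchanges.\<close>

lemma connection_dual_C:
  assumes con0: "connection A (anchA V) C nab" and con: "connection A (anchA V') (dual C) nab'"
    and dc: "dual_connection A (anchA V') (dual C) nab' nab''"
    and lie_ell: "\<And>a \<phi>. a \<in> Sect A \<Longrightarrow> \<phi> \<in> Sect (dual (dual C)) \<Longrightarrow>
      lie (tot (dual C)) (\<lambda>\<gamma>\<in>dual_pts C. anch V' (hT a \<gamma>)) (ell (dual C) \<phi>) = ell (dual C) (nab'' a \<phi>)"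
    and brk: "\<And>a c. a \<in> Sect A \<Longrightarrow> c \<in> Sect C \<Longrightarrow> brk V (h a) (hat c) = hat (nab a c)"
  shows "dual_connection A (anchA V) C nab nab'"
  unfolding dual_connection_def
proof (intro conjI ballI connection_anchA con)
  fix a \<eta> c m assume a: "a \<in> Sect A" and \<eta>: "\<eta> \<in> Sect (dual C)" and c: "c \<in> Sect C" and "m \<in> pts (bas C)"
  then have m: "m \<in> pts M" by simp
  let ?e = "\<lambda>m\<in>pts M. (m, \<lambda>\<xi>\<in>fib (dual C) m. snd \<xi> (c m))"
  note e = evaluation_Sect[OF c]
  have nc: "nab a c \<in> Sect C" using con0 a c by (simp add: connection_def)
  have n\<eta>: "nab' a \<eta> \<in> Sect (dual C)" using con a \<eta> by (simp add: connection_def)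
  have \<eta>m: "\<eta> m \<in> dual_pts C" "fst (\<eta> m) = m" "snd (\<eta> m) \<in> fib_dual C m" "\<eta> m \<in> fib (dual C) m"
    using Sect_dual_fib[OF \<eta>, of m] Sect_fib[OF \<eta>, of m] m by simp_all
  \<comment> \<open>A point of \<open>D_B^*\<close> that projects to \<open>\<eta> m\<close>, so
    that functions on the dual of C can be evaluated there after pulling back.\<close>
  let ?\<Psi> = "hel (zB m) (snd (\<eta> m))"
  note hel = hel_dual_pts[OF zeros(2)[OF m] \<eta>m(3)]
  have ph: "p_hor D ?\<Psi> = \<eta> m" using hel(2) \<eta>m(2) by (simp add: prod_eq_iff)
  have p1: "pairing (dual C) ?e \<eta> = pairing C \<eta> c"
    unfolding pairing_def bases bas_dual
    by (rule restrict_ext) (use Sect_fib[OF \<eta>] in simp)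
  have p2: "pairing (dual C) ?e (nab' a \<eta>) m = pairing C (nab' a \<eta>) c m"
    using Sect_fib[OF n\<eta>, of m] m by (simp add: pairing_def)
  have ee: "ell (dual C) ?e = ell_sect C c"
    unfolding ell_def ell_sect_def pts_dual
  proof (rule restrict_ext)
    fix \<gamma> assume "\<gamma> \<in> dual_pts C"
    then show "snd (?e (prj (dual C) \<gamma>)) \<gamma> = snd \<gamma> (c (fst \<gamma>))" using dual_C[of \<gamma>] dual_C_D[of \<gamma>] by simp
  qed
  have "pairing (dual C) (nab'' a ?e) \<eta> m = ell (dual C) (nab'' a ?e) (\<eta> m)"
    using m \<eta>m by (simp add: pairing_def ell_def)
  also have "\<dots> = lie (tot (dual C)) (\<lambda>\<gamma>\<in>dual_pts C. anch V' (hT a \<gamma>)) (ell_sect C c) (\<eta> m)"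
    unfolding lie_ell[OF a e, symmetric] ee ..
  also have "\<dots> = pull P (p_hor D) (lie (tot (dual C)) (anch V' \<circ> hT a) (ell_sect C c)) ?\<Psi>"
    using ph hel(1) \<eta>m(1) by (simp add: pull_def lie_def)
  also have "\<dots> = pb (ell_sect DB (h a)) (ell_sect DB (hat c)) ?\<Psi>"
    unfolding pb_anch[OF dual_lift_Sect[OF a] ell_sect_smf[OF c]] ell_hT[OF a] pull_p_hor_ell[OF c] ..
  also have "\<dots> = ell_sect DB (hat (nab a c)) ?\<Psi>"
    unfolding pb_rules(3)[OF h_Sect[OF a] core_section_Sect[OF c]] brk[OF a c] ..
  also have "\<dots> = snd (\<eta> m) (nab a c m)"
    using hel(1) core_section_eq[of "zB m" m "nab a c", OF zeros(2)[OF m] Sect_C_fib[OF nc m]]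
      hel_sigma[OF zeros(1)[OF m] zeros(2)[OF m] Sect_C_fib[OF nc m]] by (simp add: ell_sect_def)
  finally have p3: "pairing (dual C) (nab'' a ?e) \<eta> m = pairing C \<eta> (nab a c) m"
    using m by (simp add: pairing_def)
  have "pairing (dual C) (nab'' a ?e) \<eta> m + pairing (dual C) ?e (nab' a \<eta>) m =
      lie (bas (dual C)) (anchA V' \<circ> a) (pairing (dual C) ?e \<eta>) m"
    using dc a e \<eta> m unfolding dual_connection_def by auto
  then have "pairing C \<eta> (nab a c) m + pairing C (nab' a \<eta>) c m = lie M (anchA V' \<circ> a) (pairing C \<eta> c) m"
    unfolding p1 p2 p3 by simp
  moreover have "pairing C \<eta> c \<in> smf M" using pairing_smf[OF \<eta> c] by simp
  ultimately show "pairing C (nab' a \<eta>) c m + pairing C \<eta> (nab a c) m = lie (bas C) (anchA V \<circ> a) (pairing C \<eta> c) m"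
    using lie_anchA[OF a] by simp
qed

text \<open>The bracket of the two lifts gives the same function on \<open>D_B^*\<close> from either
  side. At the test point over b and \<open>\<gamma>\<close> both horizontal parts contribute
  \<open>snd \<gamma> (zC m)\<close>, which is 0, so the brackets in A drop out. There remain
  \<open>snd \<gamma> (K b)\<close> from \<open>V\<close> and, by the sign of the pairing, minus the
  value of \<open>K' \<gamma>\<close> on b from \<open>V'\<close>.\<close>

lemma curvature_dual:
  assumes K: "vb_morphism B C K (\<lambda>m. m)" and K': "vb_morphism (dual C) (dual B) K' (\<lambda>m. m)"
    and a: "a1 \<in> Sect A" "a2 \<in> Sect A"
    and brk: "brk V (h a1) (h a2) = sadd DB (h (brkA V a1 a2)) (hom_hat D (\<lambda>c. c) K)"
    and brk': "brk V' (hT a1) (hT a2) =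
      sadd (overB (vertical_dual D)) (hT (brkA V' a1 a2)) (hom_hat (vertical_dual D) (ver_core D) K')"
    and \<gamma>: "\<gamma> \<in> dual_pts C"
  shows "K' \<gamma> = vscl (dual B) (-1) (dual_map B C K \<gamma>)"
proof -
  define m where "m = fst \<gamma>"
  have m: "m \<in> pts M" and g: "snd \<gamma> \<in> fib_dual C m" using dual_C[OF \<gamma>] by (simp_all add: m_def)
  have k: "K' \<gamma> \<in> dual_pts B" "fst (K' \<gamma>) = m"
    using smooth_map_into[OF vb_morphismD(1)[OF K'], of \<gamma>] vb_morphismD(3)[OF K', of \<gamma>] \<gamma> by (simp_all add: m_def)
  have f: "snd (K' \<gamma>) \<in> fib_dual B m" using k by (auto simp: dual_pts_def)
  note bA = brkA_Sect[OF a]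
  have main: "snd (K' \<gamma>) b = - snd \<gamma> (K b)" if b: "b \<in> fib B m" for b
  proof -
    have bp: "b \<in> pts (tot B)" "prj B b = m" using prj_fib[OF b] by auto
    have Kb: "K b \<in> fib C m"
      using smooth_map_into[OF vb_morphismD(1)[OF K], of b] vb_morphismD(3)[OF K, of b] bp by (simp add: fib_def)
    let ?\<Psi> = "hel b (snd \<gamma>)"
    note hel = hel_dual_pts[OF b g]
    have ph: "p_hor D ?\<Psi> = \<gamma>" using hel(2) by (simp add: m_def)
    note al = Sect_A_fib[OF bA(1) m] and al' = Sect_A_fib[OF bA(2) m]
    have g0: "snd \<gamma> (zC m) = 0" using fib_dual_vzero[OF fvs_C _ g] m by simp
    have hP: "snd ?\<Psi> \<in> fib_dual DB b" using hel(1) by (auto simp: dual_pts_def hel_def)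
    have "brk V' (hT a1) (hT a2) \<gamma> = ver_add D (hT (brkA V' a1 a2) \<gamma>) (hom_hat (vertical_dual D) (ver_core D) K' \<gamma>)"
      unfolding brk' sadd_def using \<gamma> by simp
    also have "\<dots> = vel (brkA V' a1 a2 m) (snd \<gamma>) (snd (K' \<gamma>))"
      using hom_hat_dual_eq[OF \<gamma>, of K'] k dual_lift_eq[OF bA(2)] \<gamma> ver_add_vel[OF al' g f] by (simp add: m_def)
    finally have v: "brk V' (hT a1) (hT a2) (p_hor D ?\<Psi>) = vel (brkA V' a1 a2 m) (snd (p_hor D ?\<Psi>)) (snd (K' \<gamma>))"
      unfolding ph .
    have b': "fst ?\<Psi> \<in> fib B m" using b by simp
    have "ell_core_dual D (brk V' (hT a1) (hT a2)) ?\<Psi> = snd ?\<Psi> (\<sigma> (brkA V' a1 a2 m, fst ?\<Psi>, zC m)) - snd (K' \<gamma>) (fst ?\<Psi>)"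
      by (rule ell_core_dual_vel[where m = m and \<Theta> = "brk V' (hT a1) (hT a2)", OF hel(1) b' v al' f])
    also have "\<dots> = - snd (K' \<gamma>) b" using hel_sigma[OF al' b zC[OF m]] g0 by simp
    finally have L: "ell_core_dual D (brk V' (hT a1) (hT a2)) ?\<Psi> = - snd (K' \<gamma>) b" .
    have "ell_core_dual D (brk V' (hT a1) (hT a2)) ?\<Psi> = ell_sect DB (brk V (h a1) (h a2)) ?\<Psi>"
      unfolding pb_brk[OF dual_lift_Sect[OF a(1)] dual_lift_Sect[OF a(2)]] ell_hT[OF a(1)] ell_hT[OF a(2)]
        pb_rules(3)[OF h_Sect[OF a(1)] h_Sect[OF a(2)]] ..
    also have "\<dots> = snd ?\<Psi> (vadd DB (\<sigma> (brkA V a1 a2 m, b, zC m)) (\<sigma> (zA m, b, K b)))"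
      unfolding brk using hel(1) bp h_sigma[OF bA(1) b] zero_DB_plus_core[OF b Kb]
      by (simp add: ell_sect_def sadd_def hom_hat_def)
    also have "\<dots> = snd \<gamma> (K b)"
      using fib_dualD(1)[OF hP sigma_fib(2)[OF al b zC[OF m]] sigma_fib(2)[OF zeros(1)[OF m] b Kb]]
        hel_sigma[OF al b zC[OF m]] hel_sigma[OF zeros(1)[OF m] b Kb] g0 by simp
    finally show ?thesis using L by simp
  qed
  have "snd (K' \<gamma>) = (\<lambda>u\<in>fib B m. - snd \<gamma> (K u))"
    by (rule extensionalityI[OF fib_dualD(3)[OF f] restrict_extensional]) (simp add: main)
  also have "\<dots> = snd (vscl (dual B) (-1) (dual_map B C K \<gamma>))"
    by (auto simp: dual_def dual_map_def m_def intro!: restrict_ext)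
  finally show ?thesis using k(2) by (simp add: prod_eq_iff) (simp add: dual_def dual_map_def m_def)
qed

end

text \<open>Equality with the dual connection is expressed by its defining identity
  \<open>dual_connection\<close>. The indices cross: the dual of B sits in degree 0 of the dual
  representation, so \<open>nab_ver0\<close> is dual to \<open>nab1\<close> and
  \<open>nab_ver1\<close> to \<open>nab0\<close>.\<close>

theorem propositionA1:
  fixes V :: "('d, 'a, 'b, 'm) vbalg"
    and D :: "('d, 'a, 'b, 'm) dvbun"
    and A :: "('a, 'm) vbun" and B :: "('b, 'm) vbun" and C :: "('d, 'm) vbun"
    and V' :: "('a \<times> ('d \<Rightarrow> real), 'a, 'm \<times> ('d \<Rightarrow> real), 'm) vbalg"
  assumes "D = dvb V" and "A = sideA D" and "B = sideB D" and "C = core D"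
    and "vb_algebroid V"
    and "horizontal_lift D h"
    and "decomposition_of_lift D h \<sigma>"
    and "dual_vb_algebroid V V'"
    and "structure_operators V C (\<lambda>c. c) h del nab0 nab1 K"
    and "structure_operators V' (dual B) (ver_core D) (dual_lift D \<sigma>)
           del_ver nab_ver0 nab_ver1 K_ver"
  shows "(\<forall>\<beta>\<in>pts (tot (dual B)). del_ver \<beta> = dual_map C B del \<beta>) \<and>
    dual_connection A (anchA V) B nab1 nab_ver0 \<and>
    dual_connection A (anchA V) C nab0 nab_ver1 \<and>
    (\<forall>a1\<in>Sect A. \<forall>a2\<in>Sect A. \<forall>\<gamma>\<in>pts (tot (dual C)).
       K_ver a1 a2 \<gamma> = vscl (dual B) (-1) (dual_map B C (K a1 a2) \<gamma>))"
proof -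
  note eqs = assms(2-4)
  have V': "vb_algebroid V'" "dvb V' = vertical_dual D"
    using assms(8) unfolding dual_vb_algebroid_def Let_def assms(1) by auto
  obtain pb where pb: "dual_poisson V pb"
    "\<And>\<Theta>1 \<Theta>2. \<Theta>1 \<in> Sect (overB (vertical_dual D)) \<Longrightarrow> \<Theta>2 \<in> Sect (overB (vertical_dual D)) \<Longrightarrow>
      ell_core_dual D (brk V' \<Theta>1 \<Theta>2) = pb (ell_core_dual D \<Theta>1) (ell_core_dual D \<Theta>2)"
    "\<And>\<Theta> g. \<Theta> \<in> Sect (overB (vertical_dual D)) \<Longrightarrow> g \<in> smf (tot (dual (core D))) \<Longrightarrow>
      pull (tot (dual (overB D))) (p_hor D) (lie (tot (dual (core D))) (anch V' \<circ> \<Theta>) g) =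
      pb (ell_core_dual D \<Theta>) (pull (tot (dual (overB D))) (p_hor D) g)"
    using assms(8) unfolding dual_vb_algebroid_def Let_def assms(1)[symmetric] by blast
  interpret dual_vb_algebroids D \<sigma> V V' h pb
  proof
    show "double_vector_bundle D" using assms(5) unfolding vb_algebroid_def Let_def assms(1) by blast
    show "double_vector_bundle (vertical_dual D)" using V' unfolding vb_algebroid_def Let_def by metis
    show "decomposition D \<sigma>" using assms(7) by (simp add: decomposition_of_lift_def)
  qed (use assms V' pb in auto)
  note so = assms(9)[unfolded structure_operators_def Let_def eqs, folded assms(1)]
  note so' = assms(10)[unfolded structure_operators_def Let_def V'(2) vertical_dual_simps eqs pts_dual]
  have op: "vb_morphism (core D) (sideB D) del (\<lambda>m. m)" "connection (sideA D) (anchA V) (core D) nab0"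
    "hom_two_form (sideA D) (sideB D) (core D) K"
    "\<And>c b. c \<in> Sect (core D) \<Longrightarrow> b \<in> pts (tot (sideB D)) \<Longrightarrow>
      anch V (core_section D (\<lambda>c. c) c b) = vertical_lift (sideB D) (del \<circ> c) b"
    "\<And>a c. a \<in> Sect (sideA D) \<Longrightarrow> c \<in> Sect (core D) \<Longrightarrow>
      brk V (h a) (core_section D (\<lambda>c. c) c) = core_section D (\<lambda>c. c) (nab0 a c)"
    "\<And>a1 a2. a1 \<in> Sect (sideA D) \<Longrightarrow> a2 \<in> Sect (sideA D) \<Longrightarrow> brk V (h a1) (h a2) =
      sadd (overB D) (h (brkA V a1 a2)) (hom_hat D (\<lambda>c. c) (K a1 a2))"
    using so by meson+
  obtain nab1' where n1: "dual_connection (sideA D) (anchA V) (sideB D) nab1 nab1'"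
     "\<And>a \<psi>. a \<in> Sect (sideA D) \<Longrightarrow> \<psi> \<in> Sect (dual (sideB D)) \<Longrightarrow>
        lie (tot (sideB D)) (\<lambda>b\<in>pts (tot (sideB D)). anch V (h a b)) (ell (sideB D) \<psi>) = ell (sideB D) (nab1' a \<psi>)"
    using so by meson
  have op': "vb_morphism (dual (sideB D)) (dual (core D)) del_ver (\<lambda>m. m)"
    "connection (sideA D) (anchA V') (dual (sideB D)) nab_ver0"
    "connection (sideA D) (anchA V') (dual (core D)) nab_ver1"
    "hom_two_form (sideA D) (dual (core D)) (dual (sideB D)) K_ver"
    "\<And>\<beta> \<gamma>. \<beta> \<in> Sect (dual (sideB D)) \<Longrightarrow> \<gamma> \<in> dual_pts (core D) \<Longrightarrow>
      anch V' (core_section (vertical_dual D) (ver_core D) \<beta> \<gamma>) = vertical_lift (dual (core D)) (del_ver \<circ> \<beta>) \<gamma>"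
    "\<And>a \<beta>. a \<in> Sect (sideA D) \<Longrightarrow> \<beta> \<in> Sect (dual (sideB D)) \<Longrightarrow>
      brk V' (dual_lift D \<sigma> a) (core_section (vertical_dual D) (ver_core D) \<beta>) =
      core_section (vertical_dual D) (ver_core D) (nab_ver0 a \<beta>)"
    "\<And>a1 a2. a1 \<in> Sect (sideA D) \<Longrightarrow> a2 \<in> Sect (sideA D) \<Longrightarrow> brk V' (dual_lift D \<sigma> a1) (dual_lift D \<sigma> a2) =
      sadd (overB (vertical_dual D)) (dual_lift D \<sigma> (brkA V' a1 a2))
        (hom_hat (vertical_dual D) (ver_core D) (K_ver a1 a2))"
    using so' by meson+
  obtain nab2' where n2: "dual_connection (sideA D) (anchA V') (dual (core D)) nab_ver1 nab2'"
     "\<And>a \<psi>. a \<in> Sect (sideA D) \<Longrightarrow> \<psi> \<in> Sect (dual (dual (core D))) \<Longrightarrow>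
        lie (tot (dual (core D))) (\<lambda>b\<in>dual_pts (core D). anch V' (dual_lift D \<sigma> a b)) (ell (dual (core D)) \<psi>) =
        ell (dual (core D)) (nab2' a \<psi>)"
    using so' by meson
  show ?thesis
    unfolding pts_dual eqs
  proof (intro conjI ballI)
    show "del_ver \<beta> = dual_map (core D) (sideB D) del \<beta>" if "\<beta> \<in> dual_pts (sideB D)" for \<beta>
      by (rule differential_dual[OF op(1) op'(1) op(4) op'(5) that])
    show "dual_connection (sideA D) (anchA V) (sideB D) nab1 nab_ver0"
      by (rule connection_dual_B[OF n1(1) op'(2) n1(2) op'(6)])
    show "dual_connection (sideA D) (anchA V) (core D) nab0 nab_ver1"
      by (rule connection_dual_C[OF op(2) op'(3) n2(1,2) op(5)])
    fix a1 a2 \<gamma> assume a: "a1 \<in> Sect (sideA D)" "a2 \<in> Sect (sideA D)" and \<gamma>: "\<gamma> \<in> dual_pts (core D)"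
    have "vb_morphism (sideB D) (core D) (K a1 a2) (\<lambda>m. m)"
      "vb_morphism (dual (core D)) (dual (sideB D)) (K_ver a1 a2) (\<lambda>m. m)"
      using op(3) op'(4) a unfolding hom_two_form_def by blast+
    then show "K_ver a1 a2 \<gamma> = vscl (dual (sideB D)) (-1) (dual_map (sideB D) (core D) (K a1 a2) \<gamma>)"
      by (rule curvature_dual[OF _ _ a op(6)[OF a] op'(7)[OF a] \<gamma>])
  qed
qed

end
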